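(* Suppose $\mathfrak{C}=\mathfrak{C}_{AR(1)}$ and the weights $w(j,n)$ are admissible. Suppose one of the following scenarios applies: (S1) $e_+\in\mathfrak{M}$ with $R\hat\beta(e_+)=0$ and $e_-\notin\mathfrak{M}$; $k+1<n$; and $\bar X=(X,e_-)$ (which necessarily has rank $k+1$) satisfies the rank condition relative to $\bar R=(R,0)\in\mathbb{R}^{q\times(k+1)}$. Define $\bar\beta(y)=(I_k,0)(\bar X'\bar X)^{-1}\bar X'y$. (S2) $e_+\notin\mathfrak{M}$ and $e_-\in\mathfrak{M}$ with $R\hat\beta(e_-)=0$; $k+1<n$; and $\bar X=(X,e_+)$ (necessarily of rank $k+1$) satisfies the rank condition relative to $\bar R=(R,0)\in\mathbb{R}^{q\times(k+1)}$. Define $\bar\beta(y)=(I_k,0)(\bar X'\bar X)^{-1}\bar X'y$. (S3) $e_+\notin\mathfrak{M}$ and $e_-\notin\mathfrak{M}$ with $\operatorname{rank}(X,e_+,e_-)=k+2$; $k+2<n$; and $\bar X=(X,e_+,e_-)$ satisfies the rank condition relative to $\bar R=(R,0,0)\in\mathbb{R}^{q\times(k+2)}$. Define $\bar\beta(y)=(I_k,0,0)(\bar X'\bar X)^{-1}\bar X'y$. (S4) $e_+\notin\mathfrak{M}$ and $e_-\notin\mathfrak{M}$ with $\operatorname{rank}(X,e_+,e_-)=k+1$; $k+1<n$; $\bar X=(X,e_+)$ (necessarily of rank $k+1$) satisfies the rank condition relative to $\bar R=(R,0)\in\mathbb{R}^{q\times(k+1)}$; and $\bar R(\bar X'\bar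 X)^{-1}\bar X'e_-=0$. Define $\bar\beta(y)=(I_k,0)(\bar X'\bar X)^{-1}\bar X'y$. (S5) $e_+\notin\mathfrak{M}$ and $e_-\notin\mathfrak{M}$ with $\operatorname{rank}(X,e_+,e_-)=k+1$; $k+1<n$; $\bar X=(X,e_-)$ (necessarily of rank $k+1$) satisfies the rank condition relative to $\bar R=(R,0)\in\mathbb{R}^{q\times(k+1)}$; and $\bar R(\bar X'\bar X)^{-1}\bar X'e_+=0$. Define $\bar\beta(y)=(I_k,0)(\bar X'\bar X)^{-1}\bar X'y$. In all five scenarios define $\bar T(y)=(R\bar\beta(y)-r)'\bar\Omega_w^{-1}(y)(R\bar\beta(y)-r)$ if $\det\bar\Omega_w(y)\ne0$ and $\bar T(y)=0$ if $\det\bar\Omega_w(y)=0$, where $\bar\Omega_w(y)=n\bar R(\bar X'\bar X)^{-1}\bar\Psi_w(y)(\bar X'\bar X)^{-1}\bar R'$ and $\bar\Psi_w$ is the weighted autocovariance matrix based on $\bar X$ (see context). For $0<C<\infty$ let $\bar W(C)=\{y\in\mathbb{R}^n:\bar T(y)\ge C\}$. Then for each of the five scenarios the following holds for every $0<C<\infty$ (in items 1–3): 1. $\sup_{\mu_0\in\mathfrak{M}_0}\sup_{0<\sigma^2<\infty}\sup_{-1<\rho<1}P_{\mu_0,\sigma^2\Lambda(\rho)}(\bar W(C))<1$ and $\inf_{\mu_0\in\mathfrak{M}_0}\inf_{0<\sigma^2<\infty}\inf_{-1<\rho<1}P_{\mu_0,\sigma^2\Lambda(\rho)}(\bar W(C))>0$.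 2. $\inf_{\mu_1\in\mathfrak{M}_1}\inf_{0<\sigma^2<\infty}\inf_{-1<\rho<1}P_{\mu_1,\sigma^2\Lambda(\rho)}(\bar W(C))>0$. 3. For every $0<c<\infty$ and every sequence $\rho_m\in(-1,1)$ with $|\rho_m|\to1$, $$\inf_{\mu_1\in\mathfrak{M}_1,\ 0<\sigma^2<\infty,\ d(\mu_1,\mathfrak{M}_0)/\sigma\ge c}P_{\mu_1,\sigma^2\Lambda(\rho_m)}(\bar W(C))\to1\quad(m\to\infty).$$ Furthermore, for every sequence $0<c_m<\infty$ and every $0<\varepsilon<1$, $$\inf_{\mu_1\in\mathfrak{M}_1,\ d(\mu_1,\mathfrak{M}_0)\ge c_m}\ \inf_{-1+\varepsilon\le\rho\le1-\varepsilon}P_{\mu_1,\sigma_m^2\Lambda(\rho)}(\bar W(C))\to1\quad(m\to\infty)$$ whenever $0<\sigma_m^2<\infty$ and $c_m/\sigma_m\to\infty$. 4. For every $0<\delta<1$ there exists $C(\delta)$, $0<C(\delta)<\infty$, such that $\sup_{\mu_0\in\mathfrak{M}_0}\sup_{0<\sigma^2<\infty}\sup_{-1<\rho<1}P_{\mu_0,\sigma^2\Lambda(\rho)}(\bar W(C(\delta)))\le\delta$.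
   Context: Framework: $n,k,q$ are integers with $1\le k<n$, $q\ge1$; $X$ is a fixed real $n\times k$ matrix of rank $k$; $R$ is a fixed real $q\times k$ matrix of rank $q$; $r\in\mathbb{R}^q$. $\mathfrak{M}=\operatorname{span}(X)$, $\mathfrak{M}_0=\{X\beta:\beta\in\mathbb{R}^k,\ R\beta=r\}$, $\mathfrak{M}_1=\mathfrak{M}\setminus\mathfrak{M}_0$. $P_{\mu,\Phi}$ is the Gaussian measure on $\mathbb{R}^n$ with mean $\mu$ and covariance matrix $\Phi$. $\mathfrak{C}$ is the covariance model: the observation is distributed as $P_{\mu,\sigma^2\Sigma}$ with $\Sigma\in\mathfrak{C}$, null hypothesis $\mu\in\mathfrak{M}_0$ and alternative $\mu\in\mathfrak{M}_1$. $\hat\beta(y)=(X'X)^{-1}X'y$; $d(x,A)$ is the Euclidean distance from $x$ to $A$; $\sigma,\sigma_m$ denote positive square roots; $I_k$ is the identity matrix. $\Lambda(\rho)$ is the $n\times n$ matrix with $(i,j)$ entry $\rho^{|i-j|}$; $\mathfrak{C}_{AR(1)}=\{\Lambda(\rho):\rho\in(-1,1)\}$. $e_+=(1,\dots,1)'$, $e_-=(-1,1,\dots,(-1)^n)'$ in $\mathbb{R}^n$; $e_i(n)$ is the $i$-th standard basis vector. The weights $w(j,n)$, $j=-(n-1),\dots,n-1$, are data-independent reals; admissible means $w(0,n)=1$, $w(-j,n)=w(j,n)$, and the Toeplitz matrix $(w(i-j,n))_{i,j=1}^n$ is positive definite. Weighted autocovariance matrix based on $\bar X$: let $\bar u(y)=y-\bar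 X(\bar X'\bar X)^{-1}\bar X'y$ with coordinates $\bar u_t(y)$, $\bar x_{t\cdot}$ the $t$-th row of $\bar X$, $\bar v_t(y)=\bar u_t(y)\bar x_{t\cdot}'$, $\bar\Gamma_j(y)=n^{-1}\sum_{t=j+1}^n\bar v_t(y)\bar v_{t-j}(y)'$ for $j\ge0$, $\bar\Gamma_j(y)=\bar\Gamma_{-j}(y)'$ for $j<0$, and $\bar\Psi_w(y)=\sum_{j=-(n-1)}^{n-1}w(j,n)\bar\Gamma_j(y)$. Rank condition of $\bar X$ relative to $\bar R$: let $i_1<\dots<i_s$ be all indices $i$ with $e_i(n)\in\operatorname{span}(\bar X)$ ($s=0$ if there are none) and let $\bar X'(\neg(i_1,\dots,i_s))$ be $\bar X'$ with the columns with these indices deleted; then $\operatorname{rank}(\bar R(\bar X'\bar X)^{-1}\bar X'(\neg(i_1,\dots,i_s)))=q$. *)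

theory Defs
  imports "HOL-Probability.Probability"
begin

text \<open>
  The sample size, the number of regressors and the number of restrictions are the
  cardinalities of index types \<open>'n\<close>, \<open>'k\<close>, \<open>'q\<close>, so they are at least 1.
  Only observations need an order; \<open>'n\<close> is a finite linearly ordered type and
  \<open>time\<close> is the order isomorphism from it onto \<open>{1..n}\<close>.
\<close>

definition time :: "'n::{finite,linorder} \<Rightarrow> nat" where
  "time i = card {j. j \<le> i}"

definition obs :: "nat \<Rightarrow> 'n::{finite,linorder}" where
  "obs t = inv time t"

lemma bij_betw_time: "bij_betw time (UNIV :: 'n::{finite,linorder} set) {1..CARD('n)}"
proof -
  have "strict_mono (time :: 'n \<Rightarrow> nat)"
  proof (rule strict_monoI)
    fix x y :: 'n
    assume "x < y"
    then have "{j. j \<le> x} \<subset> {j. j \<le> y}"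
      by (auto intro: order_trans less_imp_le simp: psubset_eq set_eq_iff dest: leD)
    then show "time x < time y"
      by (simp add: time_def psubset_card_mono)
  qed
  then have inj: "inj (time :: 'n \<Rightarrow> nat)"
    by (rule strict_mono_imp_inj_on)
  have "1 \<le> time i" "time i \<le> CARD('n)" for i :: 'n
    by (auto simp: time_def Suc_le_eq card_gt_0_iff intro: card_mono)
  then have sub: "range (time :: 'n \<Rightarrow> nat) \<subseteq> {1..CARD('n)}"
    by auto
  have "card (range (time :: 'n \<Rightarrow> nat)) = CARD('n)"
    using inj by (simp add: card_image)
  then have "range (time :: 'n \<Rightarrow> nat) = {1..CARD('n)}"
    using sub by (intro card_subset_eq) auto
  with inj show ?thesis by (simp add: bij_betw_def)
qed

lemma time_obs:
  assumes "1 \<le> t" and "t \<le> CARD('n)"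
  shows "time (obs t :: 'n::{finite,linorder}) = t"
proof -
  have "t \<in> range (time :: 'n \<Rightarrow> nat)"
    using bij_betw_time[where 'n='n] assms by (simp add: bij_betw_def)
  then show ?thesis
    unfolding obs_def by (rule f_inv_into_f)
qed

definition e_plus :: "real^'n::{finite,linorder}" where
  "e_plus = (\<chi> i. 1)"

definition e_minus :: "real^'n::{finite,linorder}" where
  "e_minus = (\<chi> i. (- 1) ^ time i)"

definition AR1 :: "real \<Rightarrow> real^'n::{finite,linorder}^'n::{finite,linorder}" where
  "AR1 \<rho> = (\<chi> i j. \<rho> ^ nat \<bar>int (time i) - int (time j)\<bar>)"

text \<open>The Gaussian measure through its Lebesgue density, hence for positive definite
  \<open>\<Phi>\<close>; all matrices \<open>\<sigma>\<^sup>2 \<Lambda>(\<rho>)\<close> with \<open>\<sigma>\<^sup>2 > 0\<close> and \<open>\<bar>\<rho>\<bar> < 1\<close> are.\<close>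

definition gaussian :: "real^'n \<Rightarrow> real^'n^'n \<Rightarrow> (real^'n) measure" where
  "gaussian \<mu> \<Phi> = density lborel (\<lambda>y. ennreal
     (exp (- ((y - \<mu>) \<bullet> (matrix_inv \<Phi> *v (y - \<mu>))) / 2) / sqrt ((2 * pi) ^ CARD('n) * det \<Phi>)))"

definition positive_definite :: "real^'n^'n \<Rightarrow> bool" where
  "positive_definite A \<longleftrightarrow> transpose A = A \<and> (\<forall>x. x \<noteq> 0 \<longrightarrow> x \<bullet> (A *v x) > 0)"

text \<open>The second argument is a column: \<open>append_col A v = (A, v)\<close>.\<close>

definition append_col :: "real^'p^'m \<Rightarrow> real^'m \<Rightarrow> real^('p + 1)^'m" where
  "append_col A v = (\<chi> i j. case j of Inl a \<Rightarrow> A $ i $ a | Inr _ \<Rightarrow> v $ i)"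

definition outer :: "real^'m \<Rightarrow> real^'p \<Rightarrow> real^'p^'m" where
  "outer u v = (\<chi> i j. u $ i * v $ j)"

definition mean_space :: "real^'k^'n \<Rightarrow> (real^'n) set" where
  "mean_space X = span (columns X)"

definition null_means :: "real^'k^'n \<Rightarrow> real^'k^'q \<Rightarrow> real^'q \<Rightarrow> (real^'n) set" where
  "null_means X R r = {X *v \<beta> | \<beta>. R *v \<beta> = r}"

definition alt_means :: "real^'k^'n \<Rightarrow> real^'k^'q \<Rightarrow> real^'q \<Rightarrow> (real^'n) set" where
  "alt_means X R r = mean_space X - null_means X R r"

definition ols :: "real^'p^'n \<Rightarrow> real^'n \<Rightarrow> real^'p" where
  "ols X y = matrix_inv (transpose X ** X) *v (transpose X *v y)"

definition admissible_weights :: "'n::{finite,linorder} itself \<Rightarrow> (int \<Rightarrow> real) \<Rightarrow> bool" where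
  "admissible_weights _ w \<longleftrightarrow>
     w 0 = 1 \<and>
     (\<forall>j \<in> {- (int CARD('n) - 1) .. int CARD('n) - 1}. w (- j) = w j) \<and>
     positive_definite ((\<chi> i j. w (int (time i) - int (time j))) :: real^'n::{finite,linorder}^'n::{finite,linorder})"

definition resid :: "real^'p^'n \<Rightarrow> real^'n \<Rightarrow> real^'n" where
  "resid X y = y - X *v ols X y"

definition score :: "real^'p^'n \<Rightarrow> real^'n \<Rightarrow> 'n \<Rightarrow> real^'p" where
  "score X y i = (resid X y $ i) *\<^sub>R row i X"

definition autocov_nonneg :: "real^'p^'n::{finite,linorder} \<Rightarrow> real^'n::{finite,linorder} \<Rightarrow> nat \<Rightarrow> real^'p^'p" where
  "autocov_nonneg X y j =
     (1 / real CARD('n)) *\<^sub>R (\<Sum>t = j + 1..CARD('n). outer (score X y (obs t)) (score X y (obs (t - j))))"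

definition autocov :: "real^'p^'n::{finite,linorder} \<Rightarrow> real^'n::{finite,linorder} \<Rightarrow> int \<Rightarrow> real^'p^'p" where
  "autocov X y j =
     (if j \<ge> 0 then autocov_nonneg X y (nat j) else transpose (autocov_nonneg X y (nat (- j))))"

definition Psi :: "(int \<Rightarrow> real) \<Rightarrow> real^'p^'n::{finite,linorder} \<Rightarrow> real^'n::{finite,linorder} \<Rightarrow> real^'p^'p" where
  "Psi w X y = (\<Sum>j = - (int CARD('n) - 1)..int CARD('n) - 1. w j *\<^sub>R autocov X y j)"

definition Omega ::
  "(int \<Rightarrow> real) \<Rightarrow> real^'p^'n::{finite,linorder} \<Rightarrow> real^'p^'q \<Rightarrow> real^'n::{finite,linorder} \<Rightarrow> real^'q^'q" where
  "Omega w X R y =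
     real CARD('n) *\<^sub>R (R ** matrix_inv (transpose X ** X) ** Psi w X y **
                        matrix_inv (transpose X ** X) ** transpose R)"

text \<open>In \<open>T_bar w Xb Rb S R r\<close> the matrices \<open>Xb\<close>, \<open>Rb\<close> and \<open>S\<close> stand for the augmented
  \<open>(X, \<dots>)\<close>, \<open>(R, 0)\<close> (or \<open>(R, 0, 0)\<close>) and \<open>(I\<^sub>k, 0)\<close> (or \<open>(I\<^sub>k, 0, 0)\<close>).\<close>

definition T_bar ::
  "(int \<Rightarrow> real) \<Rightarrow> real^'p^'n::{finite,linorder} \<Rightarrow> real^'p^'q \<Rightarrow> real^'p^'k \<Rightarrow>
   real^'k^'q \<Rightarrow> real^'q \<Rightarrow> real^'n::{finite,linorder} \<Rightarrow> real" where
  "T_bar w Xb Rb S R r y =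
     (let d = R *v (S *v ols Xb y) - r; V = Omega w Xb Rb y
      in if det V \<noteq> 0 then d \<bullet> (matrix_inv V *v d) else 0)"

text \<open>
  Deleting columns changes the index type, so \<open>rank (B X'(\<not>(i\<^sub>1,\<dots>,i\<^sub>s)))\<close> is expressed as the
  dimension of the span of the columns of that product, which are the images under \<open>B\<close> of
  the retained columns of \<open>X'\<close>. The lemma after the definition shows that this is the library's
  \<open>rank\<close> of the matrix with these columns deleted, for any enumeration \<open>f\<close> of the retained indices.
\<close>

definition rank_condition :: "real^'p^'n \<Rightarrow> real^'p^'q \<Rightarrow> bool" where
  "rank_condition X R \<longleftrightarrow>
     dim ((\<lambda>v. (R ** matrix_inv (transpose X ** X)) *v v) `
            {column i (transpose X) | i. axis i 1 \<notin> span (columns X)}) = CARD('q)"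

lemma rank_condition_iff_rank:
  fixes X :: "real^'p^'n" and R :: "real^'p^'q" and f :: "'m::finite \<Rightarrow> 'n"
  assumes "bij_betw f UNIV {i. axis i 1 \<notin> span (columns X)}"
  shows "rank_condition X R \<longleftrightarrow>
    rank (R ** matrix_inv (transpose X ** X) ** (\<chi> a j. transpose X $ a $ f j)) = CARD('q)"
proof -
  define B where "B = R ** matrix_inv (transpose X ** X)"
  define D :: "real^'m^'p" where "D = (\<chi> a j. transpose X $ a $ f j)"
  have col: "column j (B ** D) = B *v column (f j) (transpose X)" for j
    by (simp add: column_def matrix_matrix_mult_def matrix_vector_mult_def D_def vec_eq_iff)
  have "columns (B ** D) = (\<lambda>j. B *v column (f j) (transpose X)) ` UNIV"
    by (auto simp: columns_def col)
  also have "\<dots> = (*v) B ` (\<lambda>i. column i (transpose X)) ` range f"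
    by (simp add: image_image)
  also have "\<dots> = (*v) B ` {column i (transpose X) | i. axis i 1 \<notin> span (columns X)}"
    using assms by (auto simp: bij_betw_def)
  finally show ?thesis
    by (simp add: rank_condition_def column_rank_def B_def D_def)
qed

end

theory Submission
  imports Defs
begin

text \<open>
  Write \<open>d\<close> for the violation \<open>R \<beta> - r\<close> of the restriction and, for the augmented design \<open>(X, \<dots>)\<close>, let
  \<open>T\<^sub>d(y) = (B y + d)' \<Omega>(y)\<^sup>-\<^sup>1 (B y + d)\<close>, where \<open>B y\<close> is the estimate of the tested combinations. In every
  scenario the augmented design spans both \<open>e_plus\<close> and \<open>e_minus\<close>, and \<open>B\<close> annihilates them. Since \<open>\<Omega>(y)\<close> is
  quadratic in the residuals, adding a multiple of \<open>e_plus\<close> or \<open>e_minus\<close> to \<open>y\<close> does not change the statistic, and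
  scaling the error by \<open>t\<close> amounts to dividing \<open>d\<close> by \<open>t\<close> (\<open>stat_shift\<close>).

  These are the only directions in which the AR(1) covariance matrix degenerates as \<open>\<bar>\<rho>\<bar> \<rightarrow> 1\<close>: it equals \<open>Q Q'\<close> with
  \<open>Q = \<tau> A + e c'\<close>, where \<open>\<tau> = sqrt (1 - \<rho>\<^sup>2)\<close>, \<open>e\<close> is \<open>e_plus\<close> or \<open>e_minus\<close>, and both \<open>A\<close> and its inverse are bounded
  uniformly in \<open>\<rho>\<close> (\<open>ar1_decomposition\<close>). Hence the statistic has, under mean \<open>X \<beta>\<close> and variance \<open>\<sigma>\<^sup>2\<close>, the law of
  \<open>T\<^sub>\<delta>\<close> under \<open>N(0, A A')\<close> with \<open>\<delta> = (R \<beta> - r) / (\<sigma> \<tau>)\<close> (\<open>stat_law_normalization\<close>). The singular boundary has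
  disappeared into \<open>\<delta>\<close>. Moreover all laws \<open>N(0, A A')\<close> lie between fixed multiples of \<open>N(0, K\<^sup>-\<^sup>2 I)\<close> and
  \<open>N(0, K\<^sup>2 I)\<close> (\<open>gaussian_sandwich\<close>), so it is enough to argue for one Gaussian measure equivalent to
  Lebesgue measure.

  There, \<open>\<Omega>(y) = M' W M\<close> with the positive definite matrix \<open>W\<close> of weights and a matrix \<open>M\<close> linear in the residuals.
  By the rank condition \<open>\<Omega>(y)\<close> is invertible off finitely many hyperplanes (\<open>det_V_null_set\<close>), and
  \<open>\<bar>B y + d\<bar>\<^sup>2 \<le> k\<^sup>2 T\<^sub>d(y) g(y)\<^sup>2\<close> with a function \<open>g\<close> of the residuals (\<open>stat_lower_bound\<close>). This gives all claims.
  The statistic tends to infinity almost everywhere as \<open>\<bar>d\<bar> \<rightarrow> \<infinity>\<close>, which is consistency. It exceeds \<open>C\<close> with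
  positive probability uniformly in \<open>d\<close>, because translations along the column space change \<open>B y\<close> arbitrarily
  and leave \<open>g\<close> fixed. Under the null hypothesis \<open>\<delta> = 0\<close>; then the statistic vanishes at residual vectors, so it
  stays below \<open>C\<close> on a nonempty open set, and its finiteness yields critical values for every level.
\<close>

section \<open>Linear changes of variables in Lebesgue measure\<close>

lemma nn_integral_lborel_translate:
  fixes f :: "'a::euclidean_space \<Rightarrow> ennreal"
  assumes [measurable]: "f \<in> borel_measurable borel"
  shows "(\<integral>\<^sup>+x. f (c + x) \<partial>lborel) = (\<integral>\<^sup>+x. f x \<partial>lborel)"
proof -
  have "(\<integral>\<^sup>+x. f x \<partial>lborel) = (\<integral>\<^sup>+x. f x \<partial>distr lborel borel ((+) c))"
    by (simp add: lborel_distr_plus)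
  also have "\<dots> = (\<integral>\<^sup>+x. f (c + x) \<partial>lborel)"
    by (rule nn_integral_distr) auto
  finally show ?thesis ..
qed

text \<open>Shifting all of space by \<open>t v\<close> changes neither the integral nor \<open>h\<close>. Averaging over \<open>t\<close> with a probability
  density \<open>\<phi>\<close> and applying Tonelli's theorem, the displacement \<open>h x\<close> becomes a translation of the
  real variable \<open>t\<close>, which one-dimensional invariance removes.\<close>

lemma nn_integral_lborel_shear:
  fixes f :: "'a::euclidean_space \<Rightarrow> ennreal" and h :: "'a \<Rightarrow> real"
  assumes [measurable]: "f \<in> borel_measurable borel" "h \<in> borel_measurable borel"
    and h: "\<And>x t. h (x + t *\<^sub>R v) = h x"
  shows "(\<integral>\<^sup>+x. f (x + h x *\<^sub>R v) \<partial>lborel) = (\<integral>\<^sup>+x. f x \<partial>lborel)"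
proof -
  have h': "h (t *\<^sub>R v + x) = h x" for x t
    using h[of x t] by (simp add: add.commute)
  define \<phi> :: "real \<Rightarrow> ennreal" where "\<phi> = indicator {0..1}"
  have [measurable]: "\<phi> \<in> borel_measurable borel"
    by (simp add: \<phi>_def)
  have \<phi>1: "(\<integral>\<^sup>+t. \<phi> t \<partial>lborel) = 1"
    by (simp add: \<phi>_def)
  have "(\<integral>\<^sup>+x. f (x + h x *\<^sub>R v) \<partial>lborel)
      = (\<integral>\<^sup>+t. \<phi> t * (\<integral>\<^sup>+x. f (x + h x *\<^sub>R v) \<partial>lborel) \<partial>lborel)"
    by (simp add: nn_integral_multc \<phi>1)
  also have "\<dots> = (\<integral>\<^sup>+t. \<phi> t * (\<integral>\<^sup>+x. f (x + (t + h x) *\<^sub>R v) \<partial>lborel) \<partial>lborel)"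
  proof (rule nn_integral_cong)
    fix t :: real
    have "(\<integral>\<^sup>+x. f (x + h x *\<^sub>R v) \<partial>lborel)
        = (\<integral>\<^sup>+x. f ((t *\<^sub>R v + x) + h (t *\<^sub>R v + x) *\<^sub>R v) \<partial>lborel)"
      by (rule nn_integral_lborel_translate[of "\<lambda>x. f (x + h x *\<^sub>R v)" "t *\<^sub>R v", symmetric]) measurable
    also have "\<dots> = (\<integral>\<^sup>+x. f (x + (t + h x) *\<^sub>R v) \<partial>lborel)"
      by (simp add: h' scaleR_add_left add.assoc add.left_commute)
    finally show "\<phi> t * (\<integral>\<^sup>+x. f (x + h x *\<^sub>R v) \<partial>lborel)
      = \<phi> t * (\<integral>\<^sup>+x. f (x + (t + h x) *\<^sub>R v) \<partial>lborel)" by simp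
  qed
  also have "\<dots> = (\<integral>\<^sup>+t. (\<integral>\<^sup>+x. \<phi> t * f (x + (t + h x) *\<^sub>R v) \<partial>lborel) \<partial>lborel)"
    by (simp add: nn_integral_cmult)
  also have "\<dots> = (\<integral>\<^sup>+x. (\<integral>\<^sup>+t. \<phi> t * f (x + (t + h x) *\<^sub>R v) \<partial>lborel) \<partial>lborel)"
    by (rule lborel_pair.Fubini') measurable
  also have "\<dots> = (\<integral>\<^sup>+x. (\<integral>\<^sup>+t. \<phi> (t - h x) * f (x + t *\<^sub>R v) \<partial>lborel) \<partial>lborel)"
  proof (rule nn_integral_cong)
    fix x
    show "(\<integral>\<^sup>+t. \<phi> t * f (x + (t + h x) *\<^sub>R v) \<partial>lborel)
        = (\<integral>\<^sup>+t. \<phi> (t - h x) * f (x + t *\<^sub>R v) \<partial>lborel)"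
      using nn_integral_lborel_translate[of "\<lambda>t. \<phi> (t - h x) * f (x + t *\<^sub>R v)" "h x"]
      by (simp add: add.commute)
  qed
  also have "\<dots> = (\<integral>\<^sup>+t. (\<integral>\<^sup>+x. \<phi> (t - h x) * f (x + t *\<^sub>R v) \<partial>lborel) \<partial>lborel)"
    by (rule lborel_pair.Fubini') measurable
  also have "\<dots> = (\<integral>\<^sup>+t. (\<integral>\<^sup>+x. \<phi> (t - h x) * f x \<partial>lborel) \<partial>lborel)"
  proof (rule nn_integral_cong)
    fix t :: real
    have "(\<integral>\<^sup>+x. \<phi> (t - h x) * f x \<partial>lborel)
        = (\<integral>\<^sup>+x. \<phi> (t - h (t *\<^sub>R v + x)) * f (t *\<^sub>R v + x) \<partial>lborel)"
      by (rule nn_integral_lborel_translate[of "\<lambda>x. \<phi> (t - h x) * f x" "t *\<^sub>R v", symmetric]) measurable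
    then show "(\<integral>\<^sup>+x. \<phi> (t - h x) * f (x + t *\<^sub>R v) \<partial>lborel) = (\<integral>\<^sup>+x. \<phi> (t - h x) * f x \<partial>lborel)"
      by (simp add: h h' add.commute[of "t *\<^sub>R v"])
  qed
  also have "\<dots> = (\<integral>\<^sup>+x. (\<integral>\<^sup>+t. \<phi> (t - h x) * f x \<partial>lborel) \<partial>lborel)"
    by (rule lborel_pair.Fubini') measurable
  also have "\<dots> = (\<integral>\<^sup>+x. f x \<partial>lborel)"
  proof (rule nn_integral_cong)
    fix x
    have "(\<integral>\<^sup>+t. \<phi> (t - h x) \<partial>lborel) = 1"
      using nn_integral_lborel_translate[of \<phi> "- h x"] \<phi>1 by simp
    then show "(\<integral>\<^sup>+t. \<phi> (t - h x) * f x \<partial>lborel) = f x"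
      by (simp add: nn_integral_multc)
  qed
  finally show ?thesis .
qed

lemma measurable_matrix_vector_mult[measurable (raw)]:
  fixes A :: "real^'n^'m" and f :: "'a \<Rightarrow> real^'n"
  assumes "f \<in> borel_measurable M"
  shows "(\<lambda>x. A *v f x) \<in> borel_measurable M"
proof -
  have "continuous_on UNIV ((*v) A)"
    by (intro linear_continuous_on matrix_vector_mul_bounded_linear)
  then show ?thesis
    using assms borel_measurable_continuous_on by blast
qed

lemma bij_betw_axis_Basis: "bij_betw (\<lambda>i. axis i 1) UNIV (Basis :: (real^'n) set)"
  by (auto simp: bij_betw_def inj_on_def axis_eq_axis Basis_vec_def)

text \<open>Both sides are multiplicative in \<open>A\<close>, so elementary matrices suffice. Diagonal matrices rescale
  the coordinates; transvections are shears along a coordinate axis; a transposition is a product of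
  three shears and one change of sign.\<close>

lemma nn_integral_lborel_linear:
  fixes A :: "real^'n^'n" and f :: "real^'n \<Rightarrow> ennreal"
  assumes "f \<in> borel_measurable borel" and "det A \<noteq> 0"
  shows "ennreal \<bar>det A\<bar> * (\<integral>\<^sup>+x. f (A *v x) \<partial>lborel) = (\<integral>\<^sup>+x. f x \<partial>lborel)"
proof -
  have shear: "(\<integral>\<^sup>+x. f (x + (c * x $ n) *\<^sub>R axis m 1) \<partial>lborel) = (\<integral>\<^sup>+x. f x \<partial>lborel)"
    if "m \<noteq> n" and [measurable]: "f \<in> borel_measurable borel" for m n :: 'n and c and f :: "real^'n \<Rightarrow> ennreal"
    using that by (intro nn_integral_lborel_shear) (auto simp: axis_def)
  have diag: "ennreal \<bar>prod c UNIV\<bar> * (\<integral>\<^sup>+x. f (\<chi> i. c i * x $ i) \<partial>lborel) = (\<integral>\<^sup>+x. f x \<partial>lborel)"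
    if [measurable]: "f \<in> borel_measurable borel" and c: "\<And>i. c i \<noteq> 0"
    for c and f :: "real^'n \<Rightarrow> ennreal"
  proof -
    define T :: "real^'n \<Rightarrow> real^'n" where "T = (\<lambda>x. \<Sum>j\<in>Basis. ((\<chi> i. c i) \<bullet> j * (x \<bullet> j)) *\<^sub>R j)"
    have T: "T x = (\<chi> i. c i * x $ i)" for x
    proof -
      have "T x = (\<Sum>i\<in>UNIV. (c i * x $ i) *\<^sub>R axis i 1)"
        unfolding T_def sum.reindex_bij_betw[OF bij_betw_axis_Basis, symmetric]
        by (simp add: inner_axis)
      then show ?thesis
        by (simp add: vec_eq_iff axis_def if_distrib cong: if_cong)
    qed
    have [measurable]: "T \<in> borel_measurable borel"
      unfolding T_def by measurable
    have P: "(\<Prod>j\<in>Basis. \<bar>((\<chi> i. c i) :: real^'n) \<bullet> j\<bar>) = \<bar>prod c UNIV\<bar>"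
      unfolding prod.reindex_bij_betw[OF bij_betw_axis_Basis, symmetric]
      by (simp add: inner_axis abs_prod)
    have "(\<integral>\<^sup>+x. f x \<partial>lborel) = (\<integral>\<^sup>+x. f x \<partial>(density (distr lborel borel T) (\<lambda>_. ennreal \<bar>prod c UNIV\<bar>)))"
    proof -
      have "((\<chi> i. c i) :: real^'n) \<bullet> j \<noteq> 0" if "j \<in> Basis" for j
        using that c by (auto simp: Basis_vec_def inner_axis)
      then show ?thesis
        using lborel_affine_euclidean[of "\<lambda>j. ((\<chi> i. c i) :: real^'n) \<bullet> j" 0]
        by (simp add: T_def P)
    qed
    also have "\<dots> = ennreal \<bar>prod c UNIV\<bar> * (\<integral>\<^sup>+x. f (T x) \<partial>lborel)"
      by (simp add: nn_integral_density nn_integral_distr nn_integral_cmult)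
    finally show ?thesis by (simp add: T)
  qed
  define P where "P A \<longleftrightarrow> (det A \<noteq> 0 \<longrightarrow> (\<forall>f \<in> borel_measurable borel.
    ennreal \<bar>det A\<bar> * (\<integral>\<^sup>+x. f (A *v x) \<partial>lborel) = (\<integral>\<^sup>+x. f x \<partial>lborel)))" for A :: "real^'n^'n"
  have "P A"
  proof (rule induct_matrix_elementary)
    fix A B :: "real^'n^'n"
    assume A: "P A" and B: "P B"
    show "P (A ** B)"
      unfolding P_def
    proof (intro impI ballI)
      fix f :: "real^'n \<Rightarrow> ennreal" assume [measurable]: "f \<in> borel_measurable borel" and "det (A ** B) \<noteq> 0"
      then have nz: "det A \<noteq> 0" "det B \<noteq> 0" by (auto simp: det_mul)
      have "ennreal \<bar>det (A ** B)\<bar> * (\<integral>\<^sup>+x. f ((A ** B) *v x) \<partial>lborel)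
        = ennreal \<bar>det A\<bar> * (ennreal \<bar>det B\<bar> * (\<integral>\<^sup>+x. f (A *v (B *v x)) \<partial>lborel))"
        by (simp add: det_mul abs_mult ennreal_mult' matrix_vector_mul_assoc ac_simps)
      also have "ennreal \<bar>det B\<bar> * (\<integral>\<^sup>+x. f (A *v (B *v x)) \<partial>lborel) = (\<integral>\<^sup>+x. f (A *v x) \<partial>lborel)"
        using B nz unfolding P_def by (elim impE ballE[where x="\<lambda>x. f (A *v x)"]) auto
      also have "ennreal \<bar>det A\<bar> * \<dots> = (\<integral>\<^sup>+x. f x \<partial>lborel)"
        using A nz unfolding P_def by auto
      finally show "ennreal \<bar>det (A ** B)\<bar> * (\<integral>\<^sup>+x. f ((A ** B) *v x) \<partial>lborel) = (\<integral>\<^sup>+x. f x \<partial>lborel)" .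
    qed
  next
    fix A :: "real^'n^'n" and i
    assume "row i A = 0"
    then show "P A" by (simp add: P_def det_zero_row(2))
  next
    fix A :: "real^'n^'n"
    assume A: "\<And>i j. i \<noteq> j \<Longrightarrow> A $ i $ j = 0"
    have det: "det A = (\<Prod>i\<in>UNIV. A $ i $ i)"
      by (rule det_diagonal) (use A in auto)
    have Ax: "A *v x = (\<chi> i. A $ i $ i * x $ i)" for x
    proof -
      have "(A *v x) $ i = A $ i $ i * x $ i" for i
        using A by (simp add: matrix_vector_mult_def sum.remove[where x=i])
      then show ?thesis by (simp add: vec_eq_iff)
    qed
    show "P A"
      using diag[of _ "\<lambda>i. A $ i $ i"] unfolding P_def by (auto simp: det Ax)
  next
    fix m n :: 'n assume mn: "m \<noteq> n"
    define S :: "real^'n^'n" where "S = (\<chi> i j. mat 1 $ i $ Transposition.transpose m n j)"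
    have "Transposition.transpose m n permutes UNIV"
      by (simp add: permutes_swap_id)
    then have "det S = of_int (sign (Transposition.transpose m n))"
      unfolding S_def using det_permute_columns[of _ "mat 1 :: real^'n^'n"] by simp
    then have det: "\<bar>det S\<bar> = 1" by (simp add: sign_def)
    have Sx: "S *v x = (\<chi> i. x $ (Transposition.transpose m n i))" for x
    proof -
      have "(S *v x) $ i = x $ (Transposition.transpose m n i)" for i
      proof -
        have "(S *v x) $ i = (\<Sum>j\<in>UNIV. if j = Transposition.transpose m n i then x $ j else 0)"
          unfolding S_def matrix_vector_mult_def mat_def vec_lambda_beta
          by (intro sum.cong refl) (metis mult_1 mult_zero_left transpose_involutory)
        then show ?thesis by simp
      qed
      then show ?thesis by (simp add: vec_eq_iff)
    qed
    \<comment> \<open>The transposition is a product of three shears and a change of sign: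
      \<open>(a, b) \<mapsto> (a + b, b) \<mapsto> (a + b, -a) \<mapsto> (b, -a) \<mapsto> (b, a)\<close>.\<close>
    define s1 s2 D where "s1 = (\<lambda>x::real^'n. x + (1 * x $ n) *\<^sub>R axis m 1)"
      and "s2 = (\<lambda>x::real^'n. x + ((-1) * x $ m) *\<^sub>R axis n 1)"
      and "D = (\<lambda>x::real^'n. \<chi> i. (if i = n then - 1 else 1) * x $ i)"
    have [measurable]: "s1 \<in> borel_measurable borel" "s2 \<in> borel_measurable borel"
      by (simp_all add: s1_def s2_def)
    have s1i: "(\<integral>\<^sup>+x. g (s1 x) \<partial>lborel) = (\<integral>\<^sup>+x. g x \<partial>lborel)"
      if "g \<in> borel_measurable borel" for g :: "real^'n \<Rightarrow> ennreal"
      unfolding s1_def using mn that by (rule shear)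
    have s2i: "(\<integral>\<^sup>+x. g (s2 x) \<partial>lborel) = (\<integral>\<^sup>+x. g x \<partial>lborel)"
      if "g \<in> borel_measurable borel" for g :: "real^'n \<Rightarrow> ennreal"
      unfolding s2_def using mn[symmetric] that by (rule shear)
    have "D = (\<lambda>x. x - (2 * x $ n) *\<^sub>R axis n 1)"
      by (auto simp: D_def axis_def vec_eq_iff)
    then have [measurable]: "D \<in> borel_measurable borel" by simp
    have comp: "S *v x = D (s1 (s2 (s1 x)))" for x
      using mn by (auto simp: Sx vec_eq_iff D_def s1_def s2_def axis_def transpose_def)
    have "(\<integral>\<^sup>+x. f (S *v x) \<partial>lborel) = (\<integral>\<^sup>+x. f x \<partial>lborel)"
      if [measurable]: "f \<in> borel_measurable borel" for f :: "real^'n \<Rightarrow> ennreal"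
    proof -
      have "(\<integral>\<^sup>+x. f (S *v x) \<partial>lborel) = (\<integral>\<^sup>+x. f (D (s1 (s2 (s1 x)))) \<partial>lborel)"
        by (simp add: comp)
      also have "\<dots> = (\<integral>\<^sup>+x. f (D (s1 (s2 x))) \<partial>lborel)"
        by (rule s1i[of "\<lambda>x. f (D (s1 (s2 x)))"]) measurable
      also have "\<dots> = (\<integral>\<^sup>+x. f (D (s1 x)) \<partial>lborel)"
        by (rule s2i[of "\<lambda>x. f (D (s1 x))"]) measurable
      also have "\<dots> = (\<integral>\<^sup>+x. f (D x) \<partial>lborel)"
        by (rule s1i[of "\<lambda>x. f (D x)"]) measurable
      also have "\<dots> = (\<integral>\<^sup>+x. f x \<partial>lborel)"
        using diag[of f "\<lambda>i. if i = n then - 1 else 1"] by (simp add: D_def prod.delta_remove)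
      finally show ?thesis .
    qed
    then have "P S" by (simp add: P_def det)
    then show "P (\<chi> i j. mat 1 $ i $ Transposition.transpose m n j)" by (simp add: S_def)
  next
    fix m n :: 'n and c :: real assume mn: "m \<noteq> n"
    define S :: "real^'n^'n" where "S = (\<chi> i j. if i = m \<and> j = n then c else of_bool (i = j))"
    have "S = (\<chi> k. if k = m then row m (mat 1) + c *s row n (mat 1) else row k (mat 1))"
      using mn by (auto simp: S_def vec_eq_iff row_def mat_def)
    then have det: "det S = 1"
      by (simp add: det_row_operation[OF mn])
    have Sx: "S *v x = x + (c * x $ n) *\<^sub>R axis m 1" for x
    proof -
      have "(S *v x) $ i = (\<Sum>j\<in>UNIV. (if j = n then (if i = m then c * x $ n else 0) else 0) + (if j = i then x $ i else 0))" for i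
        unfolding S_def matrix_vector_mult_def using mn by (auto intro!: sum.cong)
      then show ?thesis by (simp add: vec_eq_iff sum.distrib axis_def)
    qed
    have "P S"
      using shear[OF mn] by (simp add: P_def det Sx)
    then show "P (\<chi> i j. if i = m \<and> j = n then c else of_bool (i = j))" by (simp add: S_def)
  qed
  then show ?thesis using assms by (simp add: P_def)
qed

section \<open>Gaussian measures\<close>

lemma matrix_inv_mult:
  fixes A :: "real^'n^'n"
  assumes "det A \<noteq> 0"
  shows "A ** matrix_inv A = mat 1" and "matrix_inv A ** A = mat 1"
proof -
  have "invertible A" using assms by (simp add: invertible_det_nz)
  then have "A ** matrix_inv A = mat 1 \<and> matrix_inv A ** A = mat 1"
    unfolding invertible_def matrix_inv_def by (rule someI_ex)
  then show "A ** matrix_inv A = mat 1" "matrix_inv A ** A = mat 1" by auto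
qed

lemma matrix_inv_vector_mult:
  fixes A :: "real^'n^'n"
  assumes "det A \<noteq> 0"
  shows "A *v (matrix_inv A *v x) = x" and "matrix_inv A *v (A *v x) = x"
  using matrix_inv_mult[OF assms] by (simp_all add: matrix_vector_mul_assoc)

lemma matrix_inv_eqI:
  fixes A B :: "real^'n^'n"
  assumes "A ** B = mat 1"
  shows "matrix_inv A = B"
proof -
  have "det A * det B = 1" using assms by (metis det_mul det_I)
  then have "det A \<noteq> 0" by auto
  then have "matrix_inv A ** (A ** B) = B"
    by (simp add: matrix_mul_assoc matrix_inv_mult)
  then show ?thesis using assms by simp
qed

lemma inner_matrix_vector_mult:
  fixes A :: "real^'n^'m"
  shows "(A *v x) \<bullet> y = x \<bullet> (transpose A *v y)"
  by (metis dot_lmul_matrix vector_transpose_matrix)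

lemma mat_vector_mult: "mat c *v x = c *\<^sub>R (x :: real^'n)"
  by (simp add: vec_eq_iff matrix_vector_mult_def mat_def mult_delta_left)

lemma mat_mult_mat: "mat a ** mat b = (mat (a * b) :: real^'n^'n)"
  by (simp add: vec_eq_iff matrix_matrix_mult_def mat_def mult_delta_left)

lemma det_mat: "det (mat c :: real^'n^'n) = c ^ CARD('n)"
  by (subst det_diagonal) (auto simp: mat_def)

lemma sets_gaussian[measurable_cong, simp]: "sets (gaussian \<mu> \<Phi>) = sets borel"
  and space_gaussian[simp]: "space (gaussian \<mu> \<Phi>) = UNIV"
  by (simp_all add: gaussian_def)

text \<open>In the substitution \<open>y = \<mu> + M x\<close> the Jacobian \<open>\<bar>det M\<bar>\<close> cancels against the factor by which the
  normalizing constant grows, and \<open>M\<close> drops out of the quadratic form.\<close>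

lemma gaussian_affine:
  fixes M \<Phi> :: "real^'n^'n"
  assumes M: "det M \<noteq> 0" and \<Phi>: "det \<Phi> \<noteq> 0"
  shows "gaussian \<mu> (M ** \<Phi> ** transpose M) = distr (gaussian 0 \<Phi>) borel (\<lambda>x. \<mu> + M *v x)"
proof (rule measure_eqI)
  show "sets (gaussian \<mu> (M ** \<Phi> ** transpose M)) = sets (distr (gaussian 0 \<Phi>) borel (\<lambda>x. \<mu> + M *v x))"
    by simp
  fix E assume "E \<in> sets (gaussian \<mu> (M ** \<Phi> ** transpose M))"
  then have [measurable]: "E \<in> sets borel" by simp
  define d where "d = sqrt ((2 * pi) ^ CARD('n) * det \<Phi>)"
  define g where "g x = ennreal (exp (- (x \<bullet> (matrix_inv (M ** \<Phi> ** transpose M) *v x)) / 2)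
    / sqrt ((2 * pi) ^ CARD('n) * det (M ** \<Phi> ** transpose M)))" for x :: "real^'n"
  have [measurable]: "g \<in> borel_measurable borel" unfolding g_def by measurable
  have inv: "matrix_inv (M ** \<Phi> ** transpose M) = transpose (matrix_inv M) ** matrix_inv \<Phi> ** matrix_inv M"
  proof (rule matrix_inv_eqI)
    have "transpose M ** transpose (matrix_inv M) = mat 1"
      using M by (metis matrix_transpose_mul matrix_inv_mult(2) transpose_mat)
    then show "M ** \<Phi> ** transpose M ** (transpose (matrix_inv M) ** matrix_inv \<Phi> ** matrix_inv M) = mat 1"
      by (metis (no_types, lifting) M \<Phi> matrix_inv_mult(1) matrix_mul_assoc matrix_mul_rid)
  qed
  have quad: "(M *v x) \<bullet> (matrix_inv (M ** \<Phi> ** transpose M) *v (M *v x)) = x \<bullet> (matrix_inv \<Phi> *v x)" for x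
  proof -
    have "(M *v x) \<bullet> (matrix_inv (M ** \<Phi> ** transpose M) *v (M *v x))
      = (M *v x) \<bullet> (transpose (matrix_inv M) *v (matrix_inv \<Phi> *v x))"
      using M by (simp add: inv matrix_vector_mul_assoc[symmetric] matrix_inv_vector_mult)
    also have "\<dots> = (matrix_inv M *v (M *v x)) \<bullet> (matrix_inv \<Phi> *v x)"
      by (rule inner_matrix_vector_mult[symmetric])
    also have "\<dots> = x \<bullet> (matrix_inv \<Phi> *v x)"
      using M by (simp add: matrix_inv_vector_mult)
    finally show ?thesis .
  qed
  have "det (M ** \<Phi> ** transpose M) = (det M)\<^sup>2 * det \<Phi>"
    by (simp add: det_mul power2_eq_square)
  then have nrm: "sqrt ((2 * pi) ^ CARD('n) * det (M ** \<Phi> ** transpose M)) = \<bar>det M\<bar> * d"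
    by (simp add: d_def real_sqrt_mult)
  have dens: "ennreal \<bar>det M\<bar> * g (M *v x) = ennreal (exp (- (x \<bullet> (matrix_inv \<Phi> *v x)) / 2) / d)" for x
    unfolding g_def quad nrm using M by (simp add: ennreal_mult'[symmetric])
  have "emeasure (gaussian \<mu> (M ** \<Phi> ** transpose M)) E = (\<integral>\<^sup>+y. g (y - \<mu>) * indicator E y \<partial>lborel)"
    unfolding gaussian_def g_def by (subst emeasure_density) (auto simp: mult.commute)
  also have "\<dots> = (\<integral>\<^sup>+y. g y * indicator E (\<mu> + y) \<partial>lborel)"
    using nn_integral_lborel_translate[of "\<lambda>y. g (y - \<mu>) * indicator E y" \<mu>] by simp
  also have "\<dots> = ennreal \<bar>det M\<bar> * (\<integral>\<^sup>+x. g (M *v x) * indicator E (\<mu> + M *v x) \<partial>lborel)"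
    by (rule nn_integral_lborel_linear[symmetric]) (use M in measurable)
  also have "\<dots> = (\<integral>\<^sup>+x. (ennreal \<bar>det M\<bar> * g (M *v x)) * indicator E (\<mu> + M *v x) \<partial>lborel)"
    by (subst nn_integral_cmult[symmetric]) (auto simp: mult.assoc)
  also have "\<dots> = emeasure (gaussian 0 \<Phi>) ((\<lambda>x. \<mu> + M *v x) -` E)"
    unfolding dens gaussian_def
    by (subst emeasure_density)
      (auto simp: d_def indicator_def intro!: nn_integral_cong measurable_sets_borel[of _ borel])
  also have "\<dots> = emeasure (distr (gaussian 0 \<Phi>) borel (\<lambda>x. \<mu> + M *v x)) E"
    by (subst emeasure_distr) auto
  finally show "emeasure (gaussian \<mu> (M ** \<Phi> ** transpose M)) E
    = emeasure (distr (gaussian 0 \<Phi>) borel (\<lambda>x. \<mu> + M *v x)) E" .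
qed

text \<open>The density is the product of the standard normal densities of the coordinates.\<close>

lemma prob_space_standard_gaussian: "prob_space (gaussian 0 (mat 1 :: real^'n^'n))"
proof
  have inv: "matrix_inv (mat 1 :: real^'n^'n) = mat 1"
    by (rule matrix_inv_eqI) simp
  have *: "exp (- (y \<bullet> y) / 2) / sqrt ((2 * pi) ^ CARD('n)) = (\<Prod>b\<in>Basis. std_normal_density (y \<bullet> b))"
    for y :: "real^'n"
  proof -
    have "(\<Prod>b\<in>Basis. std_normal_density (y \<bullet> b)) = (\<Prod>i\<in>UNIV. std_normal_density (y $ i))"
      unfolding prod.reindex_bij_betw[OF bij_betw_axis_Basis, symmetric] by (simp add: inner_axis)
    also have "\<dots> = (1 / sqrt (2 * pi)) ^ CARD('n) * (\<Prod>i\<in>UNIV. exp (- (y $ i)\<^sup>2 / 2))"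
      by (simp only: std_normal_density_def prod.distrib prod_constant card_UNIV)
    also have "(\<Prod>i\<in>UNIV. exp (- (y $ i)\<^sup>2 / 2)) = exp (\<Sum>i\<in>UNIV. - (y $ i)\<^sup>2 / 2)"
      by (simp add: exp_sum)
    also have "(\<Sum>i\<in>UNIV. - (y $ i)\<^sup>2 / 2) = - (y \<bullet> y) / 2"
      by (simp add: inner_vec_def power2_eq_square sum_negf sum_divide_distrib[symmetric])
    finally show ?thesis
      by (simp add: real_sqrt_power[symmetric] power_divide)
  qed
  have dens: "exp (- ((y - 0) \<bullet> (matrix_inv (mat 1) *v (y - 0))) / 2)
      / sqrt ((2 * pi) ^ CARD('n) * det (mat 1 :: real^'n^'n))
    = (\<Prod>b\<in>Basis. std_normal_density (y \<bullet> b))" for y :: "real^'n"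
    by (simp only: inv diff_zero matrix_vector_mul_lid det_I mult_1_right *)
  have "emeasure (gaussian 0 (mat 1 :: real^'n^'n)) UNIV
      = (\<integral>\<^sup>+y. (\<Prod>b\<in>Basis. ennreal (std_normal_density ((y :: real^'n) \<bullet> b))) \<partial>lborel)"
    unfolding gaussian_def dens
    by (subst emeasure_density) (auto simp: prod_ennreal)
  also have "\<dots> = (\<Prod>b\<in>(Basis :: (real^'n) set). (\<integral>\<^sup>+x. ennreal (std_normal_density x) \<partial>lborel))"
    by (rule nn_integral_lborel_prod) auto
  also have "(\<integral>\<^sup>+x. ennreal (std_normal_density x) \<partial>lborel) = 1"
    by (simp add: nn_integral_eq_integral integrable_std_normal_moment)
  finally show "emeasure (gaussian 0 (mat 1 :: real^'n^'n)) (space (gaussian 0 (mat 1 :: real^'n^'n))) = 1"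
    by simp
qed

lemma prob_space_gaussian:
  fixes A :: "real^'n^'n"
  assumes "det A \<noteq> 0"
  shows "prob_space (gaussian \<mu> (A ** transpose A))"
proof -
  interpret prob_space "gaussian 0 (mat 1 :: real^'n^'n)"
    by (rule prob_space_standard_gaussian)
  have "gaussian \<mu> (A ** transpose A) = distr (gaussian 0 (mat 1)) borel (\<lambda>x. \<mu> + A *v x)"
    using gaussian_affine[OF assms, of "mat 1" \<mu>] by simp
  moreover have "prob_space (distr (gaussian 0 (mat 1 :: real^'n^'n)) borel (\<lambda>x. \<mu> + A *v x))"
    by (rule prob_space_distr) simp
  ultimately show ?thesis by simp
qed

lemma prob_space_gaussian_mat:
  assumes "c \<noteq> 0"
  shows "prob_space (gaussian \<mu> (mat (c\<^sup>2) :: real^'n^'n))"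
  using prob_space_gaussian[of "mat c :: real^'n^'n" \<mu>] assms
  by (simp add: det_mat mat_mult_mat power2_eq_square)

text \<open>Multiplied by \<open>\<bar>det M\<bar>\<close>, the density of \<open>N(0, M M')\<close> at \<open>x\<close> is a constant times
  \<open>exp (- \<bar>M\<^sup>-\<^sup>1 x\<bar>\<^sup>2 / 2)\<close>, so the assumption compares the two densities pointwise.\<close>

lemma gaussian_comparison:
  fixes A B :: "real^'n^'n"
  assumes A: "det A \<noteq> 0" and B: "det B \<noteq> 0"
    and le: "\<And>x. norm (matrix_inv B *v x) \<le> norm (matrix_inv A *v x)"
    and [measurable]: "E \<in> sets borel"
  shows "\<bar>det A\<bar> * measure (gaussian 0 (A ** transpose A)) E \<le> \<bar>det B\<bar> * measure (gaussian 0 (B ** transpose B)) E"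
proof -
  define h where "h M x = ennreal (exp (- (norm (matrix_inv M *v x))\<^sup>2 / 2) / sqrt ((2 * pi) ^ CARD('n)))"
    for M :: "real^'n^'n" and x
  have [measurable]: "h M \<in> borel_measurable borel" for M
    unfolding h_def by measurable
  have em: "ennreal (\<bar>det M\<bar> * measure (gaussian 0 (M ** transpose M)) E) = (\<integral>\<^sup>+x. h M x * indicator E x \<partial>lborel)"
    if M: "det M \<noteq> 0" for M :: "real^'n^'n"
  proof -
    interpret prob_space "gaussian 0 (M ** transpose M)"
      using M by (rule prob_space_gaussian)
    have inv: "matrix_inv (M ** transpose M) = transpose (matrix_inv M) ** matrix_inv M"
    proof (rule matrix_inv_eqI)
      have "transpose M ** transpose (matrix_inv M) = mat 1"
        using M by (metis matrix_transpose_mul matrix_inv_mult(2) transpose_mat)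
      then show "M ** transpose M ** (transpose (matrix_inv M) ** matrix_inv M) = mat 1"
        by (metis M matrix_inv_mult(1) matrix_mul_assoc matrix_mul_rid)
    qed
    have quad: "x \<bullet> (matrix_inv (M ** transpose M) *v x) = (norm (matrix_inv M *v x))\<^sup>2" for x
      by (simp add: inv matrix_vector_mul_assoc[symmetric] inner_matrix_vector_mult[symmetric] power2_norm_eq_inner)
        (simp add: inner_commute inner_matrix_vector_mult)
    have nrm: "sqrt ((2 * pi) ^ CARD('n) * det (M ** transpose M)) = \<bar>det M\<bar> * sqrt ((2 * pi) ^ CARD('n))"
      by (simp add: det_mul real_sqrt_mult)
    have dens: "exp (- ((x - 0) \<bullet> (matrix_inv (M ** transpose M) *v (x - 0))) / 2)
        / sqrt ((2 * pi) ^ CARD('n) * det (M ** transpose M))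
      = exp (- (norm (matrix_inv M *v x))\<^sup>2 / 2) / (\<bar>det M\<bar> * sqrt ((2 * pi) ^ CARD('n)))" for x
      by (simp only: quad nrm diff_zero)
    have "ennreal (\<bar>det M\<bar> * measure (gaussian 0 (M ** transpose M)) E)
      = ennreal \<bar>det M\<bar> * emeasure (gaussian 0 (M ** transpose M)) E"
      by (simp add: ennreal_mult emeasure_eq_measure)
    also have "\<dots> = ennreal \<bar>det M\<bar> * (\<integral>\<^sup>+x. ennreal (exp (- (norm (matrix_inv M *v x))\<^sup>2 / 2) / (\<bar>det M\<bar> * sqrt ((2 * pi) ^ CARD('n)))) * indicator E x \<partial>lborel)"
      unfolding gaussian_def dens by (subst emeasure_density) auto
    also have "\<dots> = (\<integral>\<^sup>+x. (ennreal \<bar>det M\<bar> * ennreal (exp (- (norm (matrix_inv M *v x))\<^sup>2 / 2) / (\<bar>det M\<bar> * sqrt ((2 * pi) ^ CARD('n))))) * indicator E x \<partial>lborel)"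
      by (subst nn_integral_cmult[symmetric]) (auto simp: mult.assoc)
    also have "\<dots> = (\<integral>\<^sup>+x. h M x * indicator E x \<partial>lborel)"
      using M by (intro nn_integral_cong) (simp add: h_def ennreal_mult'[symmetric])
    finally show ?thesis .
  qed
  have "h A x \<le> h B x" for x
    unfolding h_def using le[of x] by (intro ennreal_leI divide_right_mono) (auto intro: power_mono)
  then have "(\<integral>\<^sup>+x. h A x * indicator E x \<partial>lborel) \<le> (\<integral>\<^sup>+x. h B x * indicator E x \<partial>lborel)"
    by (intro nn_integral_mono mult_right_mono) auto
  then show ?thesis
    using em[OF A] em[OF B] by (simp add: ennreal_le_iff[symmetric] del: ennreal_le_iff)
qed

text \<open>The comparison of densities on the whole space, where both measures have mass 1, also bounds the
  determinant of \<open>A\<close>: it lies between \<open>K\<^sup>-\<^sup>n\<close> and \<open>K\<^sup>n\<close>. This turns the comparison of scaled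
  measures into a two-sided estimate with constants that depend on \<open>K\<close> only.\<close>

lemma gaussian_sandwich:
  fixes A :: "real^'n^'n"
  assumes K: "0 < K" and A: "det A \<noteq> 0"
    and upper: "\<And>x. norm (A *v x) \<le> K * norm x" and lower: "\<And>x. norm x \<le> K * norm (A *v x)"
    and E: "E \<in> sets borel"
  shows "measure (gaussian 0 (A ** transpose A)) E \<le> K ^ (2 * CARD('n)) * measure (gaussian 0 (mat (K\<^sup>2))) E"
    and "measure (gaussian 0 (mat (1 / K\<^sup>2))) E \<le> K ^ (2 * CARD('n)) * measure (gaussian 0 (A ** transpose A)) E"
proof -
  have inv: "matrix_inv (mat c :: real^'n^'n) = mat (1 / c)" if "c \<noteq> 0" for c
    using that by (intro matrix_inv_eqI) (simp add: mat_mult_mat)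
  have up: "\<bar>det A\<bar> * measure (gaussian 0 (A ** transpose A)) E \<le> K ^ CARD('n) * measure (gaussian 0 (mat (K\<^sup>2))) E"
    if "E \<in> sets borel" for E
  proof -
    have "norm (matrix_inv (mat K :: real^'n^'n) *v x) \<le> norm (matrix_inv A *v x)" for x
      using upper[of "matrix_inv A *v x"] K
      by (simp add: inv mat_vector_mult matrix_inv_vector_mult[OF A] divide_le_eq mult.commute)
    from gaussian_comparison[OF A _ this that] show ?thesis
      using K by (simp add: det_mat mat_mult_mat power2_eq_square)
  qed
  have lo: "(1 / K) ^ CARD('n) * measure (gaussian 0 (mat (1 / K\<^sup>2))) E \<le> \<bar>det A\<bar> * measure (gaussian 0 (A ** transpose A)) E"
    if "E \<in> sets borel" for E
  proof -
    have "norm (matrix_inv A *v x) \<le> norm (matrix_inv (mat (1 / K) :: real^'n^'n) *v x)" for x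
      using lower[of "matrix_inv A *v x"] K
      by (simp add: inv mat_vector_mult matrix_inv_vector_mult[OF A])
    from gaussian_comparison[OF _ A this that] show ?thesis
      using K by (simp add: det_mat mat_mult_mat power2_eq_square)
  qed
  interpret A: prob_space "gaussian 0 (A ** transpose A)"
    using A by (rule prob_space_gaussian)
  interpret K: prob_space "gaussian 0 (mat (K\<^sup>2) :: real^'n^'n)"
    using K by (intro prob_space_gaussian_mat) simp
  interpret K1: prob_space "gaussian 0 (mat (1 / K\<^sup>2) :: real^'n^'n)"
    using prob_space_gaussian_mat[of "1 / K" 0] K by (simp add: power_divide)
  have d1: "\<bar>det A\<bar> \<le> K ^ CARD('n)"
    using up[of UNIV] A.prob_space K.prob_space by simp
  have d2: "(1 / K) ^ CARD('n) \<le> \<bar>det A\<bar>"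
    using lo[of UNIV] A.prob_space K1.prob_space by simp
  have KK: "K ^ (2 * CARD('n)) = K ^ CARD('n) * K ^ CARD('n)"
    by (simp add: mult_2 power_add)
  have "(1 / K) ^ CARD('n) * measure (gaussian 0 (A ** transpose A)) E \<le> K ^ CARD('n) * measure (gaussian 0 (mat (K\<^sup>2))) E"
    using up[OF E] mult_right_mono[OF d2 measure_nonneg] by (rule order_trans[rotated])
  then show "measure (gaussian 0 (A ** transpose A)) E \<le> K ^ (2 * CARD('n)) * measure (gaussian 0 (mat (K\<^sup>2))) E"
    unfolding KK using K by (simp add: power_divide divide_le_eq ac_simps)
  have "(1 / K) ^ CARD('n) * measure (gaussian 0 (mat (1 / K\<^sup>2))) E \<le> K ^ CARD('n) * measure (gaussian 0 (A ** transpose A)) E"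
    using lo[OF E] mult_right_mono[OF d1 measure_nonneg] by (rule order_trans)
  then show "measure (gaussian 0 (mat (1 / K\<^sup>2))) E \<le> K ^ (2 * CARD('n)) * measure (gaussian 0 (A ** transpose A)) E"
    unfolding KK using K by (simp add: power_divide divide_le_eq ac_simps)
qed

text \<open>The density never vanishes.\<close>

lemma null_sets_gaussian:
  fixes A :: "real^'n^'n"
  assumes "c \<noteq> 0"
  shows "null_sets (gaussian 0 (mat (c\<^sup>2) :: real^'n^'n)) = null_sets lborel"
proof -
  have "det (mat (c\<^sup>2) :: real^'n^'n) > 0"
    using assms by (simp add: det_mat)
  then have "sqrt ((2 * pi) ^ CARD('n) * det (mat (c\<^sup>2) :: real^'n^'n)) > 0"
    by simp
  then have "(ennreal (exp t / sqrt ((2 * pi) ^ CARD('n) * det (mat (c\<^sup>2) :: real^'n^'n))) = 0) = False" for t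
    by (simp add: ennreal_eq_0_iff not_le)
  then have "(N \<in> null_sets (gaussian 0 (mat (c\<^sup>2) :: real^'n^'n))) = (N \<in> null_sets lborel)" for N
    unfolding gaussian_def
    by (subst null_sets_density_iff) (auto simp: AE_iff_null_sets intro: AE_not_in)
  then show ?thesis by blast
qed

section \<open>The AR(1) covariance matrix near the unit root\<close>

lemma time_bounds: "1 \<le> time i" "time i \<le> CARD('n)" for i :: "'n::{finite,linorder}"
  using bij_betw_time[where 'n='n] by (auto simp: bij_betw_def)

lemma time_inject: "time i = time j \<longleftrightarrow> i = j" for i :: "'n::{finite,linorder}"
  using bij_betw_time[where 'n='n] by (auto simp: bij_betw_def inj_eq)

lemma sum_time: "(\<Sum>j\<in>UNIV. f (time (j :: 'n::{finite,linorder}))) = (\<Sum>t=1..CARD('n). f t)"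
  using sum.reindex_bij_betw[OF bij_betw_time] .

text \<open>An AR(1) process started in its stationary law is \<open>z\<^sub>a = \<rho> z\<^sub>a\<^sub>-\<^sub>1 + sqrt (1 - \<rho>\<^sup>2) \<epsilon>\<^sub>a\<close> with
  \<open>z\<^sub>1 = \<epsilon>\<^sub>1\<close>; \<open>q a t\<close> is the coefficient of \<open>\<epsilon>\<^sub>t\<close> in \<open>z\<^sub>a\<close>. The recursion gives unit variances by
  induction, and for \<open>a \<le> b\<close> the first \<open>a\<close> coefficients of \<open>z\<^sub>b\<close> are those of \<open>z\<^sub>a\<close> times \<open>\<rho> ^ (b - a)\<close>.\<close>

lemma sum_ar1_innovations:
  fixes \<rho> :: real
  assumes \<rho>: "\<bar>\<rho>\<bar> < 1"
  defines "q \<equiv> \<lambda>a t. if t = 1 then \<rho> ^ (a - 1) else if t \<le> a then sqrt (1 - \<rho>\<^sup>2) * \<rho> ^ (a - t) else (0::real)"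
  assumes ab: "1 \<le> a" "a \<le> b" "b \<le> n"
  shows "(\<Sum>t=1..n. q a t * q b t) = \<rho> ^ (b - a)"
proof -
  have "\<rho>\<^sup>2 \<le> 1" using \<rho> by (simp add: abs_square_le_1)
  then have tau: "(sqrt (1 - \<rho>\<^sup>2))\<^sup>2 = 1 - \<rho>\<^sup>2" by simp
  have shift: "q d t = \<rho> ^ (d - c) * q c t" if "1 \<le> c" "c \<le> d" "t \<le> c" "1 \<le> t" for c d t
    using that by (auto simp: q_def power_add[symmetric])
  have one: "(\<Sum>t=1..a. (q a t)\<^sup>2) = 1" if "1 \<le> a" for a
    using that
  proof (induction a rule: nat_induct_at_least)
    case base
    show ?case by (simp add: q_def)
  next
    case (Suc a)
    have "(\<Sum>t=1..Suc a. (q (Suc a) t)\<^sup>2) = (\<Sum>t=1..a. (q (Suc a) t)\<^sup>2) + (q (Suc a) (Suc a))\<^sup>2"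
      by simp
    also have "(\<Sum>t=1..a. (q (Suc a) t)\<^sup>2) = (\<Sum>t=1..a. \<rho>\<^sup>2 * (q a t)\<^sup>2)"
      using Suc.hyps by (intro sum.cong) (auto simp: shift[of a "Suc a"] power_mult_distrib)
    also have "\<dots> = \<rho>\<^sup>2" using Suc.IH by (simp add: sum_distrib_left[symmetric])
    also have "(q (Suc a) (Suc a))\<^sup>2 = 1 - \<rho>\<^sup>2"
      using Suc.hyps by (simp add: q_def tau)
    finally show ?case by simp
  qed
  have "(\<Sum>t=1..n. q a t * q b t) = (\<Sum>t=1..a. q a t * q b t)"
    using ab by (intro sum.mono_neutral_right) (auto simp: q_def)
  also have "\<dots> = (\<Sum>t=1..a. \<rho> ^ (b - a) * (q a t)\<^sup>2)"
    using ab by (intro sum.cong) (auto simp: shift[of a b] power2_eq_square)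
  also have "\<dots> = \<rho> ^ (b - a)"
    using one[of a] ab by (simp add: sum_distrib_left[symmetric])
  finally show ?thesis .
qed

text \<open>The triangular factor of the AR(1) matrix has the first column \<open>\<rho> ^ (i - 1)\<close> and the entries
  \<open>\<tau> \<rho> ^ (i - j)\<close> in later columns, where \<open>\<tau> = sqrt (1 - \<rho>\<^sup>2)\<close>. Dividing it by \<open>\<tau>\<close> keeps the later
  columns nondegenerate as \<open>\<rho> \<rightarrow> 1\<close> but lets the first one explode. Subtracting \<open>(1 - \<tau>) / \<tau>\<close> times
  \<open>e_plus\<close> from the first column cures this, since \<open>(1 - \<rho> ^ m) / \<tau> \<rightarrow> 0\<close>. What remains is this matrix.\<close>

definition ar1_normalizer :: "real \<Rightarrow> real^'n::{finite,linorder}^'n::{finite,linorder}" where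
  "ar1_normalizer \<rho> = (\<chi> i j. if time j = 1 then 1 + (\<rho> ^ (time i - 1) - 1) / sqrt (1 - \<rho>\<^sup>2)
     else if time j \<le> time i then \<rho> ^ (time i - time j) else 0)"

lemma ar1_factorization:
  fixes \<rho> :: real
  assumes \<rho>: "0 \<le> \<rho>" "\<rho> < 1"
  defines "Q \<equiv> sqrt (1 - \<rho>\<^sup>2) *\<^sub>R ar1_normalizer \<rho> + outer e_plus (axis (obs 1) (1 - sqrt (1 - \<rho>\<^sup>2)))
     :: real^'n::{finite,linorder}^'n::{finite,linorder}"
  shows "Q ** transpose Q = AR1 \<rho>"
proof -
  define \<tau> where "\<tau> = sqrt (1 - \<rho>\<^sup>2)"
  have "\<tau> \<noteq> 0" using \<rho> by (auto simp: \<tau>_def power2_eq_1_iff)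
  define q where "q a t = (if t = 1 then \<rho> ^ (a - 1) else if t \<le> a then \<tau> * \<rho> ^ (a - t) else (0::real))" for a t :: nat
  have "(1::nat) \<le> CARD('n)" using time_bounds[of "undefined :: 'n"] by linarith
  then have "time (obs 1 :: 'n) = 1" by (intro time_obs) auto
  then have obs1: "j = obs 1 \<longleftrightarrow> time j = 1" for j :: 'n by (metis time_inject)
  note obs1' = obs1[unfolded One_nat_def]
  have Q: "Q $ i $ j = q (time i) (time j)" for i j
    using \<open>\<tau> \<noteq> 0\<close> unfolding Q_def q_def \<tau>_def[symmetric]
    by (simp add: ar1_normalizer_def outer_def e_plus_def axis_def obs1' \<tau>_def[symmetric] field_simps)
  have S: "(\<Sum>t=1..CARD('n). q a t * q b t) = \<rho> ^ (b - a)" if "1 \<le> a" "a \<le> b" "b \<le> CARD('n)" for a b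
    unfolding q_def \<tau>_def using \<rho> that by (intro sum_ar1_innovations) auto
  have "(Q ** transpose Q) $ i $ j = AR1 \<rho> $ i $ j" for i j
  proof -
    have "(Q ** transpose Q) $ i $ j = (\<Sum>t=1..CARD('n). q (time i) t * q (time j) t)"
      using sum_time[where 'n='n, of "\<lambda>t. q (time i) t * q (time j) t"]
      by (simp add: matrix_matrix_mult_def transpose_def Q)
    also have "\<dots> = \<rho> ^ nat \<bar>int (time i) - int (time j)\<bar>"
    proof (cases "time i \<le> time j")
      case True
      then show ?thesis
        using S[of "time i" "time j"] time_bounds[of i] time_bounds[of j]
        by (simp add: nat_diff_distrib)
    next
      case False
      then show ?thesis
        using S[of "time j" "time i"] time_bounds[of i] time_bounds[of j]
        by (simp add: nat_diff_distrib mult.commute)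
    qed
    finally show ?thesis by (simp add: AR1_def)
  qed
  then show ?thesis by (simp add: vec_eq_iff)
qed

lemma ar1_scale_bounds:
  fixes \<rho> :: real
  assumes "0 \<le> \<rho>" "\<rho> < 1"
  shows "0 < sqrt (1 - \<rho>\<^sup>2)" "1 - \<rho> \<le> sqrt (1 - \<rho>\<^sup>2)" "sqrt (1 - \<rho>\<^sup>2) \<le> 1"
proof -
  have "\<rho>\<^sup>2 < 1" using assms by (simp add: power_less_one_iff)
  then show "0 < sqrt (1 - \<rho>\<^sup>2)" by simp
  have "0 \<le> 2 * (\<rho> * (1 - \<rho>))" using assms by simp
  then have "(1 - \<rho>)\<^sup>2 \<le> 1 - \<rho>\<^sup>2" by (simp add: power2_eq_square algebra_simps)
  then show "1 - \<rho> \<le> sqrt (1 - \<rho>\<^sup>2)" by (rule real_le_rsqrt)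
  show "sqrt (1 - \<rho>\<^sup>2) \<le> 1" by simp
qed

text \<open>All entries are bounded by the sample size. For the first column this is Bernoulli's inequality
  \<open>1 - \<rho> ^ m \<le> m (1 - \<rho>)\<close> together with \<open>1 - \<rho> \<le> sqrt (1 - \<rho>\<^sup>2)\<close>.\<close>

lemma ar1_normalizer_upper:
  fixes x :: "real^'n::{finite,linorder}"
  assumes \<rho>: "0 \<le> \<rho>" "\<rho> < 1"
  shows "norm (ar1_normalizer \<rho> *v x) \<le> real CARD('n) ^ 3 * norm x"
proof -
  define \<tau> where "\<tau> = sqrt (1 - \<rho>\<^sup>2)"
  note \<tau> = ar1_scale_bounds[OF \<rho>, folded \<tau>_def]
  have "\<bar>ar1_normalizer \<rho> $ i $ j\<bar> \<le> real CARD('n)" for i j :: 'n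
  proof -
    have n1: "1 \<le> real CARD('n)" using time_bounds[of i] by simp
    have pow: "0 \<le> \<rho> ^ m" "\<rho> ^ m \<le> 1" for m using \<rho> by (auto intro: power_le_one)
    have m: "real (time i - 1) + 1 \<le> real CARD('n)" using time_bounds[of i] by simp
    have "1 + real (time i - 1) * (\<rho> - 1) \<le> (1 + (\<rho> - 1)) ^ (time i - 1)"
      using \<rho> by (intro Bernoulli_inequality) auto
    then have "1 - \<rho> ^ (time i - 1) \<le> real (time i - 1) * (1 - \<rho>)"
      by (simp add: algebra_simps)
    also have "\<dots> \<le> real (time i - 1) * \<tau>"
      using \<tau> by (intro mult_left_mono) auto
    finally have "(1 - \<rho> ^ (time i - 1)) / \<tau> \<le> real (time i - 1)"
      using \<tau> by (simp add: divide_le_eq)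
    moreover have "0 \<le> (1 - \<rho> ^ (time i - 1)) / \<tau>" using \<tau> pow by simp
    moreover have "1 + (\<rho> ^ (time i - 1) - 1) / \<tau> = 1 - (1 - \<rho> ^ (time i - 1)) / \<tau>"
      by (simp add: diff_divide_distrib)
    ultimately have "\<bar>1 + (\<rho> ^ (time i - 1) - 1) / \<tau>\<bar> \<le> real CARD('n)"
      using m by simp
    moreover have "\<bar>\<rho> ^ (time i - time j)\<bar> \<le> real CARD('n)"
      using pow[of "time i - time j"] n1 by linarith
    ultimately show ?thesis
      using n1 by (simp add: ar1_normalizer_def \<tau>_def[symmetric])
  qed
  then have "onorm ((*v) (ar1_normalizer \<rho> :: real^'n::{finite,linorder}^'n::{finite,linorder})) \<le> real CARD('n) * real CARD('n) * real CARD('n)"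
    by (rule onorm_le_matrix_component)
  then have "onorm ((*v) (ar1_normalizer \<rho> :: real^'n::{finite,linorder}^'n::{finite,linorder})) * norm x
      \<le> real CARD('n) ^ 3 * norm x"
    unfolding power3_eq_cube by (rule mult_right_mono) simp
  moreover have "norm (ar1_normalizer \<rho> *v x) \<le> onorm ((*v) (ar1_normalizer \<rho> :: real^'n::{finite,linorder}^'n::{finite,linorder})) * norm x"
    by (intro onorm matrix_vector_mul_bounded_linear)
  ultimately show ?thesis by (rule order_trans[rotated])
qed

lemma ar1_normalizer_first:
  fixes x :: "real^'n::{finite,linorder}"
  shows "(ar1_normalizer \<rho> *v x) $ obs 1 = x $ obs 1"
proof -
  have "(1::nat) \<le> CARD('n)" using time_bounds[of "undefined :: 'n"] by linarith
  then have t1: "time (obs 1 :: 'n) = 1" by (intro time_obs) auto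
  have obs1: "time j = 1 \<longleftrightarrow> j = obs 1" for j :: 'n using t1 by (metis time_inject)
  show ?thesis
  proof -
    have "(ar1_normalizer \<rho> *v x) $ obs 1 = (\<Sum>j\<in>UNIV. if j = obs 1 then x $ j else 0)"
      unfolding matrix_vector_mult_def vec_lambda_beta
    proof (intro sum.cong refl)
      fix j :: 'n
      show "ar1_normalizer \<rho> $ obs 1 $ j * x $ j = (if j = obs 1 then x $ j else 0)"
      proof (cases "j = obs 1")
        case True
        then show ?thesis using t1 by (simp add: ar1_normalizer_def)
      next
        case False
        then have "time j \<noteq> 1" "\<not> time j \<le> 1" using time_bounds(1)[of j] obs1[of j] by linarith+
        then show ?thesis using t1 False by (simp add: ar1_normalizer_def)
      qed
    qed
    then show ?thesis by simp
  qed
qed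

text \<open>The inverse is bidiagonal up to its first column: if \<open>y = A x\<close>, then
  \<open>x\<^sub>t = y\<^sub>t - \<rho> y\<^sub>t\<^sub>-\<^sub>1 - \<kappa> y\<^sub>1\<close> for \<open>t > 1\<close>, with a coefficient \<open>\<kappa>\<close> that stays bounded near \<open>\<rho> = 1\<close>.\<close>

lemma ar1_normalizer_lower:
  fixes x :: "real^'n::{finite,linorder}"
  assumes \<rho>: "0 \<le> \<rho>" "\<rho> < 1"
  shows "norm x \<le> 3 * real CARD('n) * norm (ar1_normalizer \<rho> *v x)"
proof -
  define \<tau> where "\<tau> = sqrt (1 - \<rho>\<^sup>2)"
  define \<kappa> where "\<kappa> = (1 - \<rho>) * (1 - 1 / \<tau>)"
  define y where "y = ar1_normalizer \<rho> *v x"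
  note \<tau> = ar1_scale_bounds[OF \<rho>, folded \<tau>_def]
  \<comment> \<open>\<open>\<kappa>\<close> is the first entry of row \<open>i\<close> minus \<open>\<rho>\<close> times that of row \<open>i - 1\<close>.\<close>
  have \<kappa>: "\<bar>\<kappa>\<bar> \<le> 1"
  proof -
    have "\<kappa> = (1 - \<rho>) - (1 - \<rho>) / \<tau>" by (simp add: \<kappa>_def algebra_simps)
    moreover have "(1 - \<rho>) / \<tau> \<le> 1" using \<tau> by (simp add: divide_le_eq)
    moreover have "1 - \<rho> \<le> (1 - \<rho>) / \<tau>" using \<tau> \<rho> by (simp add: le_divide_eq mult_left_le)
    ultimately show ?thesis using \<rho> by simp
  qed
  have "(1::nat) \<le> CARD('n)" using time_bounds[of "undefined :: 'n"] by linarith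
  then have t1: "time (obs 1 :: 'n) = 1" by (intro time_obs) auto
  note t1' = t1[unfolded One_nat_def]
  have obs1: "time j = 1 \<longleftrightarrow> j = obs 1" for j :: 'n using t1 by (metis time_inject)
  have y1: "y $ obs 1 = x $ obs 1"
    unfolding y_def by (rule ar1_normalizer_first)
  have yi: "y $ i - \<rho> * y $ i' = x $ i + \<kappa> * x $ obs 1" if i: "time i' + 1 = time i" for i i'
  proof -
    have i1: "i \<noteq> obs 1" using i time_bounds(1)[of i'] t1 by auto
    have "y $ i - \<rho> * y $ i' = (\<Sum>j\<in>UNIV. (ar1_normalizer \<rho> $ i $ j - \<rho> * ar1_normalizer \<rho> $ i' $ j) * x $ j)"
      by (simp add: y_def matrix_vector_mult_def sum_subtractf sum_distrib_left algebra_simps)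
    also have "\<dots> = (\<Sum>j\<in>UNIV. (if j = i then x $ j else 0) + (if j = obs 1 then \<kappa> * x $ j else 0))"
    proof (intro sum.cong refl)
      fix j :: 'n
      have "ar1_normalizer \<rho> $ i $ j - \<rho> * ar1_normalizer \<rho> $ i' $ j = (if j = i then 1 else 0) + (if j = obs 1 then \<kappa> else 0)"
      proof (cases "j = obs 1")
        case True
        have "time i - 1 = Suc (time i' - 1)" using i time_bounds(1)[of i'] by simp
        then have "\<rho> ^ (time i - 1) = \<rho> * \<rho> ^ (time i' - 1)" by simp
        then show ?thesis using i1 True \<tau>
          by (simp add: ar1_normalizer_def t1' \<tau>_def[symmetric] \<kappa>_def field_simps)
      next
        case False
        then have j1: "time j \<noteq> 1" using obs1 by blast
        consider "j = i" | "time j \<le> time i'" | "time i < time j"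
          using i by (metis Suc_eq_plus1 le_SucE linorder_not_less time_inject)
        then show ?thesis
        proof cases
          case 1
          then show ?thesis using i False j1 by (simp add: ar1_normalizer_def)
        next
          case 2
          then have "time i - time j = Suc (time i' - time j)" using i by simp
          moreover have "j \<noteq> i" using 2 i by auto
          ultimately show ?thesis using 2 i False j1 by (simp add: ar1_normalizer_def)
        next
          case 3
          moreover have "j \<noteq> i" using 3 by auto
          ultimately show ?thesis using i False j1 by (simp add: ar1_normalizer_def)
        qed
      qed
      then show "(ar1_normalizer \<rho> $ i $ j - \<rho> * ar1_normalizer \<rho> $ i' $ j) * x $ j
        = (if j = i then x $ j else 0) + (if j = obs 1 then \<kappa> * x $ j else 0)"
        by (auto simp: algebra_simps)
    qed
    also have "\<dots> = x $ i + \<kappa> * x $ obs 1" by (simp add: sum.distrib)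
    finally show ?thesis .
  qed
  have "\<bar>x $ i\<bar> \<le> 3 * norm y" for i
  proof (cases "time i = 1")
    case True
    then have "i = obs 1" by (simp only: obs1)
    then show ?thesis using y1 component_le_norm_cart[of y "obs 1"] by simp
  next
    case False
    define i' where "i' = (obs (time i - 1) :: 'n)"
    have "time i' = time i - 1"
      unfolding i'_def using False time_bounds[of i] by (intro time_obs) auto
    then have "time i' + 1 = time i" using False time_bounds[of i] by simp
    from yi[OF this] have "x $ i = y $ i - \<rho> * y $ i' - \<kappa> * y $ obs 1" by (simp add: y1[unfolded One_nat_def])
    then have "\<bar>x $ i\<bar> \<le> \<bar>y $ i\<bar> + \<bar>\<rho> * y $ i'\<bar> + \<bar>\<kappa> * y $ obs 1\<bar>"
      by linarith
    also have "\<dots> = \<bar>y $ i\<bar> + \<rho> * \<bar>y $ i'\<bar> + \<bar>\<kappa>\<bar> * \<bar>y $ obs 1\<bar>"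
      using \<rho> by (simp add: abs_mult)
    also have "\<dots> \<le> norm y + 1 * norm y + 1 * norm y"
      using \<rho> \<kappa> by (intro add_mono mult_mono component_le_norm_cart) auto
    finally show ?thesis by simp
  qed
  then have "norm x \<le> (\<Sum>i\<in>(UNIV :: 'n set). 3 * norm y)"
    by (intro order_trans[OF norm_le_l1_cart] sum_mono) auto
  then show ?thesis by (simp add: y_def)
qed

lemma det_nonzeroI:
  fixes A :: "real^'n^'n"
  assumes "\<And>x. A *v x = 0 \<Longrightarrow> x = 0"
  shows "det A \<noteq> 0"
proof -
  have "\<exists>B. B ** A = mat 1"
    using assms unfolding matrix_left_invertible_ker by blast
  then show ?thesis
    by (simp add: invertible_left_inverse invertible_det_nz[symmetric])
qed

lemma outer_vector_mult: "outer u v *v x = (v \<bullet> x) *\<^sub>R u"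
  by (simp add: vec_eq_iff matrix_vector_mult_def outer_def inner_vec_def sum_distrib_left algebra_simps)

lemma minus_one_power_dist: "(- 1 :: real) ^ (a + b) = (- 1) ^ nat \<bar>int a - int b\<bar>"
proof (cases "a \<le> b")
  case True
  then have "a + b = 2 * a + (b - a)" "nat \<bar>int a - int b\<bar> = b - a" by auto
  then show ?thesis by (simp only: power_add power_minus1_even mult_1)
next
  case False
  then have "a + b = 2 * b + (a - b)" "nat \<bar>int a - int b\<bar> = a - b" by auto
  then show ?thesis by (simp only: power_add power_minus1_even mult_1)
qed

text \<open>The degeneration of the AR(1) matrix as \<open>\<bar>\<rho>\<bar> \<rightarrow> 1\<close> is confined to a single direction \<open>e\<close>: apart from it
  the factor is \<open>sqrt (1 - \<rho>\<^sup>2)\<close> times a matrix whose norm and inverse are bounded uniformly in \<open>\<rho>\<close>.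
  A negative \<open>\<rho>\<close> reduces to \<open>\<bar>\<rho>\<bar>\<close> by alternating the signs of the rows, which exchanges \<open>e_plus\<close>
  and \<open>e_minus\<close>.\<close>

lemma ar1_decomposition:
  fixes \<rho> :: real
  assumes \<rho>: "\<bar>\<rho>\<bar> < 1"
  shows "\<exists>(A :: real^'n::{finite,linorder}^'n::{finite,linorder}) e c.
    (e = e_plus \<or> e = e_minus)
    \<and> (sqrt (1 - \<rho>\<^sup>2) *\<^sub>R A + outer e c) ** transpose (sqrt (1 - \<rho>\<^sup>2) *\<^sub>R A + outer e c) = AR1 \<rho>
    \<and> det (sqrt (1 - \<rho>\<^sup>2) *\<^sub>R A + outer e c) \<noteq> 0
    \<and> (\<forall>x. norm (A *v x) \<le> 3 * real CARD('n) ^ 3 * norm x \<and> norm x \<le> 3 * real CARD('n) ^ 3 * norm (A *v x))"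
proof -
  define A0 :: "real^'n::{finite,linorder}^'n::{finite,linorder}" where "A0 = ar1_normalizer \<bar>\<rho>\<bar>"
  define c :: "real^'n::{finite,linorder}" where "c = axis (obs 1) (1 - sqrt (1 - \<rho>\<^sup>2))"
  define Q0 where "Q0 = sqrt (1 - \<rho>\<^sup>2) *\<^sub>R A0 + outer e_plus c"
  have Q0: "Q0 ** transpose Q0 = AR1 \<bar>\<rho>\<bar>"
    using ar1_factorization[of "\<bar>\<rho>\<bar>"] \<rho> by (simp add: Q0_def A0_def c_def)
  have "1 \<le> real CARD('n)" by simp
  then have pw: "real CARD('n) ^ 1 \<le> real CARD('n) ^ 3" by (intro power_increasing) auto
  have up: "norm (A0 *v x) \<le> 3 * real CARD('n) ^ 3 * norm x" for x
    using ar1_normalizer_upper[of "\<bar>\<rho>\<bar>" x] \<rho> unfolding A0_def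
    by (smt (verit, best) mult_right_mono norm_ge_zero zero_le_power of_nat_0_le_iff)
  have lo: "norm x \<le> 3 * real CARD('n) ^ 3 * norm (A0 *v x)" for x
  proof -
    have "norm x \<le> 3 * real CARD('n) * norm (A0 *v x)"
      using ar1_normalizer_lower[of "\<bar>\<rho>\<bar>" x] \<rho> unfolding A0_def by simp
    also have "\<dots> \<le> 3 * real CARD('n) ^ 3 * norm (A0 *v x)"
      using pw by (intro mult_right_mono mult_left_mono) auto
    finally show ?thesis .
  qed
  \<comment> \<open>The first coordinates of \<open>A0 x\<close> and of \<open>Q0 x\<close> are both that of \<open>x\<close>, so on the kernel of \<open>Q0\<close>
    the multiple of \<open>e_plus\<close> vanishes and \<open>A0 x = 0\<close>.\<close>
  have ker: "x = 0" if "Q0 *v x = 0" for x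
  proof -
    define \<tau> where "\<tau> = sqrt (1 - \<rho>\<^sup>2)"
    have "\<tau> \<noteq> 0" using ar1_scale_bounds(1)[of "\<bar>\<rho>\<bar>"] \<rho> by (simp add: \<tau>_def)
    have Q0x: "Q0 *v x = \<tau> *\<^sub>R (A0 *v x) + (c \<bullet> x) *\<^sub>R e_plus" for x
      by (simp add: Q0_def \<tau>_def matrix_vector_mult_add_rdistrib scaleR_matrix_vector_assoc outer_vector_mult)
    have cx: "c \<bullet> x = (1 - \<tau>) * x $ obs 1" by (simp add: c_def \<tau>_def inner_axis' )
    have "(Q0 *v x) $ obs 1 = x $ obs 1"
      by (simp add: Q0x cx A0_def ar1_normalizer_first[unfolded One_nat_def] e_plus_def algebra_simps)
    with that have "x $ obs 1 = 0" by simp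
    then have "\<tau> *\<^sub>R (A0 *v x) = 0" using that Q0x[of x] cx by simp
    then have "A0 *v x = 0" using \<open>\<tau> \<noteq> 0\<close> by simp
    then show ?thesis using lo[of x] by simp
  qed
  show ?thesis
  proof (cases "0 \<le> \<rho>")
    case True
    then have "Q0 ** transpose Q0 = AR1 \<rho>" using Q0 by simp
    moreover have "det Q0 \<noteq> 0" using ker by (rule det_nonzeroI)
    ultimately show ?thesis
      using up lo unfolding Q0_def by (intro exI[of _ A0] exI[of _ e_plus] exI[of _ c]) simp
  next
    case False
    define A :: "real^'n::{finite,linorder}^'n::{finite,linorder}" where "A = (\<chi> i j. (-1) ^ time i * A0 $ i $ j)"
    define Q where "Q = sqrt (1 - \<rho>\<^sup>2) *\<^sub>R A + outer e_minus c"
    have Qe: "Q $ i $ j = (-1) ^ time i * Q0 $ i $ j" for i j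
      by (simp add: Q_def Q0_def A_def outer_def e_minus_def e_plus_def algebra_simps)
    have "(Q ** transpose Q) $ i $ j = AR1 \<rho> $ i $ j" for i j
    proof -
      have "(Q ** transpose Q) $ i $ j = (-1) ^ time i * (-1) ^ time j * (Q0 ** transpose Q0) $ i $ j"
        by (simp add: matrix_matrix_mult_def transpose_def Qe sum_distrib_left algebra_simps)
      also have "\<dots> = (-1) ^ (time i + time j) * \<bar>\<rho>\<bar> ^ nat \<bar>int (time i) - int (time j)\<bar>"
        by (simp add: Q0 AR1_def power_add)
      also have "(-1::real) ^ (time i + time j) = (-1) ^ nat \<bar>int (time i) - int (time j)\<bar>"
        by (rule minus_one_power_dist)
      also have "(-1) ^ nat \<bar>int (time i) - int (time j)\<bar> * \<bar>\<rho>\<bar> ^ nat \<bar>int (time i) - int (time j)\<bar>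
        = \<rho> ^ nat \<bar>int (time i) - int (time j)\<bar>"
        using False by (simp add: power_mult_distrib[symmetric])
      finally show ?thesis by (simp add: AR1_def)
    qed
    then have QQ: "Q ** transpose Q = AR1 \<rho>" by (simp add: vec_eq_iff)
    have "(A *v x) $ i = (-1) ^ time i * (A0 *v x) $ i" for x i
      by (simp add: A_def matrix_vector_mult_def sum_distrib_left mult.assoc)
    then have norm_A: "norm (A *v x) = norm (A0 *v x)" for x
      by (simp add: norm_vec_def abs_mult)
    have "(Q *v x) $ i = (-1) ^ time i * (Q0 *v x) $ i" for x i
      by (simp add: Qe matrix_vector_mult_def sum_distrib_left mult.assoc)
    then have "Q *v x = 0 \<Longrightarrow> Q0 *v x = 0" for x
      by (simp add: vec_eq_iff)
    then have "det Q \<noteq> 0" using ker by (intro det_nonzeroI) blast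
    then show ?thesis
      using QQ up lo unfolding Q_def by (intro exI[of _ A] exI[of _ e_minus] exI[of _ c]) (simp add: norm_A)
  qed
qed

section \<open>Least squares and the sandwich form of the covariance estimator\<close>

lemma continuous_on_matrix_vector_mult [continuous_intros]:
  fixes A :: "real^'n^'m"
  assumes "continuous_on S f"
  shows "continuous_on S (\<lambda>x. A *v f x)"
proof -
  have "continuous_on UNIV ((*v) A)"
    by (intro linear_continuous_on matrix_vector_mul_bounded_linear)
  then show ?thesis
    using assms by (rule continuous_on_compose2) auto
qed

lemma continuous_on_det:
  fixes A :: "'a::topological_space \<Rightarrow> real^'n^'n"
  assumes "\<And>i j. continuous_on S (\<lambda>x. A x $ i $ j)"
  shows "continuous_on S (\<lambda>x. det (A x))"
  unfolding det_def by (intro continuous_intros assms)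

text \<open>The minimum over the compact unit sphere is attained and positive.\<close>

lemma positive_definite_lower_bound:
  fixes W :: "real^'n^'n"
  assumes "positive_definite W"
  obtains l where "0 < l" and "\<And>z. l * (norm z)\<^sup>2 \<le> z \<bullet> (W *v z)"
proof -
  have pos: "0 < z \<bullet> (W *v z)" if "z \<noteq> 0" for z
    using assms that by (simp add: positive_definite_def)
  have "continuous_on (sphere 0 1) (\<lambda>z. z \<bullet> (W *v z))"
    by (intro continuous_intros)
  moreover have "sphere (0::real^'n) 1 \<noteq> {}" by simp
  ultimately obtain z0 where z0: "z0 \<in> sphere 0 1" "\<And>z. z \<in> sphere 0 1 \<Longrightarrow> z0 \<bullet> (W *v z0) \<le> z \<bullet> (W *v z)"
    using continuous_attains_inf[OF compact_sphere] by blast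
  define l where "l = z0 \<bullet> (W *v z0)"
  have "z0 \<noteq> 0" using z0(1) by auto
  then have "0 < l" using pos by (simp add: l_def)
  moreover have "l * (norm z)\<^sup>2 \<le> z \<bullet> (W *v z)" for z
  proof (cases "z = 0")
    case False
    have "l \<le> (z /\<^sub>R norm z) \<bullet> (W *v (z /\<^sub>R norm z))"
      unfolding l_def using False by (intro z0(2)) simp
    also have "\<dots> = (z \<bullet> (W *v z)) / (norm z)\<^sup>2"
      by (simp add: matrix_vector_mult_scaleR power2_eq_square divide_inverse)
    finally show ?thesis using False by (simp add: pos_le_divide_eq)
  qed simp
  ultimately show ?thesis using that by blast
qed

lemma span_columns: "span (columns A) = range ((*v) A)" for A :: "real^'n^'m"
proof
  have "columns A \<subseteq> range ((*v) A)"
    by (auto simp: columns_def matrix_vector_mult_basis[symmetric])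
  moreover have "subspace (range ((*v) A))"
    by (intro linear_subspace_image) auto
  ultimately show "span (columns A) \<subseteq> range ((*v) A)"
    by (rule span_minimal)
qed (auto intro: matrix_vector_mult_in_columnspace)

definition ols_matrix :: "real^'p^'n \<Rightarrow> real^'n^'p" where
  "ols_matrix X = matrix_inv (transpose X ** X) ** transpose X"

lemma ols_eq: "ols X y = ols_matrix X *v y"
  by (simp only: ols_def ols_matrix_def matrix_vector_mul_assoc)

lemma gram_invertible:
  fixes X :: "real^'p^'n"
  assumes "rank X = CARD('p)"
  shows "det (transpose X ** X) \<noteq> 0"
proof (rule det_nonzeroI)
  fix x assume "(transpose X ** X) *v x = 0"
  then have "x \<bullet> (transpose X *v (X *v x)) = 0" by (simp add: matrix_vector_mul_assoc)
  then have "(X *v x) \<bullet> (X *v x) = 0" by (simp only: inner_matrix_vector_mult)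
  then have "X *v x = X *v 0" by simp
  moreover have "inj ((*v) X)" using assms by (simp add: full_rank_injective)
  ultimately show "x = 0" by (meson injD)
qed

lemma transpose_gram_inverse:
  fixes X :: "real^'p^'n"
  assumes "rank X = CARD('p)"
  shows "transpose (matrix_inv (transpose X ** X)) = matrix_inv (transpose X ** X)"
proof -
  have "transpose (matrix_inv (transpose X ** X) ** (transpose X ** X)) = mat 1"
    using matrix_inv_mult(2)[OF gram_invertible[OF assms]] by simp
  then have "(transpose X ** X) ** transpose (matrix_inv (transpose X ** X)) = mat 1"
    by (simp add: matrix_transpose_mul)
  then show ?thesis by (rule matrix_inv_eqI[symmetric])
qed

lemma ols_fitted:
  assumes "rank X = CARD('p)"
  shows "ols X (X *v b) = (b :: real^'p)"
proof -
  have "ols X (X *v b) = matrix_inv (transpose X ** X) *v ((transpose X ** X) *v b)"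
    by (simp only: ols_def matrix_vector_mul_assoc matrix_mul_assoc)
  then show ?thesis by (simp only: matrix_inv_vector_mult(2)[OF gram_invertible[OF assms]])
qed

lemma ols_affine: "ols X (u + c *\<^sub>R v) = ols X u + c *\<^sub>R ols X v"
  by (simp add: ols_eq matrix_vector_right_distrib matrix_vector_mult_scaleR)

lemma resid_affine: "resid X (u + c *\<^sub>R v) = resid X u + c *\<^sub>R resid X v"
  by (simp add: resid_def ols_affine matrix_vector_right_distrib matrix_vector_mult_scaleR algebra_simps)

lemma resid_fitted: "rank X = CARD('p) \<Longrightarrow> resid X (X *v b) = 0" for b :: "real^'p"
  by (simp add: resid_def ols_fitted)

lemma resid_shift: "rank X = CARD('p) \<Longrightarrow> resid X (X *v b + c *\<^sub>R y) = c *\<^sub>R resid X y" for b :: "real^'p"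
  by (simp add: resid_affine resid_fitted)

text \<open>Residuals are an orthogonal projection.\<close>

lemma resid_selfadjoint:
  fixes X :: "real^'p^'n"
  assumes "rank X = CARD('p)"
  shows "resid X y \<bullet> z = y \<bullet> resid X z"
proof -
  define G where "G = matrix_inv (transpose X ** X)"
  have "(X *v (G *v (transpose X *v y))) \<bullet> z = (transpose X *v y) \<bullet> (transpose G *v (transpose X *v z))"
    by (simp only: inner_matrix_vector_mult)
  also have "\<dots> = y \<bullet> (X *v (G *v (transpose X *v z)))"
    by (simp only: inner_matrix_vector_mult[of "transpose X"] transpose_transpose
        transpose_gram_inverse[OF assms, folded G_def])
  finally show ?thesis
    by (simp only: resid_def ols_def G_def[symmetric] inner_diff_left inner_diff_right)
qed

lemma continuous_on_resid [continuous_intros]: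
  "continuous_on S f \<Longrightarrow> continuous_on S (\<lambda>x. resid X (f x))"
  unfolding resid_def ols_eq by (intro continuous_intros)

definition weight_matrix :: "(int \<Rightarrow> real) \<Rightarrow> real^'n::{finite,linorder}^'n::{finite,linorder}" where
  "weight_matrix w = (\<chi> i j. w (int (time i) - int (time j)))"

lemma obs_time: "obs (time i) = i"
  using bij_betw_time[where 'n='a] unfolding obs_def
  by (simp add: bij_betw_def)

lemma transpose_outer: "transpose (outer u v) = outer v u"
  by (simp add: vec_eq_iff transpose_def outer_def mult.commute)

lemma transpose_sum: "transpose (\<Sum>x\<in>A. f x) = (\<Sum>x\<in>A. transpose (f x))"
  by (simp add: vec_eq_iff transpose_def)

text \<open>For both signs of the lag the definition sums over the pairs of times at that signed distance;
  transposition at a negative lag exchanges the two members of a pair.\<close>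

lemma autocov_eq:
  fixes X :: "real^'p^'n::{finite,linorder}" and y :: "real^'n::{finite,linorder}"
  defines "F \<equiv> \<lambda>(s, t). outer (score X y (obs s)) (score X y (obs t))"
  assumes j: "\<bar>j\<bar> < int CARD('n)"
  shows "autocov X y j = (1 / real CARD('n)) *\<^sub>R
    (\<Sum>p\<in>{p \<in> {1..CARD('n)} \<times> {1..CARD('n)}. int (fst p) - int (snd p) = j}. F p)"
proof (cases "0 \<le> j")
  case True
  define m where "m = nat j"
  have jm: "j = int m" using True by (simp add: m_def)
  have "(\<Sum>t = m + 1..CARD('n). F (t, t - m))
      = (\<Sum>p\<in>{p \<in> {1..CARD('n)} \<times> {1..CARD('n)}. int (fst p) - int (snd p) = j}. F p)"
    by (rule sum.reindex_bij_witness[where i=fst and j="\<lambda>t. (t, t - m)"]) (auto simp: jm)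
  then show ?thesis
    using True by (simp add: autocov_def autocov_nonneg_def F_def m_def)
next
  case False
  define m where "m = nat (- j)"
  have jm: "j = - int m" using False by (simp add: m_def)
  have "(\<Sum>t = m + 1..CARD('n). F (t - m, t))
      = (\<Sum>p\<in>{p \<in> {1..CARD('n)} \<times> {1..CARD('n)}. int (fst p) - int (snd p) = j}. F p)"
    by (rule sum.reindex_bij_witness[where i=snd and j="\<lambda>t. (t - m, t)"]) (auto simp: jm)
  then show ?thesis
    using False by (simp add: autocov_def autocov_nonneg_def F_def m_def transpose_scalar transpose_sum transpose_outer)
qed

lemma Psi_eq:
  fixes X :: "real^'p^'n::{finite,linorder}"
  shows "Psi w X y = (1 / real CARD('n)) *\<^sub>R
    (\<Sum>i\<in>UNIV. \<Sum>j\<in>UNIV. weight_matrix w $ i $ j *\<^sub>R outer (score X y i) (score X y j))"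
proof -
  define N where "N = CARD('n)"
  define P where "P = {1..N} \<times> {1..N}"
  define F where "F = (\<lambda>(s, t). outer (score X y (obs s)) (score X y (obs t)))"
  define \<delta> where "\<delta> = (\<lambda>p :: nat \<times> nat. int (fst p) - int (snd p))"
  have "Psi w X y = (\<Sum>j = - (int N - 1)..int N - 1. w j *\<^sub>R ((1 / real N) *\<^sub>R (\<Sum>p\<in>{p \<in> P. \<delta> p = j}. F p)))"
    unfolding Psi_def N_def
    by (intro sum.cong refl, subst autocov_eq) (auto simp: P_def N_def F_def \<delta>_def)
  also have "\<dots> = (\<Sum>j = - (int N - 1)..int N - 1. \<Sum>p\<in>{p \<in> P. \<delta> p = j}. (1 / real N) *\<^sub>R (w (\<delta> p) *\<^sub>R F p))"
    by (simp add: scaleR_sum_right)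
  also have "\<dots> = (\<Sum>p\<in>P. (1 / real N) *\<^sub>R (w (\<delta> p) *\<^sub>R F p))"
    by (rule sum.group) (auto simp: P_def \<delta>_def)
  also have "\<dots> = (1 / real N) *\<^sub>R (\<Sum>p\<in>P. w (\<delta> p) *\<^sub>R F p)"
    by (simp only: scaleR_sum_right)
  also have "(\<Sum>p\<in>P. w (\<delta> p) *\<^sub>R F p) = (\<Sum>s=1..N. \<Sum>t=1..N. w (\<delta> (s, t)) *\<^sub>R F (s, t))"
    unfolding P_def by (simp only: sum.cartesian_product) (simp add: case_prod_unfold)
  also have "\<dots> = (\<Sum>i\<in>(UNIV :: 'n set). \<Sum>j\<in>(UNIV :: 'n set). w (\<delta> (time i, time j)) *\<^sub>R F (time i, time j))"
    unfolding N_def sum_time[where 'n='n, symmetric] by (rule refl)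
  also have "\<dots> = (\<Sum>i\<in>UNIV. \<Sum>j\<in>UNIV. weight_matrix w $ i $ j *\<^sub>R outer (score X y i) (score X y j))"
    by (simp add: weight_matrix_def \<delta>_def F_def obs_time)
  finally show ?thesis by (simp only: N_def)
qed

definition score_matrix :: "real^'p^'n \<Rightarrow> real^'p^'q \<Rightarrow> real^'n \<Rightarrow> real^'q^'n" where
  "score_matrix X R y = (\<chi> i a. resid X y $ i * (R ** ols_matrix X) $ a $ i)"

lemma congruence_outer: "P ** outer u v ** transpose Q = outer (P *v u) (Q *v v)"
  by (simp add: vec_eq_iff matrix_matrix_mult_def outer_def transpose_def matrix_vector_mult_def
      sum_distrib_left sum_distrib_right mult_ac) (intro allI sum.swap)

lemma matrix_add_mult: "(B + C) ** A = B ** A + C ** A" for A :: "real^'n^'m"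
  by (simp add: vec_eq_iff matrix_matrix_mult_def sum.distrib algebra_simps)

lemma matrix_mult_sum_left: "P ** (\<Sum>x\<in>A. f x) = (\<Sum>x\<in>A. P ** f x)" for P :: "real^'n^'m"
  by (induction A rule: infinite_finite_induct) (auto simp: matrix_add_ldistrib)

lemma matrix_mult_sum_right: "(\<Sum>x\<in>A. f x) ** P = (\<Sum>x\<in>A. f x ** P)" for P :: "real^'n^'m"
  by (induction A rule: infinite_finite_induct) (auto simp: matrix_add_mult)

text \<open>The estimate is a congruence transform of the weight matrix by a matrix that is linear in the
  residuals, so positive definite weights make it positive semidefinite.\<close>

lemma Omega_sandwich:
  fixes X :: "real^'p^'n::{finite,linorder}" and R :: "real^'p^'q"
  assumes "rank X = CARD('p)"
  shows "Omega w X R y = transpose (score_matrix X R y) ** weight_matrix w ** score_matrix X R y"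
proof -
  define G where "G = matrix_inv (transpose X ** X)"
  define P where "P = R ** G"
  have tP: "G ** transpose R = transpose P"
    by (simp add: P_def matrix_transpose_mul transpose_gram_inverse[OF assms, folded G_def])
  have Ps: "P *v score X y i = (\<chi> a. score_matrix X R y $ i $ a)" for i
  proof -
    have "P *v score X y i = resid X y $ i *\<^sub>R (P *v row i X)"
      by (simp add: score_def matrix_vector_mult_scaleR)
    moreover have "(P *v row i X) $ a = (R ** ols_matrix X) $ a $ i" for a
      by (simp add: ols_matrix_def G_def[symmetric] P_def matrix_mul_assoc)
         (simp add: matrix_vector_mult_def matrix_matrix_mult_def[of "R ** G"] transpose_def row_def)
    ultimately show ?thesis by (simp add: vec_eq_iff score_matrix_def)
  qed
  have "Omega w X R y = real CARD('n) *\<^sub>R (P ** Psi w X y ** transpose P)"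
    unfolding Omega_def G_def[symmetric] tP[symmetric] by (simp only: P_def matrix_mul_assoc)
  also have "\<dots> = P ** (\<Sum>i\<in>UNIV. \<Sum>j\<in>UNIV. weight_matrix w $ i $ j *\<^sub>R outer (score X y i) (score X y j)) ** transpose P"
    by (simp add: Psi_eq matrix_scalar_ac scalar_matrix_assoc[symmetric])
  also have "\<dots> = (\<Sum>i\<in>UNIV. \<Sum>j\<in>UNIV. weight_matrix w $ i $ j *\<^sub>R outer (P *v score X y i) (P *v score X y j))"
    by (simp add: matrix_mult_sum_left matrix_mult_sum_right matrix_scalar_ac scalar_matrix_assoc[symmetric] congruence_outer)
  also have "\<dots> = transpose (score_matrix X R y) ** weight_matrix w ** score_matrix X R y"
  proof -
    have "(\<Sum>i\<in>UNIV. \<Sum>j\<in>UNIV. weight_matrix w $ i $ j *\<^sub>R outer (P *v score X y i) (P *v score X y j)) $ a $ b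
       = (transpose (score_matrix X R y) ** weight_matrix w ** score_matrix X R y) $ a $ b" for a b
      unfolding Ps matrix_mul_assoc[symmetric]
      by (simp add: matrix_matrix_mult_def outer_def transpose_def sum_distrib_left mult_ac)
    then show ?thesis by (simp add: vec_eq_iff)
  qed
  finally show ?thesis .
qed

section \<open>The test statistic\<close>

lemma scaleR_eq_mat_mult: "c *\<^sub>R A = mat c ** A" for A :: "real^'m^'n"
  by (simp add: vec_eq_iff matrix_matrix_mult_def mat_def mult_delta_left)

lemma det_scaleR: "det (c *\<^sub>R A) = c ^ CARD('n) * det A" for A :: "real^'n^'n"
  by (simp add: scaleR_eq_mat_mult det_mul det_mat)

lemma matrix_inv_scaleR:
  fixes A :: "real^'n^'n"
  assumes "c \<noteq> 0" and "det A \<noteq> 0"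
  shows "matrix_inv (c *\<^sub>R A) = (1 / c) *\<^sub>R matrix_inv A"
  using assms by (intro matrix_inv_eqI)
    (simp add: matrix_scalar_ac scalar_matrix_assoc[symmetric] matrix_inv_mult)

lemma inverse_quadratic_form_cramer:
  fixes A :: "real^'n^'n"
  assumes "det A \<noteq> 0"
  shows "v \<bullet> (matrix_inv A *v v)
    = (\<Sum>k\<in>UNIV. v $ k * det (\<chi> i j. if j = k then v $ i else A $ i $ j)) / det A"
proof -
  have "A *v (matrix_inv A *v v) = v"
    using assms by (rule matrix_inv_vector_mult)
  then have "matrix_inv A *v v = (\<chi> k. det (\<chi> i j. if j = k then v $ i else A $ i $ j) / det A)"
    using cramer[OF assms] by blast
  then show ?thesis by (simp add: inner_vec_def sum_divide_distrib)
qed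

locale robust_test =
  fixes X :: "real^'p^'n::{finite,linorder}" and R :: "real^'p^'q" and w :: "int \<Rightarrow> real"
  assumes full_rank: "rank X = CARD('p)"
    and surj_R: "surj ((*v) R)"
    and rank_cond: "rank_condition X R"
    and weights: "positive_definite (weight_matrix w :: real^'n::{finite,linorder}^'n::{finite,linorder})"
begin

abbreviation "V \<equiv> Omega w X R"
abbreviation "M \<equiv> score_matrix X R"
abbreviation "est y \<equiv> R *v ols X y"

text \<open>The parameter \<open>d\<close> carries at once the hypothesized value \<open>- r\<close> and, after normalization, the
  violation of the restriction in units of the standard deviation.\<close>

definition stat :: "real^'q \<Rightarrow> real^'n::{finite,linorder} \<Rightarrow> real" where
  "stat d y = (if det (V y) \<noteq> 0 then (est y + d) \<bullet> (matrix_inv (V y) *v (est y + d)) else 0)"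

text \<open>An upper bound for the operator norm of \<open>M' W\<close> that is continuous in \<open>y\<close> and, like \<open>M\<close>, a function of the
  residuals only.\<close>

definition gauge :: "real^'n::{finite,linorder} \<Rightarrow> real" where
  "gauge y = (\<Sum>a\<in>UNIV. \<Sum>i\<in>UNIV. \<bar>(transpose (M y) ** weight_matrix w) $ a $ i\<bar>)"

lemma est_shift: "est (X *v b + c *\<^sub>R y) = R *v b + c *\<^sub>R est y"
  by (simp add: ols_affine ols_fitted[OF full_rank] matrix_vector_right_distrib matrix_vector_mult_scaleR)

lemma M_shift: "M (X *v b + c *\<^sub>R y) = c *\<^sub>R M y"
  by (simp add: score_matrix_def resid_shift[OF full_rank] vec_eq_iff)

lemma V_eq: "V y = transpose (M y) ** weight_matrix w ** M y"
  by (rule Omega_sandwich[OF full_rank])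

lemma V_shift: "V (X *v b + c *\<^sub>R y) = c\<^sup>2 *\<^sub>R V y"
  by (simp add: V_eq M_shift transpose_scalar matrix_scalar_ac scalar_matrix_assoc[symmetric] power2_eq_square)

lemma gauge_shift: "gauge (X *v b + y) = gauge y"
  using M_shift[of b 1 y] by (simp add: gauge_def)

lemma stat_shift:
  assumes "c \<noteq> 0"
  shows "stat d (X *v b + c *\<^sub>R y) = stat ((1 / c) *\<^sub>R (R *v b + d)) y"
proof (cases "det (V y) = 0")
  case True
  then show ?thesis using assms by (simp add: stat_def V_shift det_scaleR)
next
  case False
  have v: "est (X *v b + c *\<^sub>R y) + d = c *\<^sub>R (est y + (1 / c) *\<^sub>R (R *v b + d))"
    using assms unfolding est_shift by (simp add: scaleR_add_right)
  show ?thesis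
    using assms False unfolding stat_def v V_shift
    by (simp add: det_scaleR matrix_inv_scaleR scaleR_matrix_vector_assoc[symmetric]
        matrix_vector_mult_scaleR power2_eq_square)
qed

lemma continuous_on_M [continuous_intros]: "continuous_on S (\<lambda>y. M y $ i $ a)"
  unfolding score_matrix_def vec_lambda_beta by (intro continuous_intros)

lemma continuous_on_V [continuous_intros]: "continuous_on S (\<lambda>y. V y $ a $ b)"
  unfolding V_eq matrix_matrix_mult_def transpose_def vec_lambda_beta by (intro continuous_intros)

lemma continuous_on_est [continuous_intros]: "continuous_on S (\<lambda>y. est y)"
  unfolding ols_eq by (intro continuous_intros)

lemma continuous_on_det_V [continuous_intros]: "continuous_on S (\<lambda>y. det (V y))"
  by (intro continuous_on_det continuous_intros)

lemma continuous_on_gauge [continuous_intros]: "continuous_on S gauge"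
  unfolding gauge_def matrix_matrix_mult_def transpose_def vec_lambda_beta by (intro continuous_intros)

definition stat_numerator :: "real^'q \<Rightarrow> real^'n::{finite,linorder} \<Rightarrow> real" where
  "stat_numerator d y = (\<Sum>k\<in>UNIV. (est y + d) $ k *
     det (\<chi> i j. if j = k then (est y + d) $ i else V y $ i $ j))"

text \<open>Cramer's rule makes the statistic a quotient of continuous functions. At a singular covariance
  estimate both sides are 0, the right one because \<open>x / 0 = 0\<close>.\<close>

lemma stat_eq: "stat d y = stat_numerator d y / det (V y)"
  by (simp add: stat_def stat_numerator_def inverse_quadratic_form_cramer)

lemma continuous_on_stat_numerator [continuous_intros]: "continuous_on S (stat_numerator d)"
proof -
  have "continuous_on S (\<lambda>y. if j = k then (est y + d) $ i else V y $ i $ j)" for i j k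
    by (cases "j = k") (auto intro!: continuous_intros)
  then show ?thesis
    unfolding stat_numerator_def by (intro continuous_intros continuous_on_det) simp
qed

lemma borel_stat [measurable]: "stat d \<in> borel_measurable borel"
proof -
  have [measurable]: "stat_numerator d \<in> borel_measurable borel" "(\<lambda>y. det (V y)) \<in> borel_measurable borel"
    by (intro borel_measurable_continuous_onI continuous_intros)+
  show ?thesis unfolding stat_eq[abs_def] by measurable
qed

lemma borel_gauge [measurable]: "gauge \<in> borel_measurable borel"
  by (intro borel_measurable_continuous_onI continuous_intros)

lemma borel_est [measurable]: "est \<in> borel_measurable borel"
  by (intro borel_measurable_continuous_onI continuous_intros)

lemma borel_det_V [measurable]: "(\<lambda>y. det (V y)) \<in> borel_measurable borel"
  by (intro borel_measurable_continuous_onI continuous_intros)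

text \<open>If \<open>V x = 0\<close>, then positive definiteness of the weights gives \<open>M x = 0\<close>, that is, \<open>x\<close> is orthogonal to
  every column of \<open>R (X' X)\<^sup>-\<^sup>1 X'\<close> whose residual is nonzero. The rank condition says that
  these columns span.\<close>

lemma det_V_nonzero:
  assumes "\<And>i. axis i 1 \<notin> span (columns X) \<Longrightarrow> resid X y $ i \<noteq> 0"
  shows "det (V y) \<noteq> 0"
proof (rule det_nonzeroI)
  fix x assume x: "V y *v x = 0"
  define B where "B = R ** ols_matrix X"
  define S where "S = (\<lambda>v. (R ** matrix_inv (transpose X ** X)) *v v) `
            {column i (transpose X) | i. axis i 1 \<notin> span (columns X)}"
  have "0 = x \<bullet> (transpose (M y) *v (weight_matrix w *v (M y *v x)))"
    using x by (simp add: V_eq matrix_vector_mul_assoc matrix_mul_assoc)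
  also have "\<dots> = (M y *v x) \<bullet> (weight_matrix w *v (M y *v x))"
    by (simp only: inner_matrix_vector_mult)
  finally have Mx: "M y *v x = 0"
    using weights unfolding positive_definite_def by (metis less_irrefl)
  have S0: "z \<bullet> x = 0" if "z \<in> S" for z
  proof -
    obtain i where i: "axis i 1 \<notin> span (columns X)"
      and z: "z = (R ** matrix_inv (transpose X ** X)) *v column i (transpose X)"
      using \<open>z \<in> S\<close> unfolding S_def by blast
    have "z = column i B"
      by (simp only: z B_def ols_matrix_def matrix_vector_mult_basis[symmetric] matrix_vector_mul_assoc matrix_mul_assoc)
    then have "(M y *v x) $ i = resid X y $ i * (z \<bullet> x)"
      by (simp add: matrix_vector_mult_def score_matrix_def B_def column_def inner_vec_def sum_distrib_left mult.assoc)
    then show ?thesis using Mx assms[OF i] by simp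
  qed
  have "span S = UNIV"
    using rank_cond dim_eq_full[of S] by (simp add: rank_condition_def S_def)
  moreover have "span S \<subseteq> {z. z \<bullet> x = 0}"
    using S0 by (intro span_minimal) (auto simp: subspace_def inner_add_left)
  ultimately have "x \<bullet> x = 0" by blast
  then show "x = 0" by simp
qed

text \<open>The \<open>i\<close>-th residual is the linear functional represented by the residual vector of the \<open>i\<close>-th unit vector, which is nonzero
  unless that unit vector lies in the column space. So the estimate is singular only on a finite
  union of hyperplanes.\<close>

lemma det_V_null_set: "{y. det (V y) = 0} \<in> null_sets lborel"
proof -
  define I where "I = {i. axis i 1 \<notin> span (columns X)}"
  have "negligible (\<Union>i\<in>I. {y. resid X (axis i 1) \<bullet> y = 0})"
  proof (rule negligible_Union, simp, clarify, rule negligible_hyperplane)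
    fix i assume "i \<in> I"
    moreover have "axis i 1 = X *v ols X (axis i 1)" if "resid X (axis i 1) = 0"
      using that by (simp add: resid_def)
    ultimately show "resid X (axis i 1) \<noteq> 0 \<or> 0 \<noteq> (0::real)"
      by (metis (mono_tags) I_def mem_Collect_eq matrix_vector_mult_in_columnspace)
  qed
  moreover have "{y. det (V y) = 0} \<subseteq> (\<Union>i\<in>I. {y. resid X (axis i 1) \<bullet> y = 0})"
  proof
    fix y assume "y \<in> {y. det (V y) = 0}"
    then obtain i where i: "i \<in> I" "resid X y $ i = 0"
      using det_V_nonzero[of y] by (auto simp: I_def)
    have "resid X (axis i 1) \<bullet> y = axis i 1 \<bullet> resid X y"
      by (rule resid_selfadjoint[OF full_rank])
    then show "y \<in> (\<Union>i\<in>I. {y. resid X (axis i 1) \<bullet> y = 0})"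
      using i by (auto simp: inner_axis')
  qed
  ultimately have "negligible {y. det (V y) = 0}" by (rule negligible_subset)
  then show ?thesis
    by (simp add: negligible_iff_null_sets null_sets_completion_iff)
qed

text \<open>With \<open>v = est y + d\<close> and \<open>z = M V\<^sup>-\<^sup>1 v\<close> one has \<open>v = M' W z\<close> and \<open>stat d y = z \<bullet> W z\<close>. The first identity bounds
  \<open>\<bar>v\<bar>\<close> by \<open>gauge y * \<bar>z\<bar>\<close>, the second one bounds \<open>\<bar>z\<bar>\<close> by the statistic.\<close>

lemma stat_lower_bound:
  obtains k where "0 \<le> k"
    and "\<And>C y d. det (V y) \<noteq> 0 \<Longrightarrow> stat d y < C \<Longrightarrow> norm (est y + d) \<le> k * sqrt C * gauge y"
proof -
  obtain l where l: "0 < l" "\<And>z :: real^'n::{finite,linorder}. l * (norm z)\<^sup>2 \<le> z \<bullet> (weight_matrix w *v z)"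
    using positive_definite_lower_bound[OF weights] by blast
  have "norm (est y + d) \<le> (1 / sqrt l) * sqrt C * gauge y" if nz: "det (V y) \<noteq> 0" and C: "stat d y < C" for C y d
  proof -
    define v where "v = est y + d"
    define x where "x = matrix_inv (V y) *v v"
    define z where "z = M y *v x"
    have g: "0 \<le> gauge y" by (simp add: gauge_def sum_nonneg)
    have v: "v = (transpose (M y) ** weight_matrix w) *v z"
    proof -
      have "V y *v x = v" unfolding x_def by (rule matrix_inv_vector_mult(1)[OF nz])
      then show ?thesis by (simp only: z_def V_eq matrix_vector_mul_assoc matrix_mul_assoc)
    qed
    have "stat d y = v \<bullet> x" using nz by (simp add: stat_def v_def x_def)
    also have "\<dots> = x \<bullet> (transpose (M y) *v (weight_matrix w *v z))"
      by (simp only: v matrix_vector_mul_assoc[symmetric] inner_commute)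
    also have "\<dots> = z \<bullet> (weight_matrix w *v z)"
      by (simp only: inner_matrix_vector_mult z_def)
    finally have "l * (norm z)\<^sup>2 \<le> C" using l(2)[of z] C by simp
    then have "(norm z)\<^sup>2 \<le> C / l" using l(1) by (simp add: pos_le_divide_eq mult.commute)
    then have nz: "norm z \<le> sqrt (C / l)" by (rule real_le_rsqrt)
    have "norm v \<le> onorm ((*v) (transpose (M y) ** weight_matrix w)) * norm z"
      unfolding v by (intro onorm matrix_vector_mul_bounded_linear)
    also have "\<dots> \<le> gauge y * sqrt (C / l)"
      using nz g unfolding gauge_def by (intro mult_mono onorm_le_matrix_component_sum) auto
    finally show ?thesis by (simp add: v_def real_sqrt_divide mult.commute)
  qed
  then show ?thesis using that[of "1 / sqrt l"] l(1) by auto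
qed

end

section \<open>Rejection probabilities under well conditioned Gaussian laws\<close>

lemma matrix_vector_mult_uminus: "A *v (- x) = - (A *v x)" for A :: "real^'n^'m"
  using matrix_vector_mult_scaleR[of A "- 1" x] by simp

text \<open>The superlevel sets decrease to the empty set.\<close>

lemma finite_measure_tail:
  assumes "finite_measure N" and [simp]: "sets N = sets borel"
    and [measurable]: "H \<in> borel_measurable borel" and "0 < \<epsilon>"
  obtains m :: nat where "0 < m" and "measure N {y. real m \<le> H y} < \<epsilon>"
proof -
  interpret finite_measure N by fact
  define A where "A m = {y. real m \<le> H y}" for m
  have "(\<Inter>m. A m) = {}"
  proof -
    have "y \<notin> (\<Inter>m. A m)" for y
      using reals_Archimedean2[of "H y"] by (auto simp: A_def not_le)
    then show ?thesis by blast
  qed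
  moreover have "(\<lambda>m. measure N (A m)) \<longlonglongrightarrow> measure N (\<Inter>m. A m)"
    by (rule finite_Lim_measure_decseq) (auto simp: A_def decseq_def)
  ultimately have "(\<lambda>m. measure N (A m)) \<longlonglongrightarrow> 0" by simp
  then have "eventually (\<lambda>m. measure N (A m) < \<epsilon>) sequentially"
    using \<open>0 < \<epsilon>\<close> by (rule order_tendstoD)
  then have "eventually (\<lambda>m. measure N (A m) < \<epsilon> \<and> 0 < m) sequentially"
    by (rule eventually_conj) (rule eventually_gt_at_top)
  then show ?thesis
    using that unfolding A_def eventually_sequentially by blast
qed

definition conditioned :: "real \<Rightarrow> real^'n^'n \<Rightarrow> bool" where
  "conditioned K A \<longleftrightarrow> (\<forall>x. norm (A *v x) \<le> K * norm x \<and> norm x \<le> K * norm (A *v x))"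

lemma conditioned_det: "conditioned K A \<Longrightarrow> det A \<noteq> 0"
  unfolding conditioned_def by (intro det_nonzeroI) (metis mult_zero_right norm_le_zero_iff norm_zero)

context robust_test
begin

text \<open>A small statistic confines \<open>d\<close> to a ball whose radius is a finite function of \<open>y\<close>, which rarely exceeds
  a large number.\<close>

lemma gaussian_stat_small:
  assumes c: "c \<noteq> 0" and C: "0 < C" and \<epsilon>: "0 < \<epsilon>"
  obtains \<kappa> where "0 < \<kappa>"
    and "\<And>d. \<kappa> \<le> norm d \<Longrightarrow> measure (gaussian 0 (mat (c\<^sup>2))) {y. stat d y < C} < \<epsilon>"
proof -
  interpret prob_space "gaussian 0 (mat (c\<^sup>2) :: real^'n::{finite,linorder}^'n::{finite,linorder})"
    using c by (rule prob_space_gaussian_mat)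
  obtain k where k: "0 \<le> k"
    "\<And>C y d. det (V y) \<noteq> 0 \<Longrightarrow> stat d y < C \<Longrightarrow> norm (est y + d) \<le> k * sqrt C * gauge y"
    using stat_lower_bound by blast
  define H where "H y = norm (est y) + k * sqrt C * gauge y" for y
  have [measurable]: "H \<in> borel_measurable borel" unfolding H_def by measurable
  obtain m :: nat where m: "0 < m" "measure (gaussian 0 (mat (c\<^sup>2))) {y. real m \<le> H y} < \<epsilon>"
    using finite_measure_tail[OF finite_measure_axioms _ _ \<epsilon>, of H] by auto
  have "measure (gaussian 0 (mat (c\<^sup>2))) {y. stat d y < C} < \<epsilon>" if d: "real m \<le> norm d" for d
  proof -
    have null: "measure (gaussian 0 (mat (c\<^sup>2))) {y. det (V y) = 0} = 0"
      using det_V_null_set null_sets_gaussian[OF c] by (intro measure_eq_0_null_sets) blast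
    have "{y. stat d y < C} \<subseteq> {y. det (V y) = 0} \<union> {y. real m \<le> H y}"
    proof
      fix y assume "y \<in> {y. stat d y < C}"
      then have "norm (est y + d) \<le> k * sqrt C * gauge y" if "det (V y) \<noteq> 0"
        using k(2)[OF that] by simp
      moreover have "norm d \<le> norm (est y + d) + norm (est y)"
        by (metis add.commute add_diff_cancel_left' norm_triangle_ineq4)
      ultimately show "y \<in> {y. det (V y) = 0} \<union> {y. real m \<le> H y}"
        using d by (cases "det (V y) = 0") (auto simp: H_def)
    qed
    then have "measure (gaussian 0 (mat (c\<^sup>2))) {y. stat d y < C}
      \<le> measure (gaussian 0 (mat (c\<^sup>2))) ({y. det (V y) = 0} \<union> {y. real m \<le> H y})"
      by (intro finite_measure_mono) auto
    also have "\<dots> \<le> measure (gaussian 0 (mat (c\<^sup>2))) {y. det (V y) = 0} + measure (gaussian 0 (mat (c\<^sup>2))) {y. real m \<le> H y}"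
      by (rule measure_Un_le) auto
    finally show ?thesis using m null by simp
  qed
  then show ?thesis using that[of "real m"] m(1) by simp
qed

text \<open>Translation by \<open>X b\<close> moves the estimate by \<open>R b\<close> and leaves the residuals, hence \<open>gauge\<close>, alone. As
  \<open>R\<close> is onto, countably many translates of the set cover almost all of space.\<close>

lemma large_est_not_null:
  "\<not> negligible {y. det (V y) \<noteq> 0 \<and> a + b * gauge y < norm (est y)}" (is "\<not> negligible ?G")
proof
  assume G: "negligible ?G"
  define u :: "real^'q" where "u = (\<chi> i. 1)"
  have "u \<noteq> 0" by (simp add: u_def vec_eq_iff)
  obtain b0 where b0: "R *v b0 = u" using surj_R by (metis surj_def)
  \<comment> \<open>\<open>y\<close> lies in \<open>S m\<close> iff its translate by \<open>X (m b0)\<close> lies in the set, and the estimate there is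
    \<open>m u + est y\<close>.\<close>
  define S where "S m = (+) (X *v (- real m *\<^sub>R b0)) ` ?G" for m :: nat
  have "negligible (\<Union> (range S))"
    unfolding S_def using G by (intro negligible_countable_Union) (auto intro: negligible_translation)
  moreover have "{y. det (V y) = 0} \<union> \<Union> (range S) = UNIV"
  proof -
    have "y \<in> \<Union> (range S)" if nz: "det (V y) \<noteq> 0" for y
    proof -
      obtain m :: nat where m: "(a + b * gauge y + norm (est y)) / norm u < real m"
        using reals_Archimedean2 by blast
      define z where "z = X *v (real m *\<^sub>R b0) + 1 *\<^sub>R y"
      have "est z = R *v (real m *\<^sub>R b0) + 1 *\<^sub>R est y"
        unfolding z_def by (rule est_shift)
      then have "est z = real m *\<^sub>R u + est y"
        by (simp add: matrix_vector_mult_scaleR b0)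
      then have "norm (real m *\<^sub>R u) \<le> norm (est z) + norm (est y)"
        by (metis add_diff_cancel_right' norm_triangle_ineq4)
      moreover have "a + b * gauge y + norm (est y) < real m * norm u"
        using m \<open>u \<noteq> 0\<close> by (simp add: pos_divide_less_eq)
      ultimately have "a + b * gauge y < norm (est z)" by simp
      moreover have "gauge z = gauge y" using gauge_shift[of "real m *\<^sub>R b0" y] by (simp add: z_def)
      moreover have "det (V z) \<noteq> 0" using nz by (simp only: z_def V_shift det_scaleR) simp
      ultimately have "z \<in> ?G" by simp
      moreover have "y = X *v (- real m *\<^sub>R b0) + z"
        by (simp add: z_def matrix_vector_mult_scaleR matrix_vector_mult_uminus)
      ultimately show ?thesis unfolding S_def by blast
    qed
    then show ?thesis by blast
  qed
  moreover have "negligible {y. det (V y) = 0}"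
    using det_V_null_set by (simp add: negligible_iff_null_sets null_sets_completion_iff)
  ultimately have "negligible (UNIV :: (real^'n::{finite,linorder}) set)"
    by (metis negligible_Un)
  then show False by simp
qed

text \<open>Large \<open>d\<close> are covered by the previous tail estimate. For bounded \<open>d\<close> a single set does: where the
  estimate exceeds the bound on \<open>d\<close> by a large multiple of the gauge, the statistic is at least \<open>C\<close>.\<close>

lemma gaussian_stat_large:
  assumes c: "c \<noteq> 0" and C: "0 < C"
  obtains \<eta> where "0 < \<eta>" and "\<And>d. \<eta> \<le> measure (gaussian 0 (mat (c\<^sup>2))) {y. C \<le> stat d y}"
proof -
  interpret prob_space "gaussian 0 (mat (c\<^sup>2) :: real^'n::{finite,linorder}^'n::{finite,linorder})"
    using c by (rule prob_space_gaussian_mat)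
  obtain \<kappa> where \<kappa>: "0 < \<kappa>"
    "\<And>d. \<kappa> \<le> norm d \<Longrightarrow> measure (gaussian 0 (mat (c\<^sup>2))) {y. stat d y < C} < 1 / 2"
    using gaussian_stat_small[OF c C, of "1 / 2"] by auto
  obtain k where k: "0 \<le> k"
    "\<And>C y d. det (V y) \<noteq> 0 \<Longrightarrow> stat d y < C \<Longrightarrow> norm (est y + d) \<le> k * sqrt C * gauge y"
    using stat_lower_bound by blast
  define G where "G = {y. det (V y) \<noteq> 0 \<and> \<kappa> + k * sqrt C * gauge y < norm (est y)}"
  define \<eta> where "\<eta> = min (1 / 2) (measure (gaussian 0 (mat (c\<^sup>2))) G)"
  have [measurable]: "G \<in> sets borel" unfolding G_def by measurable
  have "G \<notin> null_sets lborel"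
    using large_est_not_null[of \<kappa> "k * sqrt C"]
    by (simp add: G_def negligible_iff_null_sets null_sets_completion_iff)
  then have "G \<notin> null_sets (gaussian 0 (mat (c\<^sup>2)))"
    using null_sets_gaussian[OF c] by blast
  then have "measure (gaussian 0 (mat (c\<^sup>2))) G \<noteq> 0"
    by (simp add: null_sets_def emeasure_eq_measure)
  then have "0 < \<eta>" by (simp add: \<eta>_def zero_less_measure_iff)
  moreover have "\<eta> \<le> measure (gaussian 0 (mat (c\<^sup>2))) {y. C \<le> stat d y}" for d
  proof (cases "\<kappa> \<le> norm d")
    case True
    have "{y. C \<le> stat d y} = space (gaussian 0 (mat (c\<^sup>2))) - {y. stat d y < C}" by auto
    then have "measure (gaussian 0 (mat (c\<^sup>2))) {y. C \<le> stat d y} = 1 - measure (gaussian 0 (mat (c\<^sup>2))) {y. stat d y < C}"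
      by (simp only:) (rule prob_compl, simp)
    then show ?thesis using \<kappa>(2)[OF True] by (simp add: \<eta>_def)
  next
    case False
    have "G \<subseteq> {y. C \<le> stat d y}"
    proof
      fix y assume y: "y \<in> G"
      have "norm (est y) \<le> norm (est y + d) + norm d"
        by (metis add_diff_cancel_right' norm_triangle_ineq4)
      then have "k * sqrt C * gauge y < norm (est y + d)" using y False by (simp add: G_def)
      then show "y \<in> {y. C \<le> stat d y}"
        using k(2)[of y d C] y by (auto simp: G_def not_less[symmetric])
    qed
    then have "measure (gaussian 0 (mat (c\<^sup>2))) G \<le> measure (gaussian 0 (mat (c\<^sup>2))) {y. C \<le> stat d y}"
      by (intro finite_measure_mono) auto
    then show ?thesis by (simp add: \<eta>_def)
  qed
  ultimately show ?thesis using that by blast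
qed

text \<open>At a residual vector with nonsingular covariance estimate the statistic is 0, so by continuity it
  stays below \<open>C\<close> in a neighbourhood.\<close>

lemma gaussian_null_stat_small:
  assumes c: "c \<noteq> 0" and C: "0 < C"
  shows "0 < measure (gaussian 0 (mat (c\<^sup>2))) {y. stat 0 y < C}"
proof -
  interpret prob_space "gaussian 0 (mat (c\<^sup>2) :: real^'n::{finite,linorder}^'n::{finite,linorder})"
    using c by (rule prob_space_gaussian_mat)
  \<comment> \<open>Clearing the denominator makes the set open and excludes singular points, where it reads \<open>0 < 0\<close>.\<close>
  define Q where "Q = {y. stat_numerator 0 y * det (V y) < C * (det (V y))\<^sup>2}"
  have "open Q" unfolding Q_def by (intro open_Collect_less continuous_intros)
  have Q: "Q \<subseteq> {y. stat 0 y < C}"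
  proof
    fix y assume y: "y \<in> Q"
    then have nz: "det (V y) \<noteq> 0" by (auto simp: Q_def)
    have "stat 0 y * (det (V y))\<^sup>2 < C * (det (V y))\<^sup>2"
      using y nz by (simp add: Q_def stat_eq power2_eq_square)
    then show "y \<in> {y. stat 0 y < C}" using nz by simp
  qed
  have "{y. det (V y) = 0} \<noteq> UNIV"
    using det_V_null_set non_negligible_UNIV
    by (metis negligible_iff_null_sets null_sets_completionI)
  then obtain y where nz: "det (V y) \<noteq> 0" by blast
  define u where "u = X *v (- ols X y) + 1 *\<^sub>R y"
  have "est u = 0"
    by (simp only: u_def est_shift) (simp add: matrix_vector_mult_uminus)
  moreover have "det (V u) \<noteq> 0" using nz by (simp only: u_def V_shift det_scaleR) simp
  ultimately have "u \<in> Q" using C by (simp add: Q_def stat_numerator_def)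
  then have "\<not> negligible Q" using \<open>open Q\<close> open_not_negligible by blast
  have [measurable]: "Q \<in> sets borel" using \<open>open Q\<close> by simp
  have "Q \<notin> null_sets (gaussian 0 (mat (c\<^sup>2)))"
    using \<open>\<not> negligible Q\<close> null_sets_gaussian[OF c]
    by (auto simp: negligible_iff_null_sets null_sets_completion_iff)
  then have "0 < measure (gaussian 0 (mat (c\<^sup>2))) Q"
    by (simp add: null_sets_def emeasure_eq_measure zero_less_measure_iff)
  also have "\<dots> \<le> measure (gaussian 0 (mat (c\<^sup>2))) {y. stat 0 y < C}"
    using Q by (intro finite_measure_mono) auto
  finally show ?thesis .
qed

lemma measure_stat_compl:
  assumes "conditioned K A"
  shows "measure (gaussian 0 (A ** transpose A)) {y. C \<le> stat d y}
    = 1 - measure (gaussian 0 (A ** transpose A)) {y. stat d y < C}"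
proof -
  interpret prob_space "gaussian 0 (A ** transpose A)"
    using conditioned_det[OF assms] by (rule prob_space_gaussian)
  have "{y. C \<le> stat d y} = space (gaussian 0 (A ** transpose A)) - {y. stat d y < C}" by auto
  then show ?thesis by (simp only:) (rule prob_compl, simp)
qed

text \<open>These bounds make an estimate for the single Gaussian measure of scale \<open>K\<close> or \<open>1 / K\<close> uniform over all well
  conditioned laws.\<close>

lemma conditioned_sandwich:
  fixes A :: "real^'n::{finite,linorder}^'n::{finite,linorder}"
  assumes K: "0 < K" and A: "conditioned K A" and E: "E \<in> sets borel"
  shows "measure (gaussian 0 (A ** transpose A)) E \<le> K ^ (2 * CARD('n)) * measure (gaussian 0 (mat (K\<^sup>2))) E"
    and "measure (gaussian 0 (mat ((1 / K)\<^sup>2))) E \<le> K ^ (2 * CARD('n)) * measure (gaussian 0 (A ** transpose A)) E"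
  using gaussian_sandwich[OF K conditioned_det[OF A] _ _ E] A
  by (auto simp: conditioned_def power_divide)

lemma null_rejection_bounded_away_from_one:
  assumes K: "0 < K" and C: "0 < C"
  obtains \<eta> where "0 < \<eta>"
    and "\<And>A. conditioned K A \<Longrightarrow> measure (gaussian 0 (A ** transpose A)) {y. C \<le> stat 0 y} \<le> 1 - \<eta>"
proof -
  define m where "m = measure (gaussian 0 (mat ((1 / K)\<^sup>2))) {y. stat 0 y < C}"
  have "0 < m" unfolding m_def using K C by (intro gaussian_null_stat_small) auto
  show ?thesis
  proof (rule that[of "m / K ^ (2 * CARD('n))"])
    show "0 < m / K ^ (2 * CARD('n))" using \<open>0 < m\<close> K by simp
    fix A :: "real^'n::{finite,linorder}^'n::{finite,linorder}" assume A: "conditioned K A"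
    have "m \<le> K ^ (2 * CARD('n)) * measure (gaussian 0 (A ** transpose A)) {y. stat 0 y < C}"
      unfolding m_def by (intro conditioned_sandwich K A) simp
    then have "m / K ^ (2 * CARD('n)) \<le> measure (gaussian 0 (A ** transpose A)) {y. stat 0 y < C}"
      using K by (simp add: pos_divide_le_eq mult.commute)
    then show "measure (gaussian 0 (A ** transpose A)) {y. C \<le> stat 0 y} \<le> 1 - m / K ^ (2 * CARD('n))"
      using measure_stat_compl[OF A] by simp
  qed
qed

lemma rejection_bounded_away_from_zero:
  assumes K: "0 < K" and C: "0 < C"
  obtains \<eta> where "0 < \<eta>"
    and "\<And>A d. conditioned K A \<Longrightarrow> \<eta> \<le> measure (gaussian 0 (A ** transpose A)) {y. C \<le> stat d y}"
proof -
  have "1 / K \<noteq> 0" using K by simp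
  then obtain m where m: "0 < m" "\<And>d. m \<le> measure (gaussian 0 (mat ((1 / K)\<^sup>2))) {y. C \<le> stat d y}"
    using gaussian_stat_large[OF _ C] by blast
  show ?thesis
  proof (rule that[of "m / K ^ (2 * CARD('n))"])
    show "0 < m / K ^ (2 * CARD('n))" using \<open>0 < m\<close> K by simp
    fix A :: "real^'n::{finite,linorder}^'n::{finite,linorder}" and d :: "real^'q" assume A: "conditioned K A"
    have "m \<le> K ^ (2 * CARD('n)) * measure (gaussian 0 (A ** transpose A)) {y. C \<le> stat d y}"
      using m(2)[of d] by (rule order_trans) (intro conditioned_sandwich K A, simp)
    then show "m / K ^ (2 * CARD('n)) \<le> measure (gaussian 0 (A ** transpose A)) {y. C \<le> stat d y}"
      using K by (simp add: pos_divide_le_eq mult.commute)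
  qed
qed

lemma rejection_tendsto_one:
  assumes K: "0 < K" and C: "0 < C" and \<epsilon>: "0 < \<epsilon>"
  obtains \<kappa> where "0 < \<kappa>"
    and "\<And>A d. conditioned K A \<Longrightarrow> \<kappa> \<le> norm d \<Longrightarrow>
      1 - \<epsilon> < measure (gaussian 0 (A ** transpose A)) {y. C \<le> stat d y}"
proof -
  have "K \<noteq> 0" "0 < \<epsilon> / K ^ (2 * CARD('n))" using K \<epsilon> by auto
  then obtain \<kappa> where \<kappa>: "0 < \<kappa>" "\<And>d. \<kappa> \<le> norm d \<Longrightarrow>
      measure (gaussian 0 (mat (K\<^sup>2))) {y. stat d y < C} < \<epsilon> / K ^ (2 * CARD('n))"
    using C gaussian_stat_small by metis
  show ?thesis
  proof (rule that[OF \<kappa>(1)])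
    fix A :: "real^'n::{finite,linorder}^'n::{finite,linorder}" and d :: "real^'q"
    assume A: "conditioned K A" and d: "\<kappa> \<le> norm d"
    have "measure (gaussian 0 (A ** transpose A)) {y. stat d y < C}
      \<le> K ^ (2 * CARD('n)) * measure (gaussian 0 (mat (K\<^sup>2))) {y. stat d y < C}"
      by (intro conditioned_sandwich K A) simp
    also have "\<dots> < \<epsilon>" using \<kappa>(2)[OF d] K by (simp add: pos_less_divide_eq mult.commute)
    finally show "1 - \<epsilon> < measure (gaussian 0 (A ** transpose A)) {y. C \<le> stat d y}"
      using measure_stat_compl[OF A] by simp
  qed
qed

lemma null_rejection_small:
  assumes K: "0 < K" and \<epsilon>: "0 < \<epsilon>"
  obtains C where "0 < C"
    and "\<And>A. conditioned K A \<Longrightarrow> measure (gaussian 0 (A ** transpose A)) {y. C \<le> stat 0 y} \<le> \<epsilon>"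
proof -
  interpret prob_space "gaussian 0 (mat (K\<^sup>2) :: real^'n::{finite,linorder}^'n::{finite,linorder})"
    using K by (intro prob_space_gaussian_mat) simp
  have "0 < \<epsilon> / K ^ (2 * CARD('n))" using K \<epsilon> by simp
  then obtain m :: nat where m: "0 < m"
    "measure (gaussian 0 (mat (K\<^sup>2))) {y. real m \<le> stat 0 y} < \<epsilon> / K ^ (2 * CARD('n))"
    using finite_measure_tail[OF finite_measure_axioms _ borel_stat] by auto
  show ?thesis
  proof (rule that[of "real m"])
    fix A :: "real^'n::{finite,linorder}^'n::{finite,linorder}" assume A: "conditioned K A"
    have "measure (gaussian 0 (A ** transpose A)) {y. real m \<le> stat 0 y}
      \<le> K ^ (2 * CARD('n)) * measure (gaussian 0 (mat (K\<^sup>2))) {y. real m \<le> stat 0 y}"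
      by (intro conditioned_sandwich K A) simp
    also have "\<dots> \<le> \<epsilon>" using m(2) K by (simp add: pos_less_divide_eq mult.commute)
    finally show "measure (gaussian 0 (A ** transpose A)) {y. real m \<le> stat 0 y} \<le> \<epsilon>" .
  qed (use m in simp)
qed

end

section \<open>Size and power in the original model\<close>

text \<open>The conclusions as a predicate of the statistic, so that each scenario has to supply its design only.\<close>

definition size_and_power_bounds ::
  "real^'k^'n::{finite,linorder} \<Rightarrow> real^'k^'q \<Rightarrow> real^'q \<Rightarrow> (real^'n::{finite,linorder} \<Rightarrow> real) \<Rightarrow> bool" where
  "size_and_power_bounds X R r T \<longleftrightarrow>
    (\<forall>C>0.
        (SUP \<mu>\<in>null_means X R r. SUP s\<in>{0<..}. SUP \<rho>\<in>{-1<..<1}.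
           measure (gaussian \<mu> (s *\<^sub>R AR1 \<rho>)) {y. C \<le> T y}) < 1 \<and>
        (INF \<mu>\<in>null_means X R r. INF s\<in>{0<..}. INF \<rho>\<in>{-1<..<1}.
           measure (gaussian \<mu> (s *\<^sub>R AR1 \<rho>)) {y. C \<le> T y}) > 0) \<and>
     (\<forall>C>0.
        (INF \<mu>\<in>alt_means X R r. INF s\<in>{0<..}. INF \<rho>\<in>{-1<..<1}.
           measure (gaussian \<mu> (s *\<^sub>R AR1 \<rho>)) {y. C \<le> T y}) > 0) \<and>
     (\<forall>C>0.
        (\<forall>c>0. \<forall>\<rho> :: nat \<Rightarrow> real.
           (\<forall>m. \<rho> m \<in> {-1<..<1}) \<longrightarrow> (\<lambda>m. \<bar>\<rho> m\<bar>) \<longlonglongrightarrow> 1 \<longrightarrow>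
           (\<lambda>m. INF (\<mu>, s)\<in>{(\<mu>, s). \<mu> \<in> alt_means X R r \<and> 0 < s \<and>
                                      infdist \<mu> (null_means X R r) / sqrt s \<ge> c}.
              measure (gaussian \<mu> (s *\<^sub>R AR1 (\<rho> m))) {y. C \<le> T y}) \<longlonglongrightarrow> 1) \<and>
        (\<forall>c :: nat \<Rightarrow> real. \<forall>\<epsilon>. \<forall>s :: nat \<Rightarrow> real.
           (\<forall>m. 0 < c m) \<longrightarrow> 0 < \<epsilon> \<longrightarrow> \<epsilon> < 1 \<longrightarrow> (\<forall>m. 0 < s m) \<longrightarrow>
           filterlim (\<lambda>m. c m / sqrt (s m)) at_top sequentially \<longrightarrow>
           (\<lambda>m. INF \<mu>\<in>{\<mu> \<in> alt_means X R r. infdist \<mu> (null_means X R r) \<ge> c m}.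
                  INF \<rho>\<in>{-1 + \<epsilon>..1 - \<epsilon>}.
                    measure (gaussian \<mu> (s m *\<^sub>R AR1 \<rho>)) {y. C \<le> T y}) \<longlonglongrightarrow> 1)) \<and>
     (\<forall>\<delta>. 0 < \<delta> \<and> \<delta> < 1 \<longrightarrow>
        (\<exists>C>0.
           (SUP \<mu>\<in>null_means X R r. SUP s\<in>{0<..}. SUP \<rho>\<in>{-1<..<1}.
              measure (gaussian \<mu> (s *\<^sub>R AR1 \<rho>)) {y. C \<le> T y}) \<le> \<delta>))"

lemma tendsto_one_INF:
  fixes f :: "nat \<Rightarrow> 'a \<Rightarrow> real"
  assumes bounds: "\<And>m x. x \<in> S m \<Longrightarrow> 0 \<le> f m x \<and> f m x \<le> 1"
    and nonempty: "\<And>m. S m \<noteq> {}"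
    and near: "\<And>\<epsilon>. 0 < \<epsilon> \<Longrightarrow> eventually (\<lambda>m. \<forall>x\<in>S m. 1 - \<epsilon> \<le> f m x) sequentially"
  shows "(\<lambda>m. INF x\<in>S m. f m x) \<longlonglongrightarrow> 1"
proof (rule tendstoI)
  fix \<epsilon> :: real assume "0 < \<epsilon>"
  then have "eventually (\<lambda>m. \<forall>x\<in>S m. 1 - \<epsilon> / 2 \<le> f m x) sequentially"
    by (intro near) simp
  then show "eventually (\<lambda>m. dist (INF x\<in>S m. f m x) 1 < \<epsilon>) sequentially"
  proof eventually_elim
    case (elim m)
    have "1 - \<epsilon> / 2 \<le> (INF x\<in>S m. f m x)"
      using elim nonempty[of m] by (intro cINF_greatest) auto
    moreover obtain x where x: "x \<in> S m" using nonempty[of m] by blast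
    have "bdd_below (f m ` S m)" using bounds by (intro bdd_belowI[of _ 0]) auto
    then have "(INF x\<in>S m. f m x) \<le> f m x" using x by (rule cINF_lower)
    then have "(INF x\<in>S m. f m x) \<le> 1" using bounds[OF x] by simp
    ultimately show ?case using \<open>0 < \<epsilon>\<close> by (simp add: dist_real_def)
  qed
qed

lemma ar1_scale: "\<bar>\<rho>\<bar> < 1 \<Longrightarrow> 0 < sqrt (1 - \<rho>\<^sup>2) \<and> sqrt (1 - \<rho>\<^sup>2) \<le> 1" for \<rho> :: real
  using ar1_scale_bounds[of "\<bar>\<rho>\<bar>"] by simp

text \<open>With the factor \<open>Q = \<tau> A + e c'\<close> of the covariance matrix, the map \<open>N = sqrt s * Q A\<^sup>-\<^sup>1\<close> carries \<open>N(0, A A')\<close> to the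
  given law and equals \<open>sqrt s * \<tau>\<close> times the identity plus a multiple of the trend \<open>e\<close>. The statistic ignores the trend
  and trades the scale factor for a rescaling of its parameter.\<close>

lemma (in robust_test) stat_law_normalization:
  fixes \<rho> s :: real
  assumes trend: "X *v ap = e_plus" "R *v ap = 0" and alternating: "X *v am = e_minus" "R *v am = 0"
    and \<rho>: "\<bar>\<rho>\<bar> < 1" and s: "0 < s"
  shows "\<exists>A. conditioned (3 * real CARD('n) ^ 3) A \<and> (\<forall>b d C.
    measure (gaussian (X *v b) (s *\<^sub>R AR1 \<rho>)) {y. C \<le> stat d y}
    = measure (gaussian 0 (A ** transpose A)) {y. C \<le> stat ((1 / (sqrt s * sqrt (1 - \<rho>\<^sup>2))) *\<^sub>R (R *v b + d)) y})"
proof -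
  define \<tau> where "\<tau> = sqrt (1 - \<rho>\<^sup>2)"
  have \<tau>: "0 < \<tau>" using ar1_scale[OF \<rho>] by (simp add: \<tau>_def)
  obtain A :: "real^'n::{finite,linorder}^'n::{finite,linorder}" and e c where
    e: "e = e_plus \<or> e = e_minus"
    and QQ: "(\<tau> *\<^sub>R A + outer e c) ** transpose (\<tau> *\<^sub>R A + outer e c) = AR1 \<rho>"
    and detQ: "det (\<tau> *\<^sub>R A + outer e c) \<noteq> 0"
    and A: "conditioned (3 * real CARD('n) ^ 3) A"
    using ar1_decomposition[OF \<rho>, folded \<tau>_def] unfolding conditioned_def by blast
  obtain a where a: "X *v a = e" "R *v a = 0" using e trend alternating by metis
  define Q where "Q = \<tau> *\<^sub>R A + outer e c"
  define N where "N = sqrt s *\<^sub>R (Q ** matrix_inv A)"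
  have detA: "det A \<noteq> 0" using A by (rule conditioned_det)
  have NA: "N ** A = sqrt s *\<^sub>R Q"
    by (simp add: N_def scalar_matrix_assoc[symmetric] matrix_mul_assoc[symmetric] matrix_inv_mult[OF detA])
  have "det N * det A \<noteq> 0" using detQ s by (simp add: det_mul[symmetric] NA det_scaleR Q_def)
  then have detN: "det N \<noteq> 0" by simp
  have "N ** (A ** transpose A) ** transpose N = (N ** A) ** transpose (N ** A)"
    by (simp only: matrix_transpose_mul matrix_mul_assoc)
  also have "\<dots> = s *\<^sub>R AR1 \<rho>"
    using s by (simp add: NA transpose_scalar matrix_scalar_ac scalar_matrix_assoc[symmetric] QQ[folded Q_def])
  finally have cov: "N ** (A ** transpose A) ** transpose N = s *\<^sub>R AR1 \<rho>" .
  have detAA: "det (A ** transpose A) \<noteq> 0" using detA by (simp add: det_mul)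
  have Nx: "N *v x = (sqrt s * \<tau>) *\<^sub>R x + (sqrt s * (c \<bullet> (matrix_inv A *v x))) *\<^sub>R e" for x
  proof -
    have "N *v x = sqrt s *\<^sub>R (Q *v (matrix_inv A *v x))"
      by (simp add: N_def scaleR_matrix_vector_assoc[symmetric] matrix_vector_mul_assoc)
    also have "Q *v (matrix_inv A *v x) = \<tau> *\<^sub>R x + (c \<bullet> (matrix_inv A *v x)) *\<^sub>R e"
      by (simp add: Q_def matrix_vector_mult_add_rdistrib scaleR_matrix_vector_assoc[symmetric] outer_vector_mult
          matrix_inv_vector_mult[OF detA])
    finally show ?thesis by (simp add: scaleR_add_right)
  qed
  have "measure (gaussian (X *v b) (s *\<^sub>R AR1 \<rho>)) {y. C \<le> stat d y}
    = measure (gaussian 0 (A ** transpose A)) {y. C \<le> stat ((1 / (sqrt s * \<tau>)) *\<^sub>R (R *v b + d)) y}" for b d C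
  proof -
    have "stat d (X *v b + N *v x) = stat ((1 / (sqrt s * \<tau>)) *\<^sub>R (R *v b + d)) x" for x
    proof -
      define \<gamma> where "\<gamma> = sqrt s * (c \<bullet> (matrix_inv A *v x))"
      have "X *v b + N *v x = X *v (b + \<gamma> *\<^sub>R a) + (sqrt s * \<tau>) *\<^sub>R x"
        by (simp add: Nx \<gamma>_def matrix_vector_right_distrib matrix_vector_mult_scaleR a)
      then have "stat d (X *v b + N *v x) = stat ((1 / (sqrt s * \<tau>)) *\<^sub>R (R *v (b + \<gamma> *\<^sub>R a) + d)) x"
        using s \<tau> by (simp only:) (rule stat_shift, simp)
      then show ?thesis by (simp add: matrix_vector_right_distrib matrix_vector_mult_scaleR a)
    qed
    then show ?thesis
      unfolding cov[symmetric] gaussian_affine[OF detN detAA]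
      by (subst measure_distr) (auto simp: vimage_def)
  qed
  then show ?thesis using A unfolding \<tau>_def by blast
qed

text \<open>One bound uses that \<open>R \<beta> - r\<close> is a linear function of \<open>X \<beta> - \<mu>\<close> for null means \<open>\<mu>\<close>, the other one a right inverse of \<open>R\<close>.\<close>

lemma infdist_null_means:
  fixes X :: "real^'k^'n" and R :: "real^'k^'q"
  assumes X: "rank X = CARD('k)" and R: "rank R = CARD('q)"
  obtains L where "0 < L" and "\<And>\<beta>. norm (R *v \<beta> - r) \<le> L * infdist (X *v \<beta>) (null_means X R r)"
    and "\<And>\<beta>. infdist (X *v \<beta>) (null_means X R r) \<le> L * norm (R *v \<beta> - r)"
proof -
  have "surj ((*v) R)" using R by (simp add: full_rank_surjective)
  then obtain B where B: "R ** B = mat 1" by (auto simp: matrix_right_invertible_surjective[symmetric])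
  define L1 where "L1 = onorm ((*v) (R ** ols_matrix X))"
  define L2 where "L2 = onorm ((*v) (X ** B))"
  define L where "L = L1 + L2 + 1"
  have pos: "0 \<le> L1" "0 \<le> L2" by (auto simp: L1_def L2_def intro!: onorm_pos_le matrix_vector_mul_bounded_linear)
  have mem: "X *v (\<beta> - B *v (R *v \<beta> - r)) \<in> null_means X R r" for \<beta>
  proof -
    have "R *v (\<beta> - B *v (R *v \<beta> - r)) = r"
      by (simp add: matrix_vector_mult_diff_distrib matrix_vector_mul_assoc B)
        (simp add: matrix_vector_mul_assoc[symmetric] matrix_mul_assoc B)
    then show ?thesis by (auto simp: null_means_def)
  qed
  have "norm (R *v \<beta> - r) \<le> L * infdist (X *v \<beta>) (null_means X R r)" for \<beta>
  proof -
    have "norm (R *v \<beta> - r) / L \<le> dist (X *v \<beta>) \<mu>" if \<mu>: "\<mu> \<in> null_means X R r" for \<mu>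
    proof -
      obtain \<beta>0 where \<beta>0: "\<mu> = X *v \<beta>0" "R *v \<beta>0 = r" using \<mu> by (auto simp: null_means_def)
      have "R *v \<beta> - r = R *v ols X (X *v (\<beta> - \<beta>0))"
        unfolding ols_fitted[OF X] by (simp add: matrix_vector_mult_diff_distrib \<beta>0)
      also have "\<dots> = (R ** ols_matrix X) *v (X *v \<beta> - \<mu>)"
        by (simp add: ols_eq matrix_vector_mul_assoc matrix_mul_assoc matrix_vector_mult_diff_distrib \<beta>0)
      finally have "norm (R *v \<beta> - r) \<le> L1 * norm (X *v \<beta> - \<mu>)"
        unfolding L1_def by (simp only:) (intro onorm matrix_vector_mul_bounded_linear)
      also have "\<dots> \<le> L * norm (X *v \<beta> - \<mu>)"
        using pos by (intro mult_right_mono) (auto simp: L_def)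
      finally show ?thesis using pos by (simp add: L_def dist_norm divide_le_eq mult.commute)
    qed
    then have "norm (R *v \<beta> - r) / L \<le> infdist (X *v \<beta>) (null_means X R r)"
      using mem by (subst infdist_notempty) (auto intro!: cINF_greatest)
    then show ?thesis using pos by (simp add: L_def divide_le_eq mult.commute)
  qed
  moreover have "infdist (X *v \<beta>) (null_means X R r) \<le> L * norm (R *v \<beta> - r)" for \<beta>
  proof -
    have "infdist (X *v \<beta>) (null_means X R r) \<le> dist (X *v \<beta>) (X *v (\<beta> - B *v (R *v \<beta> - r)))"
      by (rule infdist_le[OF mem])
    also have "\<dots> = norm ((X ** B) *v (R *v \<beta> - r))"
      unfolding dist_norm matrix_vector_mult_diff_distrib[of X \<beta>]
      by (simp only: matrix_vector_mul_assoc[symmetric] diff_diff_eq2 add_diff_cancel_left')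
    also have "\<dots> \<le> L2 * norm (R *v \<beta> - r)"
      unfolding L2_def by (intro onorm matrix_vector_mul_bounded_linear)
    also have "\<dots> \<le> L * norm (R *v \<beta> - r)"
      using pos by (intro mult_right_mono) (auto simp: L_def)
    finally show ?thesis .
  qed
  ultimately show ?thesis using that[of L] pos by (auto simp: L_def)
qed

lemma mean_space_eq: "mean_space X = range ((*v) X)"
  by (simp add: mean_space_def span_columns)

text \<open>Each probability in question is a rejection probability under \<open>N(0, A A')\<close> with \<open>A\<close> in one class of
  well conditioned matrices; only the parameter \<open>(R \<beta> - r) / (sqrt s * sqrt (1 - \<rho>\<^sup>2))\<close> varies. It is 0 under the
  null hypothesis and tends to infinity in both limits of the consistency claim, either because its denominator vanishes or
  because the violation outgrows the standard deviation.\<close>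

lemma (in robust_test) size_and_power_bounds_stat:
  fixes X0 :: "real^'k^'n::{finite,linorder}" and R0 :: "real^'k^'q" and r :: "real^'q"
  assumes X0: "rank X0 = CARD('k)" and R0: "rank R0 = CARD('q)"
    and nested: "\<And>\<beta>. \<exists>b. X *v b = X0 *v \<beta> \<and> R *v b = R0 *v \<beta>"
    and trend: "\<exists>a. X *v a = e_plus \<and> R *v a = 0" and alternating: "\<exists>a. X *v a = e_minus \<and> R *v a = 0"
  shows "size_and_power_bounds X0 R0 r (stat (- r))"
proof -
  define K where "K = 3 * real CARD('n) ^ 3"
  have K: "0 < K" by (simp add: K_def)
  define P where "P C \<mu> s \<rho> = measure (gaussian \<mu> (s *\<^sub>R AR1 \<rho>)) {y. C \<le> stat (- r) y}" for C \<mu> s \<rho>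
  have law: "\<exists>A. conditioned K A \<and> (\<forall>\<beta> C. P C (X0 *v \<beta>) s \<rho> =
      measure (gaussian 0 (A ** transpose A)) {y. C \<le> stat ((1 / (sqrt s * sqrt (1 - \<rho>\<^sup>2))) *\<^sub>R (R0 *v \<beta> - r)) y})"
    if \<rho>s: "\<bar>\<rho>\<bar> < 1" "0 < s" for \<rho> s
  proof -
    obtain ap am where "X *v ap = e_plus" "R *v ap = 0" "X *v am = e_minus" "R *v am = 0"
      using trend alternating by blast
    from stat_law_normalization[OF this \<rho>s] obtain A where A: "conditioned K A"
      "\<And>b C. measure (gaussian (X *v b) (s *\<^sub>R AR1 \<rho>)) {y. C \<le> stat (- r) y}
        = measure (gaussian 0 (A ** transpose A)) {y. C \<le> stat ((1 / (sqrt s * sqrt (1 - \<rho>\<^sup>2))) *\<^sub>R (R *v b + - r)) y}"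
      unfolding K_def by blast
    have "P C (X0 *v \<beta>) s \<rho> =
      measure (gaussian 0 (A ** transpose A)) {y. C \<le> stat ((1 / (sqrt s * sqrt (1 - \<rho>\<^sup>2))) *\<^sub>R (R0 *v \<beta> - r)) y}" for \<beta> C
    proof -
      obtain b where "X *v b = X0 *v \<beta>" "R *v b = R0 *v \<beta>" using nested by blast
      then show ?thesis using A(2)[where b=b and C=C] by (simp add: P_def)
    qed
    then show ?thesis using A(1) by blast
  qed
  have P01: "0 \<le> P C (X0 *v \<beta>) s \<rho> \<and> P C (X0 *v \<beta>) s \<rho> \<le> 1" if \<rho>s: "\<bar>\<rho>\<bar> < 1" "0 < s" for C \<beta> \<rho> s
  proof -
    obtain A where A: "conditioned K A" and PA: "P C (X0 *v \<beta>) s \<rho> =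
      measure (gaussian 0 (A ** transpose A)) {y. C \<le> stat ((1 / (sqrt s * sqrt (1 - \<rho>\<^sup>2))) *\<^sub>R (R0 *v \<beta> - r)) y}"
      using law[OF \<rho>s] by blast
    interpret prob_space "gaussian 0 (A ** transpose A)"
      using conditioned_det[OF A] by (rule prob_space_gaussian)
    show ?thesis unfolding PA by simp
  qed
  obtain L where L: "0 < L" "\<And>\<beta>. norm (R0 *v \<beta> - r) \<le> L * infdist (X0 *v \<beta>) (null_means X0 R0 r)"
    "\<And>\<beta>. infdist (X0 *v \<beta>) (null_means X0 R0 r) \<le> L * norm (R0 *v \<beta> - r)"
    using infdist_null_means[OF X0 R0] by metis
  have surj0: "surj ((*v) R0)" using R0 by (simp add: full_rank_surjective)
  have null_ne: "null_means X0 R0 r \<noteq> {}"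
  proof -
    obtain \<beta> where "R0 *v \<beta> = r" using surj0 by (metis surj_def)
    then show ?thesis by (auto simp: null_means_def)
  qed
  have alt_iff: "\<mu> \<in> alt_means X0 R0 r \<longleftrightarrow> (\<exists>\<beta>. \<mu> = X0 *v \<beta> \<and> R0 *v \<beta> \<noteq> r)" for \<mu>
  proof -
    have "inj ((*v) X0)" using X0 by (simp add: full_rank_injective)
    then show ?thesis by (auto simp: alt_means_def mean_space_eq null_means_def inj_eq)
  qed
  \<comment> \<open>The infimum of an empty set of reals is unspecified, so every infimum needs an alternative at
    the required distance.\<close>
  have far: "\<exists>\<mu>\<in>alt_means X0 R0 r. B \<le> infdist \<mu> (null_means X0 R0 r)" for B
  proof -
    define u :: "real^'q" where "u = (\<chi> i. 1)"
    have u: "0 < norm u" by (simp add: u_def vec_eq_iff)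
    define t where "t = L * (\<bar>B\<bar> + 1) / norm u"
    have "0 < t" using L(1) u by (simp add: t_def)
    obtain \<beta> where \<beta>: "R0 *v \<beta> = r + t *\<^sub>R u" using surj0 by (metis surj_def)
    then have "norm (R0 *v \<beta> - r) = L * (\<bar>B\<bar> + 1)" using u L(1) by (simp add: t_def)
    then have "\<bar>B\<bar> + 1 \<le> infdist (X0 *v \<beta>) (null_means X0 R0 r)" using L(2)[of \<beta>] L(1) by simp
    moreover have "X0 *v \<beta> \<in> alt_means X0 R0 r" using \<beta> u \<open>0 < t\<close> by (auto simp: alt_iff)
    ultimately show ?thesis by (intro bexI) auto
  qed
  have pos_ne: "{0<..} \<noteq> ({}::real set)" and rho_ne: "{-1<..<1} \<noteq> ({}::real set)" by auto
  have size: "(SUP \<mu>\<in>null_means X0 R0 r. SUP s\<in>{0<..}. SUP \<rho>\<in>{-1<..<1}. P C \<mu> s \<rho>) \<le> c"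
    if "\<And>A. conditioned K A \<Longrightarrow> measure (gaussian 0 (A ** transpose A)) {y. C \<le> stat 0 y} \<le> c" for C c
  proof (intro cSUP_least null_ne pos_ne rho_ne)
    fix \<mu>' and s \<rho> :: real assume \<mu>: "\<mu>' \<in> null_means X0 R0 r" and s: "s \<in> {0<..}" and \<rho>: "\<rho> \<in> {-1<..<1}"
    obtain \<beta> where \<beta>: "\<mu>' = X0 *v \<beta>" "R0 *v \<beta> = r" using \<mu> by (auto simp: null_means_def)
    have "\<bar>\<rho>\<bar> < 1" "0 < s" using s \<rho> by auto
    from law[OF this] obtain A where "conditioned K A"
      "P C \<mu>' s \<rho> = measure (gaussian 0 (A ** transpose A)) {y. C \<le> stat 0 y}"
      using \<beta> by auto
    then show "P C \<mu>' s \<rho> \<le> c" using that by simp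
  qed
  have power: "\<exists>\<eta>>0. \<forall>\<beta> s \<rho>. 0 < s \<longrightarrow> \<bar>\<rho>\<bar> < 1 \<longrightarrow> \<eta> \<le> P C (X0 *v \<beta>) s \<rho>" if C: "0 < C" for C
  proof -
    obtain \<eta> where \<eta>: "0 < \<eta>"
      "\<And>A d. conditioned K A \<Longrightarrow> \<eta> \<le> measure (gaussian 0 (A ** transpose A)) {y. C \<le> stat d y}"
      using rejection_bounded_away_from_zero[OF K C] by blast
    have "\<eta> \<le> P C (X0 *v \<beta>) s \<rho>" if "0 < s" "\<bar>\<rho>\<bar> < 1" for \<beta> s \<rho>
      using law[OF that(2,1)] \<eta>(2) by (metis (no_types))
    then show ?thesis using \<eta>(1) by blast
  qed
  have INF_power: "0 < (INF \<mu>\<in>S. INF s\<in>{0<..}. INF \<rho>\<in>{-1<..<1}. P C \<mu> s \<rho>)"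
    if C: "0 < C" and S: "S \<noteq> {}" "S \<subseteq> range ((*v) X0)" for C S
  proof -
    obtain \<eta> where \<eta>: "0 < \<eta>" "\<And>\<beta> s \<rho>. 0 < s \<Longrightarrow> \<bar>\<rho>\<bar> < 1 \<Longrightarrow> \<eta> \<le> P C (X0 *v \<beta>) s \<rho>"
      using power[OF C] by blast
    have "\<eta> \<le> (INF \<mu>\<in>S. INF s\<in>{0<..}. INF \<rho>\<in>{-1<..<1}. P C \<mu> s \<rho>)"
      using S \<eta>(2) by (intro cINF_greatest pos_ne rho_ne S) (auto simp: abs_less_iff)
    then show ?thesis using \<eta>(1) by simp
  qed
  have consistent: "\<exists>\<kappa>>0. \<forall>\<beta> s \<rho>. 0 < s \<longrightarrow> \<bar>\<rho>\<bar> < 1 \<longrightarrow>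
      \<kappa> \<le> infdist (X0 *v \<beta>) (null_means X0 R0 r) / (sqrt s * sqrt (1 - \<rho>\<^sup>2)) \<longrightarrow> 1 - \<epsilon> \<le> P C (X0 *v \<beta>) s \<rho>"
    if C: "0 < C" and \<epsilon>: "0 < \<epsilon>" for C \<epsilon>
  proof -
    obtain \<kappa> where \<kappa>: "0 < \<kappa>"
      "\<And>A d. conditioned K A \<Longrightarrow> \<kappa> \<le> norm d \<Longrightarrow> 1 - \<epsilon> < measure (gaussian 0 (A ** transpose A)) {y. C \<le> stat d y}"
      using rejection_tendsto_one[OF K C \<epsilon>] by blast
    have "1 - \<epsilon> \<le> P C (X0 *v \<beta>) s \<rho>"
      if s: "0 < s" and \<rho>: "\<bar>\<rho>\<bar> < 1"
        and le: "L * \<kappa> \<le> infdist (X0 *v \<beta>) (null_means X0 R0 r) / (sqrt s * sqrt (1 - \<rho>\<^sup>2))" for \<beta> s \<rho>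
    proof -
      define \<sigma> where "\<sigma> = sqrt s * sqrt (1 - \<rho>\<^sup>2)"
      have \<sigma>: "0 < \<sigma>" using s ar1_scale[OF \<rho>] by (simp add: \<sigma>_def)
      have "L * \<kappa> \<le> L * norm (R0 *v \<beta> - r) / \<sigma>"
        using le[folded \<sigma>_def] divide_right_mono[OF L(3)[of \<beta>], of \<sigma>] \<sigma> by simp
      then have "L * \<kappa> \<le> L * (norm (R0 *v \<beta> - r) / \<sigma>)" by simp
      then have "\<kappa> \<le> norm (R0 *v \<beta> - r) / \<sigma>" using L(1) by (rule mult_left_le_imp_le)
      then have "\<kappa> \<le> norm ((1 / \<sigma>) *\<^sub>R (R0 *v \<beta> - r))" using \<sigma> by simp
      moreover obtain A where "conditioned K A" "P C (X0 *v \<beta>) s \<rho> =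
        measure (gaussian 0 (A ** transpose A)) {y. C \<le> stat ((1 / \<sigma>) *\<^sub>R (R0 *v \<beta> - r)) y}"
        using law[OF \<rho> s, folded \<sigma>_def] by blast
      ultimately show ?thesis using \<kappa>(2) by (metis less_imp_le)
    qed
    then show ?thesis using \<kappa>(1) L(1) by (intro exI[of _ "L * \<kappa>"]) auto
  qed
  have size_power: "(SUP \<mu>\<in>null_means X0 R0 r. SUP s\<in>{0<..}. SUP \<rho>\<in>{-1<..<1}. P C \<mu> s \<rho>) < 1 \<and>
    (INF \<mu>\<in>null_means X0 R0 r. INF s\<in>{0<..}. INF \<rho>\<in>{-1<..<1}. P C \<mu> s \<rho>) > 0" if C: "0 < C" for C
  proof
    obtain \<eta> where \<eta>: "0 < \<eta>"
      "\<And>A. conditioned K A \<Longrightarrow> measure (gaussian 0 (A ** transpose A)) {y. C \<le> stat 0 y} \<le> 1 - \<eta>"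
      using null_rejection_bounded_away_from_one[OF K C] by blast
    from size[OF \<eta>(2)] \<eta>(1)
    show "(SUP \<mu>\<in>null_means X0 R0 r. SUP s\<in>{0<..}. SUP \<rho>\<in>{-1<..<1}. P C \<mu> s \<rho>) < 1" by simp
    show "(INF \<mu>\<in>null_means X0 R0 r. INF s\<in>{0<..}. INF \<rho>\<in>{-1<..<1}. P C \<mu> s \<rho>) > 0"
      using C null_ne by (intro INF_power) (auto simp: null_means_def)
  qed
  have alt_ne: "alt_means X0 R0 r \<noteq> {}" using far[of 0] by auto
  have alt_power: "(INF \<mu>\<in>alt_means X0 R0 r. INF s\<in>{0<..}. INF \<rho>\<in>{-1<..<1}. P C \<mu> s \<rho>) > 0" if C: "0 < C" for C
    using C alt_ne by (intro INF_power) (auto simp: alt_iff)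
  have boundary: "(\<lambda>m. INF (\<mu>, s)\<in>{(\<mu>, s). \<mu> \<in> alt_means X0 R0 r \<and> 0 < s \<and>
        infdist \<mu> (null_means X0 R0 r) / sqrt s \<ge> c}. P C \<mu> s (\<rho> m)) \<longlonglongrightarrow> 1"
    if C: "0 < C" and c: "0 < c" and \<rho>: "\<And>m. \<rho> m \<in> {-1<..<1}" and lim: "(\<lambda>m. \<bar>\<rho> m\<bar>) \<longlonglongrightarrow> 1" for C c \<rho>
  proof (rule tendsto_one_INF)
    have \<rho>': "\<bar>\<rho> m\<bar> < 1" for m using \<rho>[of m] by auto
    let ?S = "{(\<mu>, s). \<mu> \<in> alt_means X0 R0 r \<and> 0 < s \<and> infdist \<mu> (null_means X0 R0 r) / sqrt s \<ge> c}"
    show "0 \<le> (case x of (\<mu>, s) \<Rightarrow> P C \<mu> s (\<rho> m)) \<and> (case x of (\<mu>, s) \<Rightarrow> P C \<mu> s (\<rho> m)) \<le> 1" if "x \<in> ?S" for m x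
      using that P01[OF \<rho>'] by (auto simp: alt_iff)
    obtain \<mu> where "\<mu> \<in> alt_means X0 R0 r" "c \<le> infdist \<mu> (null_means X0 R0 r)" using far by blast
    then have "(\<mu>, 1) \<in> ?S" by simp
    then show "?S \<noteq> {}" by blast
    fix \<epsilon> :: real assume "0 < \<epsilon>"
    from consistent[OF C this] obtain \<kappa> where \<kappa>: "0 < \<kappa>"
      "\<And>\<beta> s \<rho>. 0 < s \<Longrightarrow> \<bar>\<rho>\<bar> < 1 \<Longrightarrow> \<kappa> \<le> infdist (X0 *v \<beta>) (null_means X0 R0 r) / (sqrt s * sqrt (1 - \<rho>\<^sup>2))
        \<Longrightarrow> 1 - \<epsilon> \<le> P C (X0 *v \<beta>) s \<rho>" by blast
    have "(\<lambda>m. sqrt (1 - \<bar>\<rho> m\<bar>\<^sup>2)) \<longlonglongrightarrow> sqrt (1 - 1\<^sup>2)" by (intro tendsto_intros lim)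
    then have "(\<lambda>m. sqrt (1 - (\<rho> m)\<^sup>2)) \<longlonglongrightarrow> 0" by simp
    moreover have "0 < c / \<kappa>" using c \<kappa>(1) by simp
    ultimately have "eventually (\<lambda>m. sqrt (1 - (\<rho> m)\<^sup>2) < c / \<kappa>) sequentially" by (rule order_tendstoD)
    then show "eventually (\<lambda>m. \<forall>x\<in>?S. 1 - \<epsilon> \<le> (case x of (\<mu>, s) \<Rightarrow> P C \<mu> s (\<rho> m))) sequentially"
    proof eventually_elim
      case (elim m)
      have "1 - \<epsilon> \<le> P C \<mu> s (\<rho> m)"
        if \<mu>: "\<mu> \<in> alt_means X0 R0 r" and s: "0 < s" and le: "c \<le> infdist \<mu> (null_means X0 R0 r) / sqrt s" for \<mu> s
      proof -
        obtain \<beta> where \<beta>: "\<mu> = X0 *v \<beta>" using \<mu> by (auto simp: alt_iff)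
        have \<tau>: "0 < sqrt (1 - (\<rho> m)\<^sup>2)" using ar1_scale[OF \<rho>'] by blast
        have "\<kappa> \<le> c / sqrt (1 - (\<rho> m)\<^sup>2)" using elim \<tau> \<kappa>(1) by (simp only: pos_le_divide_eq pos_less_divide_eq mult.commute less_imp_le)
        also have "\<dots> \<le> infdist \<mu> (null_means X0 R0 r) / sqrt s / sqrt (1 - (\<rho> m)\<^sup>2)"
          using le \<tau> by (intro divide_right_mono) auto
        finally show ?thesis unfolding \<beta> by (intro \<kappa>(2) s \<rho>') (simp only: divide_divide_eq_left)
      qed
      then show ?case by auto
    qed
  qed
  have interior: "(\<lambda>m. INF \<mu>\<in>{\<mu> \<in> alt_means X0 R0 r. infdist \<mu> (null_means X0 R0 r) \<ge> c m}.
      INF \<rho>\<in>{-1 + \<epsilon>..1 - \<epsilon>}. P C \<mu> (s m) \<rho>) \<longlonglongrightarrow> 1"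
    if C: "0 < C" and \<epsilon>: "0 < \<epsilon>" "\<epsilon> < 1" and s: "\<And>m. 0 < s m"
      and lim: "filterlim (\<lambda>m. c m / sqrt (s m)) at_top sequentially" for C c \<epsilon> s
  proof (rule tendsto_one_INF)
    have ne: "{-1 + \<epsilon>..1 - \<epsilon>} \<noteq> {}" using \<epsilon> by simp
    have \<rho>': "\<bar>\<rho>\<bar> < 1" if "\<rho> \<in> {-1 + \<epsilon>..1 - \<epsilon>}" for \<rho> using that \<epsilon> by auto
    let ?S = "\<lambda>m. {\<mu> \<in> alt_means X0 R0 r. infdist \<mu> (null_means X0 R0 r) \<ge> c m}"
    let ?f = "\<lambda>m \<mu>. INF \<rho>\<in>{-1 + \<epsilon>..1 - \<epsilon>}. P C \<mu> (s m) \<rho>"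
    show "0 \<le> ?f m \<mu> \<and> ?f m \<mu> \<le> 1" if "\<mu> \<in> ?S m" for m \<mu>
    proof
      obtain \<beta> where \<beta>: "\<mu> = X0 *v \<beta>" using \<open>\<mu> \<in> ?S m\<close> by (auto simp: alt_iff)
      show "0 \<le> ?f m \<mu>" using P01[OF \<rho>' s] unfolding \<beta> by (intro cINF_greatest ne) blast
      have "bdd_below ((\<lambda>\<rho>. P C \<mu> (s m) \<rho>) ` {-1 + \<epsilon>..1 - \<epsilon>})"
        using P01[OF \<rho>' s] unfolding \<beta> by (intro bdd_belowI[of _ 0]) blast
      moreover have "0 \<in> {-1 + \<epsilon>..1 - \<epsilon>}" using \<epsilon> by simp
      ultimately have "?f m \<mu> \<le> P C \<mu> (s m) 0" by (rule cINF_lower)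
      then show "?f m \<mu> \<le> 1" using P01[of 0 "s m" C \<beta>] s unfolding \<beta> by simp
    qed
    show "?S m \<noteq> {}" for m using far[of "c m"] by blast
    fix \<delta> :: real assume "0 < \<delta>"
    from consistent[OF C this] obtain \<kappa> where \<kappa>: "0 < \<kappa>"
      "\<And>\<beta> s \<rho>. 0 < s \<Longrightarrow> \<bar>\<rho>\<bar> < 1 \<Longrightarrow> \<kappa> \<le> infdist (X0 *v \<beta>) (null_means X0 R0 r) / (sqrt s * sqrt (1 - \<rho>\<^sup>2))
        \<Longrightarrow> 1 - \<delta> \<le> P C (X0 *v \<beta>) s \<rho>" by blast
    have "eventually (\<lambda>m. \<kappa> \<le> c m / sqrt (s m)) sequentially"
      using lim by (simp add: filterlim_at_top)
    then show "eventually (\<lambda>m. \<forall>\<mu>\<in>?S m. 1 - \<delta> \<le> ?f m \<mu>) sequentially"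
    proof eventually_elim
      case (elim m)
      have "1 - \<delta> \<le> P C \<mu> (s m) \<rho>" if \<mu>: "\<mu> \<in> ?S m" and \<rho>: "\<rho> \<in> {-1 + \<epsilon>..1 - \<epsilon>}" for \<mu> \<rho>
      proof -
        obtain \<beta> where \<beta>: "\<mu> = X0 *v \<beta>" using \<mu> by (auto simp: alt_iff)
        have \<tau>: "0 < sqrt (1 - \<rho>\<^sup>2)" "sqrt (1 - \<rho>\<^sup>2) \<le> 1" using ar1_scale[OF \<rho>'[OF \<rho>]] by auto
        have "\<kappa> \<le> c m / sqrt (s m)" by (rule elim)
        also have "\<dots> \<le> infdist \<mu> (null_means X0 R0 r) / sqrt (s m)"
          using \<mu> s[of m] by (intro divide_right_mono) auto
        also have "\<dots> \<le> infdist \<mu> (null_means X0 R0 r) / (sqrt (s m) * sqrt (1 - \<rho>\<^sup>2))"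
          using \<tau> s[of m] by (intro divide_left_mono infdist_nonneg) (auto intro!: mult_left_le)
        finally show ?thesis unfolding \<beta> by (intro \<kappa>(2) s \<rho>'[OF \<rho>])
      qed
      then show ?case by (intro ballI cINF_greatest ne) auto
    qed
  qed
  have level: "\<exists>C>0. (SUP \<mu>\<in>null_means X0 R0 r. SUP s\<in>{0<..}. SUP \<rho>\<in>{-1<..<1}. P C \<mu> s \<rho>) \<le> \<delta>"
    if \<delta>: "0 < \<delta>" for \<delta>
  proof -
    obtain C where C: "0 < C"
      "\<And>A. conditioned K A \<Longrightarrow> measure (gaussian 0 (A ** transpose A)) {y. C \<le> stat 0 y} \<le> \<delta>"
      using null_rejection_small[OF K \<delta>] by blast
    show ?thesis using size[OF C(2)] C(1) by blast
  qed
  show ?thesis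
    unfolding size_and_power_bounds_def P_def[symmetric]
    using size_power alt_power boundary interior level by (intro conjI allI impI) auto
qed


section \<open>The augmented designs\<close>

definition join :: "real^'k \<Rightarrow> real \<Rightarrow> real^('k + 1)" where
  "join \<beta> t = (\<chi> j. case j of Inl a \<Rightarrow> \<beta> $ a | Inr _ \<Rightarrow> t)"

lemma join_cases: obtains \<beta> t where "b = join \<beta> t"
proof -
  have "b = join (\<chi> a. b $ Inl a) (b $ Inr 1)"
    by (auto simp: join_def vec_eq_iff split: sum.split)
  then show ?thesis by (rule that)
qed

lemma append_col_join:
  fixes A :: "real^'k^'n"
  shows "append_col A v *v join \<beta> t = A *v \<beta> + t *\<^sub>R v"
proof -
  have "(\<Sum>j\<in>(UNIV :: ('k::finite + 1) set). f j) = (\<Sum>a\<in>(UNIV :: 'k::finite set). f (Inl a)) + f (Inr 1)" for f :: "'k::finite + 1 \<Rightarrow> real"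
  proof -
    have "(UNIV :: 1 set) = {1}" by auto
    then show ?thesis
      by (simp add: UNIV_Plus_UNIV[symmetric] sum.Plus del: UNIV_Plus_UNIV)
  qed
  then show ?thesis
    by (simp add: vec_eq_iff matrix_vector_mult_def append_col_def join_def mult.commute)
qed

lemma rank_append_col:
  fixes A :: "real^'k^'n"
  assumes "rank A = CARD('k)" and v: "v \<notin> mean_space A"
  shows "rank (append_col A v) = CARD('k + 1)"
proof -
  have inj: "inj ((*v) A)" using assms by (simp add: full_rank_injective)
  have "b = 0" if b: "append_col A v *v b = 0" for b
  proof -
    obtain \<beta> t where bt: "b = join \<beta> t" by (rule join_cases)
    have eq: "A *v \<beta> + t *\<^sub>R v = 0" using b by (simp only: bt append_col_join)
    have "t = 0"
    proof (rule ccontr)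
      assume "t \<noteq> 0"
      have "t *\<^sub>R v = A *v (- \<beta>)" using eq by (simp add: matrix_vector_mult_uminus eq_neg_iff_add_eq_0 add.commute)
      then have "v = A *v ((1 / t) *\<^sub>R (- \<beta>))"
        using \<open>t \<noteq> 0\<close> by (metis matrix_vector_mult_scaleR scaleR_scaleR nonzero_divide_eq_eq scaleR_one)
      then show False using v by (simp add: mean_space_eq)
    qed
    moreover have "\<beta> = 0" using eq inj \<open>t = 0\<close> by (metis add.right_neutral injD matrix_vector_mult_0_right scaleR_zero_left)
    ultimately show ?thesis by (auto simp: bt join_def vec_eq_iff split: sum.split)
  qed
  then have "\<exists>B. B ** append_col A v = mat 1" by (simp add: matrix_left_invertible_ker)
  then have "inj ((*v) (append_col A v))" by (simp add: matrix_left_invertible_injective)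
  then show ?thesis by (simp only: full_rank_injective)
qed

lemma size_and_power_bounds_augmented:
  fixes X :: "real^'k^'n::{finite,linorder}" and Xb :: "real^'p^'n::{finite,linorder}" and Rb :: "real^'p^'q"
  assumes X: "rank X = CARD('k)" and R: "rank R = CARD('q)" and w: "admissible_weights TYPE('n) w"
    and Xb: "rank Xb = CARD('p)" and rc: "rank_condition Xb Rb"
    and nested: "\<And>\<beta>. \<exists>b. Xb *v b = X *v \<beta> \<and> Rb *v b = R *v \<beta>"
    and trend: "\<exists>a. Xb *v a = e_plus \<and> Rb *v a = 0" and alternating: "\<exists>a. Xb *v a = e_minus \<and> Rb *v a = 0"
    and S: "\<And>b. R *v (S *v b) = Rb *v b"
  shows "size_and_power_bounds X R r (T_bar w Xb Rb S R r)"
proof -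
  have "surj ((*v) Rb)"
  proof -
    have "\<exists>b. v = Rb *v b" for v
      using R nested by (metis full_rank_surjective surj_def)
    then show ?thesis by (simp add: surj_def)
  qed
  moreover have "positive_definite (weight_matrix w :: real^'n::{finite,linorder}^'n::{finite,linorder})"
    using w by (simp add: admissible_weights_def weight_matrix_def)
  ultimately interpret robust_test Xb Rb w
    using Xb rc by unfold_locales auto
  have "T_bar w Xb Rb S R r = stat (- r)"
    by (rule ext) (simp add: T_bar_def stat_def S Let_def)
  then show ?thesis
    using size_and_power_bounds_stat[OF X R nested trend alternating] by simp
qed

text \<open>The appended column itself is annihilated because its coefficient is not tested; the other trend has
  to be fitted by the augmented design with zero tested coefficients.\<close>

lemma size_and_power_bounds_append_col:
  fixes X :: "real^'k^'n::{finite,linorder}" and R :: "real^'k^'q" and v :: "real^'n::{finite,linorder}"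
  assumes X: "rank X = CARD('k)" and R: "rank R = CARD('q)" and w: "admissible_weights TYPE('n) w"
    and v: "v \<notin> mean_space X" and rc: "rank_condition (append_col X v) (append_col R 0)"
    and trends: "\<And>e. e = e_plus \<or> e = e_minus \<Longrightarrow> e = v \<or> (e \<in> mean_space (append_col X v) \<and> append_col R 0 *v ols (append_col X v) e = 0)"
  shows "size_and_power_bounds X R r (T_bar w (append_col X v) (append_col R 0) (append_col (mat 1) 0) R r)"
proof (rule size_and_power_bounds_augmented[OF X R w rank_append_col[OF X v] rc])
  show "\<exists>b. append_col X v *v b = X *v \<beta> \<and> append_col R 0 *v b = R *v \<beta>" for \<beta>
    by (rule exI[of _ "join \<beta> 0"]) (simp add: append_col_join)
  have "\<exists>a. append_col X v *v a = e \<and> append_col R 0 *v a = 0" if "e = e_plus \<or> e = e_minus" for e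
    using trends[OF that]
  proof
    assume "e = v"
    then show ?thesis by (intro exI[of _ "join 0 1"]) (simp add: append_col_join)
  next
    assume e: "e \<in> mean_space (append_col X v) \<and> append_col R 0 *v ols (append_col X v) e = 0"
    then obtain a where a: "e = append_col X v *v a" by (auto simp: mean_space_eq)
    then have "ols (append_col X v) e = a" using ols_fitted[OF rank_append_col[OF X v]] by simp
    then show ?thesis using e a by auto
  qed
  then show "\<exists>a. append_col X v *v a = e_plus \<and> append_col R 0 *v a = 0"
    "\<exists>a. append_col X v *v a = e_minus \<and> append_col R 0 *v a = 0" by auto
  show "R *v (append_col (mat 1) 0 *v b) = append_col R 0 *v b" for b :: "real^('k + 1)"
    by (rule join_cases[of b]) (simp add: append_col_join)
qed

lemma append_col_fitted:
  fixes X :: "real^'k^'n"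
  assumes X: "rank X = CARD('k)" and v: "v \<notin> mean_space X"
    and e: "e \<in> mean_space X" "R *v ols X e = 0"
  shows "e \<in> mean_space (append_col X v)" and "append_col R 0 *v ols (append_col X v) e = 0"
proof -
  obtain \<beta> where \<beta>: "e = X *v (\<beta> :: real^'k)" using e(1) by (auto simp: mean_space_eq)
  have b: "e = append_col X v *v join \<beta> 0" by (simp add: \<beta> append_col_join)
  then show "e \<in> mean_space (append_col X v)" by (simp add: mean_space_eq)
  have "ols (append_col X v) e = join \<beta> 0" unfolding b by (rule ols_fitted[OF rank_append_col[OF X v]])
  moreover have "ols X e = \<beta>" unfolding \<beta> by (rule ols_fitted[OF X])
  ultimately show "append_col R 0 *v ols (append_col X v) e = 0" using e(2) by (simp add: append_col_join)
qed

lemma mean_space_append_col_rank: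
  fixes X :: "real^'k^'n"
  assumes X: "rank X = CARD('k)" and v: "v \<notin> mean_space X"
    and rank: "rank (append_col (append_col X v) e) = CARD('k) + 1"
  shows "e \<in> mean_space (append_col X v)"
proof (rule ccontr)
  assume "e \<notin> mean_space (append_col X v)"
  then have "rank (append_col (append_col X v) e) = CARD(('k + 1) + 1)"
    by (rule rank_append_col[OF rank_append_col[OF X v]])
  then show False using rank by simp
qed

text \<open>If \<open>e = X \<beta> + t v\<close> lies outside the span of \<open>X\<close>, then \<open>t \<noteq> 0\<close> and the equation can be solved for \<open>v\<close>.\<close>

lemma mean_space_append_col_swap:
  assumes "e \<in> mean_space (append_col X v)" and "e \<notin> mean_space X"
  shows "v \<in> mean_space (append_col X e)"
proof -
  obtain b where "e = append_col X v *v b" using assms(1) by (auto simp: mean_space_eq)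
  then obtain \<beta> t where e: "e = X *v \<beta> + t *\<^sub>R v" by (metis append_col_join join_cases)
  then have "t \<noteq> 0" using assms(2) by (auto simp: mean_space_eq)
  then have "v = append_col X e *v join (- (1 / t) *\<^sub>R \<beta>) (1 / t)"
    unfolding append_col_join matrix_vector_mult_scaleR by (simp add: e scaleR_add_right)
  then show ?thesis by (simp add: mean_space_eq)
qed

theorem theorem3p8:
  fixes X :: "real^'k^'n::{finite,linorder}"
    and R :: "real^'k^'q"
    and r :: "real^'q"
    and w :: "int \<Rightarrow> real"
    and T :: "real^'n::{finite,linorder} \<Rightarrow> real"
    and W :: "real \<Rightarrow> (real^'n::{finite,linorder}) set"
  assumes "CARD('k) < CARD('n)"
    and "rank X = CARD('k)"
    and "rank R = CARD('q)"
    and "admissible_weights TYPE('n) w"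
    and scenario:
      "(e_plus \<in> mean_space X \<and> R *v ols X e_plus = 0 \<and> e_minus \<notin> mean_space X \<and>
        CARD('k) + 1 < CARD('n) \<and>
        rank_condition (append_col X e_minus) (append_col R 0) \<and>
        T = T_bar w (append_col X e_minus) (append_col R 0) (append_col (mat 1) 0) R r)
     \<or> (e_plus \<notin> mean_space X \<and> e_minus \<in> mean_space X \<and> R *v ols X e_minus = 0 \<and>
        CARD('k) + 1 < CARD('n) \<and>
        rank_condition (append_col X e_plus) (append_col R 0) \<and>
        T = T_bar w (append_col X e_plus) (append_col R 0) (append_col (mat 1) 0) R r)
     \<or> (e_plus \<notin> mean_space X \<and> e_minus \<notin> mean_space X \<and>
        rank (append_col (append_col X e_plus) e_minus) = CARD('k) + 2 \<and>
        CARD('k) + 2 < CARD('n) \<and>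
        rank_condition (append_col (append_col X e_plus) e_minus) (append_col (append_col R 0) 0) \<and>
        T = T_bar w (append_col (append_col X e_plus) e_minus) (append_col (append_col R 0) 0)
              (append_col (append_col (mat 1) 0) 0) R r)
     \<or> (e_plus \<notin> mean_space X \<and> e_minus \<notin> mean_space X \<and>
        rank (append_col (append_col X e_plus) e_minus) = CARD('k) + 1 \<and>
        CARD('k) + 1 < CARD('n) \<and>
        rank_condition (append_col X e_plus) (append_col R 0) \<and>
        append_col R 0 *v ols (append_col X e_plus) e_minus = 0 \<and>
        T = T_bar w (append_col X e_plus) (append_col R 0) (append_col (mat 1) 0) R r)
     \<or> (e_plus \<notin> mean_space X \<and> e_minus \<notin> mean_space X \<and>
        rank (append_col (append_col X e_plus) e_minus) = CARD('k) + 1 \<and>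
        CARD('k) + 1 < CARD('n) \<and>
        rank_condition (append_col X e_minus) (append_col R 0) \<and>
        append_col R 0 *v ols (append_col X e_minus) e_plus = 0 \<and>
        T = T_bar w (append_col X e_minus) (append_col R 0) (append_col (mat 1) 0) R r)"
    and W: "W = (\<lambda>C. {y. T y \<ge> C})"
  shows
    "(\<forall>C>0.
        (SUP \<mu>\<in>null_means X R r. SUP s\<in>{0<..}. SUP \<rho>\<in>{-1<..<1}.
           measure (gaussian \<mu> (s *\<^sub>R AR1 \<rho>)) (W C)) < 1 \<and>
        (INF \<mu>\<in>null_means X R r. INF s\<in>{0<..}. INF \<rho>\<in>{-1<..<1}.
           measure (gaussian \<mu> (s *\<^sub>R AR1 \<rho>)) (W C)) > 0) \<and>
     (\<forall>C>0.
        (INF \<mu>\<in>alt_means X R r. INF s\<in>{0<..}. INF \<rho>\<in>{-1<..<1}.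
           measure (gaussian \<mu> (s *\<^sub>R AR1 \<rho>)) (W C)) > 0) \<and>
     (\<forall>C>0.
        (\<forall>c>0. \<forall>\<rho> :: nat \<Rightarrow> real.
           (\<forall>m. \<rho> m \<in> {-1<..<1}) \<longrightarrow> (\<lambda>m. \<bar>\<rho> m\<bar>) \<longlonglongrightarrow> 1 \<longrightarrow>
           (\<lambda>m. INF (\<mu>, s)\<in>{(\<mu>, s). \<mu> \<in> alt_means X R r \<and> 0 < s \<and>
                                      infdist \<mu> (null_means X R r) / sqrt s \<ge> c}.
              measure (gaussian \<mu> (s *\<^sub>R AR1 (\<rho> m))) (W C)) \<longlonglongrightarrow> 1) \<and>
        (\<forall>c :: nat \<Rightarrow> real. \<forall>\<epsilon>. \<forall>s :: nat \<Rightarrow> real.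
           (\<forall>m. 0 < c m) \<longrightarrow> 0 < \<epsilon> \<longrightarrow> \<epsilon> < 1 \<longrightarrow> (\<forall>m. 0 < s m) \<longrightarrow>
           filterlim (\<lambda>m. c m / sqrt (s m)) at_top sequentially \<longrightarrow>
           (\<lambda>m. INF \<mu>\<in>{\<mu> \<in> alt_means X R r. infdist \<mu> (null_means X R r) \<ge> c m}.
                  INF \<rho>\<in>{-1 + \<epsilon>..1 - \<epsilon>}.
                    measure (gaussian \<mu> (s m *\<^sub>R AR1 \<rho>)) (W C)) \<longlonglongrightarrow> 1)) \<and>
     (\<forall>\<delta>. 0 < \<delta> \<and> \<delta> < 1 \<longrightarrow>
        (\<exists>C>0.
           (SUP \<mu>\<in>null_means X R r. SUP s\<in>{0<..}. SUP \<rho>\<in>{-1<..<1}.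
              measure (gaussian \<mu> (s *\<^sub>R AR1 \<rho>)) (W C)) \<le> \<delta>))"
proof -
  note base = assms(2,3,4)
  have "size_and_power_bounds X R r T"
    using scenario
  proof (elim disjE conjE)
    assume p: "e_plus \<in> mean_space X" "R *v ols X e_plus = 0" and m: "e_minus \<notin> mean_space X"
      and rc: "rank_condition (append_col X e_minus) (append_col R 0)"
      and T: "T = T_bar w (append_col X e_minus) (append_col R 0) (append_col (mat 1) 0) R r"
    show ?thesis unfolding T
      by (rule size_and_power_bounds_append_col[OF base m rc])
        (use append_col_fitted[OF assms(2) m p] in auto)
  next
    assume p: "e_plus \<notin> mean_space X" and m: "e_minus \<in> mean_space X" "R *v ols X e_minus = 0"
      and rc: "rank_condition (append_col X e_plus) (append_col R 0)"
      and T: "T = T_bar w (append_col X e_plus) (append_col R 0) (append_col (mat 1) 0) R r"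
    show ?thesis unfolding T
      by (rule size_and_power_bounds_append_col[OF base p rc])
        (use append_col_fitted[OF assms(2) p m] in auto)
  next
    assume rank: "rank (append_col (append_col X e_plus) e_minus) = CARD('k) + 2"
      and rc: "rank_condition (append_col (append_col X e_plus) e_minus) (append_col (append_col R 0) 0)"
      and T: "T = T_bar w (append_col (append_col X e_plus) e_minus) (append_col (append_col R 0) 0)
              (append_col (append_col (mat 1) 0) 0) R r"
    show ?thesis unfolding T
    proof (rule size_and_power_bounds_augmented[OF base _ rc])
      show "rank (append_col (append_col X e_plus) e_minus) = CARD(('k + 1) + 1)" using rank by simp
      show "\<exists>b. append_col (append_col X e_plus) e_minus *v b = X *v \<beta> \<and> append_col (append_col R 0) 0 *v b = R *v \<beta>" for \<beta>
        by (rule exI[of _ "join (join \<beta> 0) 0"]) (simp add: append_col_join)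
      show "\<exists>a. append_col (append_col X e_plus) e_minus *v a = e_plus \<and> append_col (append_col R 0) 0 *v a = 0"
        by (rule exI[of _ "join (join 0 1) 0"]) (simp add: append_col_join)
      show "\<exists>a. append_col (append_col X e_plus) e_minus *v a = e_minus \<and> append_col (append_col R 0) 0 *v a = 0"
        by (rule exI[of _ "join 0 1"]) (simp add: append_col_join)
      show "R *v (append_col (append_col (mat 1) 0) 0 *v b) = append_col (append_col R 0) 0 *v b" for b :: "real^(('k + 1) + 1)"
      proof -
        obtain b' t where "b = join b' t" by (rule join_cases)
        moreover obtain \<beta> t' where "b' = join \<beta> t'" by (rule join_cases)
        ultimately show ?thesis by (simp add: append_col_join)
      qed
    qed
  next
    assume p: "e_plus \<notin> mean_space X"
      and rank: "rank (append_col (append_col X e_plus) e_minus) = CARD('k) + 1"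
      and rc: "rank_condition (append_col X e_plus) (append_col R 0)"
      and zero: "append_col R 0 *v ols (append_col X e_plus) e_minus = 0"
      and T: "T = T_bar w (append_col X e_plus) (append_col R 0) (append_col (mat 1) 0) R r"
    show ?thesis unfolding T
      by (rule size_and_power_bounds_append_col[OF base p rc])
        (use mean_space_append_col_rank[OF assms(2) p rank] zero in auto)
  next
    assume p: "e_plus \<notin> mean_space X" and m: "e_minus \<notin> mean_space X"
      and rank: "rank (append_col (append_col X e_plus) e_minus) = CARD('k) + 1"
      and rc: "rank_condition (append_col X e_minus) (append_col R 0)"
      and zero: "append_col R 0 *v ols (append_col X e_minus) e_plus = 0"
      and T: "T = T_bar w (append_col X e_minus) (append_col R 0) (append_col (mat 1) 0) R r"
    \<comment> \<open>The rank assumption places \<open>e_minus\<close> in the span of \<open>(X, e_plus)\<close>; exchange reverses the roles.\<close>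
    have "e_plus \<in> mean_space (append_col X e_minus)"
      using mean_space_append_col_rank[OF assms(2) p rank] m by (rule mean_space_append_col_swap)
    then show ?thesis unfolding T
      by (intro size_and_power_bounds_append_col[OF base m rc]) (use zero in auto)
  qed
  then show ?thesis
    unfolding size_and_power_bounds_def W .
qed

end
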